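(* Assume that $V\in C^1(\mathbb{R}^N)$ satisfies (V1) there exist $a_-\neq a_+\in\mathbb{R}^N$ such that $V(a_+)=V(a_-)=0$, and $V(x)>0$ for $x\in\mathbb{R}^N\setminus\{a_-,a_+\}$; (V2) $\liminf_{|x|\to+\infty}V(x)=:\nu_0>0$. If $c\in[0,\nu_0)$ is such that condition $(\mathbf{V}^c)$ holds (with sets $\mathcal{V}^c_-,\mathcal{V}^c_+$), then the coercivity condition $$\exists\,R>0\ \text{ s.t. }\ \inf_{q\in\Gamma_c}J_c(q)=\inf\{J_c(q):\ q\in\Gamma_c,\ \|q\|_{L^\infty(\mathbb{R},\mathbb{R}^N)}\le R\}$$ holds true. In particular, for such a value of $c$, there exists a solution $q_c\in C^2(\mathbb{R},\mathbb{R}^N)$ of $\ddot q=\nabla V(q)$ on $\mathbb{R}$ such that $$\inf_{t\in\mathbb{R}}\mathrm{dist}(q_c(t),\mathcal{V}^c_-)=\inf_{t\in\mathbb{R}}\mathrm{dist}(q_c(t),\mathcal{V}^c_+)=0$$ and $E_{q_c}(t):=\tfrac12|\dot q_c(t)|^2-V(q_c(t))=-c$ for all $t\in\mathbb{R}$.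
   Context: $N\ge2$ is an integer. $\mathrm{dist}$ denotes Euclidean distance (point to set, or between sets, as an infimum). $\mathcal{V}^c:=\{x\in\mathbb{R}^N:V(x)\le c\}$. Condition $(\mathbf{V}^c)$: there exist nonempty closed sets $\mathcal{V}^c_-,\mathcal{V}^c_+\subset\mathbb{R}^N$ such that $\mathcal{V}^c=\mathcal{V}^c_-\cup\mathcal{V}^c_+$ and $\mathrm{dist}(\mathcal{V}^c_-,\mathcal{V}^c_+)>0$. $\Gamma_c$ is the set of $q\in H^1_{loc}(\mathbb{R},\mathbb{R}^N)$ (continuous representatives) such that $V(q(t))\ge c$ for all $t\in\mathbb{R}$ and $\liminf_{t\to-\infty}\mathrm{dist}(q(t),\mathcal{V}^c_-)=\liminf_{t\to+\infty}\mathrm{dist}(q(t),\mathcal{V}^c_+)=0$. $J_c(q):=\int_{-\infty}^{+\infty}\tfrac12|\dot q(t)|^2+(V(q(t))-c)\,dt$ for $q\in\Gamma_c$. *)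

theory Defs
  imports "HOL-Analysis.Analysis" "HOL-Probability.Essential_Supremum"
begin

definition grad :: "('a::real_inner \<Rightarrow> real) \<Rightarrow> 'a \<Rightarrow> 'a" where
  "grad V x = (THE D. GDERIV V x :> D)"

definition C1_function :: "('a::real_inner \<Rightarrow> real) \<Rightarrow> bool" where
  "C1_function V \<longleftrightarrow> (\<forall>x. V differentiable (at x)) \<and> continuous_on UNIV (grad V)"

definition velocity :: "(real \<Rightarrow> 'a::real_normed_vector) \<Rightarrow> real \<Rightarrow> 'a" where
  "velocity q t = vector_derivative q (at t)"

definition C2_curve :: "(real \<Rightarrow> 'a::real_normed_vector) \<Rightarrow> bool" where
  "C2_curve q \<longleftrightarrow> q C1_differentiable_on UNIV \<and> velocity q C1_differentiable_on UNIV"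

definition L2_loc :: "(real \<Rightarrow> 'a::euclidean_space) set" where
  "L2_loc = {f. f \<in> borel_measurable lborel \<and>
     (\<forall>a b. set_integrable lborel {a..b} (\<lambda>t. (norm (f t))\<^sup>2))}"

definition test_function :: "(real \<Rightarrow> real) \<Rightarrow> bool" where
  "test_function \<phi> \<longleftrightarrow> \<phi> C1_differentiable_on UNIV \<and> compact (closure {t. \<phi> t \<noteq> 0})"

text \<open>Weak derivatives on the line are tested against compactly supported functions of
  class \<open>C\<^sup>1\<close>, as in Brezis' definition of Sobolev spaces on an interval; for \<open>q\<close>, \<open>g\<close> in
  \<open>L2_loc\<close> smooth test functions would give the same notion by mollification.\<close>

definition is_weak_derivative ::
  "(real \<Rightarrow> 'a::euclidean_space) \<Rightarrow> (real \<Rightarrow> 'a) \<Rightarrow> bool" where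
  "is_weak_derivative q g \<longleftrightarrow>
     (\<forall>\<phi>. test_function \<phi> \<longrightarrow>
       (LINT t|lborel. deriv \<phi> t *\<^sub>R q t) = - (LINT t|lborel. \<phi> t *\<^sub>R g t))"

text \<open>Elements of \<open>H1_loc\<close> are the continuous representatives.\<close>

definition H1_loc :: "(real \<Rightarrow> 'a::euclidean_space) set" where
  "H1_loc = {q. continuous_on UNIV q \<and> q \<in> L2_loc \<and>
     (\<exists>g \<in> L2_loc. is_weak_derivative q g)}"

text \<open>The weak derivative is determined up to a null set.\<close>

definition weak_derivative :: "(real \<Rightarrow> 'a::euclidean_space) \<Rightarrow> real \<Rightarrow> 'a" where
  "weak_derivative q = (SOME g. g \<in> L2_loc \<and> is_weak_derivative q g)"

definition sublevel :: "('a \<Rightarrow> real) \<Rightarrow> real \<Rightarrow> 'a set" where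
  "sublevel V c = {x. V x \<le> c}"

definition splits_sublevel ::
  "('a::euclidean_space \<Rightarrow> real) \<Rightarrow> real \<Rightarrow> 'a set \<Rightarrow> 'a set \<Rightarrow> bool" where
  "splits_sublevel V c Vm Vp \<longleftrightarrow>
     Vm \<noteq> {} \<and> Vp \<noteq> {} \<and> closed Vm \<and> closed Vp \<and>
     sublevel V c = Vm \<union> Vp \<and> setdist Vm Vp > 0"

definition Gam ::
  "('a::euclidean_space \<Rightarrow> real) \<Rightarrow> real \<Rightarrow> 'a set \<Rightarrow> 'a set \<Rightarrow> (real \<Rightarrow> 'a) set" where
  "Gam V c Vm Vp = {q \<in> H1_loc. (\<forall>t. V (q t) \<ge> c) \<and>
     Liminf at_bot (\<lambda>t. ereal (infdist (q t) Vm)) = 0 \<and>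
     Liminf at_top (\<lambda>t. ereal (infdist (q t) Vp)) = 0}"

text \<open>The action may be infinite. On \<open>Gam V c Vm Vp\<close> the integrand is nonnegative, so the
  truncation of negative values by \<open>ennreal\<close> never occurs there.\<close>

definition J ::
  "('a::euclidean_space \<Rightarrow> real) \<Rightarrow> real \<Rightarrow> (real \<Rightarrow> 'a) \<Rightarrow> ennreal" where
  "J V c q = (\<integral>\<^sup>+ t. ennreal (1/2 * (norm (weak_derivative q t))\<^sup>2 + (V (q t) - c)) \<partial>lborel)"

definition Linfty_norm :: "(real \<Rightarrow> 'a::euclidean_space) \<Rightarrow> ereal" where
  "Linfty_norm q = esssup lborel (\<lambda>t. ereal (norm (q t)))"

definition coercive ::
  "('a::euclidean_space \<Rightarrow> real) \<Rightarrow> real \<Rightarrow> 'a set \<Rightarrow> 'a set \<Rightarrow> bool" where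
  "coercive V c Vm Vp \<longleftrightarrow>
     (\<exists>R>0. (INF q \<in> Gam V c Vm Vp. J V c q) =
       (INF q \<in> {q \<in> Gam V c Vm Vp. Linfty_norm q \<le> ereal R}. J V c q))"

definition energy :: "('a::real_normed_vector \<Rightarrow> real) \<Rightarrow> (real \<Rightarrow> 'a) \<Rightarrow> real \<Rightarrow> real" where
  "energy V q t = 1/2 * (norm (velocity q t))\<^sup>2 - V (q t)"

end

(*
The existence part is a direct method that avoids Sobolev spaces. A minimizing sequence of curves
from Vm to Vp for the action of W = max (V - c) 0, with free transit time, is translated in time so
that 0 is the last time at distance d/2 from Vm, d being the distance of the two wells. A
subsequence converges pointwise to a curve of action at most the infimum. Crossing the region
between the wells has a positive cost, so a minimizing curve cannot come close to Vp and then go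
back: the limit is arbitrarily close to Vm in the past and to Vp in the future, and hence minimizes
the action under all perturbations inside {V > c}. Perturbing by hat functions gives Newton's equation,
rescaling time gives the energy identity. If the limit meets a well in finite time, it arrives with
velocity 0, and reflecting it there continues the solution to the whole line.

For the coercivity, V - c is bounded below by some e > 0 outside a ball, so an excursion of length l
outside of this ball costs at least sqrt (2 e) l; curves in Gam of almost minimal action are
therefore uniformly bounded.
*)

theory Submission
  imports Defs "HOL-Complex_Analysis.Great_Picard"
begin

section \<open>Kinetic bounds and the action\<close>

text \<open>The obstacle is loss of compactness: the action is invariant under time shifts on the
  whole line, so a minimizing sequence may converge to a curve resting in one well. The
  normalization fixes distance \<open>d / 2\<close> from \<open>A\<close> at time 0, and a constant
  \<open>\<eta>\<close> independent of the error keeps the past away from \<open>B\<close>. Local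
  compactness then comes from the position at time 0 and the Hoelder estimate given by the kinetic
  energy. Working with \<open>W\<close> makes every action nonnegative and makes motionless waiting
  in a well free: curves extend to all times by constants, and competitors need not respect the
  constraint \<open>V \<ge> c\<close>. The gradient is only continuous, so Newton's equation has no
  uniqueness theorem, and the energy is obtained variationally. Rescaling time on subintervals gives
  \<open>m\<close> the derivative \<open>2 * W (q x)\<close>, which bounds the squared speed. The
  integral of the squared speed is itself a certificate, so minimality excludes strict inequality.
  Hence the speed tends to 0 at a well even where the gradient does not vanish, and the reflected
  curve is checked directly to be a solution.\<close>

text \<open>The function \<open>m\<close> certifies the kinetic energy of \<open>q\<close>: such a bound exists iff \<open>q\<close> is
  absolutely continuous on \<open>{a..b}\<close> with square integrable derivative, the smallest increment of
  \<open>m\<close> being the integral of the squared speed. Unlike derivatives, certificates pass to pointwise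
  limits.\<close>

definition kinetic_bound ::
  "(real \<Rightarrow> 'a::euclidean_space) \<Rightarrow> (real \<Rightarrow> real) \<Rightarrow> real \<Rightarrow> real \<Rightarrow> bool" where
  "kinetic_bound q m a b \<longleftrightarrow>
     (\<forall>s t. a \<le> s \<longrightarrow> s \<le> t \<longrightarrow> t \<le> b \<longrightarrow> (norm (q t - q s))\<^sup>2 \<le> (t - s) * (m t - m s))"

definition action ::
  "('a::euclidean_space \<Rightarrow> real) \<Rightarrow> (real \<Rightarrow> 'a) \<Rightarrow> (real \<Rightarrow> real) \<Rightarrow> real \<Rightarrow> real \<Rightarrow> real" where
  "action W q m a b = (m b - m a) / 2 + integral {a..b} (\<lambda>t. W (q t))"

text \<open>The interval is existentially quantified, so the transit time is free; the rescaling
  argument for the energy depends on this. \<open>C\<close> is only an upper bound, so costs compose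
  without an infimum over curves.\<close>

definition joinable ::
  "('a::euclidean_space \<Rightarrow> real) \<Rightarrow> 'a \<Rightarrow> 'a \<Rightarrow> real \<Rightarrow> bool" where
  "joinable W x y C \<longleftrightarrow>
     (\<exists>q m a b. a \<le> b \<and> kinetic_bound q m a b \<and> q a = x \<and> q b = y \<and> action W q m a b \<le> C)"

lemma kinetic_boundD:
  assumes "kinetic_bound q m a b" "a \<le> s" "s \<le> t" "t \<le> b"
  shows "(norm (q t - q s))\<^sup>2 \<le> (t - s) * (m t - m s)"
  using assms by (simp add: kinetic_bound_def)

lemma kinetic_bound_subinterval:
  assumes "kinetic_bound q m a b" "a \<le> a'" "b' \<le> b"
  shows "kinetic_bound q m a' b'"
  using assms by (auto simp: kinetic_bound_def)

lemma kinetic_bound_mono: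
  assumes "kinetic_bound q m a b" "a \<le> s" "s \<le> t" "t \<le> b"
  shows "m s \<le> m t"
proof (cases "s = t")
  case False
  have "0 \<le> (t - s) * (m t - m s)"
    using kinetic_boundD[OF assms] zero_le_power2 order_trans by blast
  with False assms show ?thesis by (simp add: zero_le_mult_iff)
qed simp

text \<open>Monotonicity of \<open>m\<close> replaces the increment on the subinterval by the total
  one. The constant depends on the kinetic energy alone, which makes families of bounded energy
  equicontinuous.\<close>

lemma kinetic_bound_hoelder:
  assumes "kinetic_bound q m a b" "s \<in> {a..b}" "t \<in> {a..b}"
  shows "norm (q t - q s) \<le> sqrt (\<bar>t - s\<bar> * (m b - m a))"
proof -
  have *: "norm (q v - q u) \<le> sqrt (\<bar>v - u\<bar> * (m b - m a))"
    if "a \<le> u" "u \<le> v" "v \<le> b" for u v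
  proof -
    have "m a \<le> m u" "m v \<le> m b"
      using kinetic_bound_mono[OF assms(1)] that by auto
    then have "(norm (q v - q u))\<^sup>2 \<le> \<bar>v - u\<bar> * (m b - m a)"
      using kinetic_boundD[OF assms(1) that] that
      by (smt (verit, best) mult_left_mono)
    then show ?thesis using real_le_rsqrt by blast
  qed
  show ?thesis
    using *[of s t] *[of t s] assms(2,3) by (cases "s \<le> t") (auto simp: norm_minus_commute abs_minus_commute)
qed

lemma kinetic_bound_continuous:
  assumes "kinetic_bound q m a b"
  shows "continuous_on {a..b} q"
proof (cases "a \<le> b")
  case True
  define C where "C = m b - m a"
  have h: "norm (q t - q s) \<le> sqrt (\<bar>t - s\<bar> * C)" if "s \<in> {a..b}" "t \<in> {a..b}" for s t
    unfolding C_def using kinetic_bound_hoelder[OF assms that] .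
  show ?thesis
    unfolding continuous_on_def
  proof
    fix s assume s: "s \<in> {a..b}"
    have "((\<lambda>t. sqrt (\<bar>t - s\<bar> * C)) \<longlongrightarrow> sqrt (\<bar>s - s\<bar> * C)) (at s within {a..b})"
      by (intro tendsto_intros)
    then have "((\<lambda>t. sqrt (\<bar>t - s\<bar> * C)) \<longlongrightarrow> 0) (at s within {a..b})" by simp
    moreover have "\<forall>\<^sub>F t in at s within {a..b}. norm (q t - q s) \<le> sqrt (\<bar>t - s\<bar> * C)"
      using h[OF s] by (auto simp: eventually_at intro: exI[of _ 1])
    ultimately have "((\<lambda>t. q t - q s) \<longlongrightarrow> 0) (at s within {a..b})"
      by (rule Lim_null_comparison[rotated])
    then show "(q \<longlongrightarrow> q s) (at s within {a..b})"
      using LIM_zero_iff by blast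
  qed
qed simp

text \<open>The cross term is a product of square roots that regroups into
  \<open>\<alpha> * l\<close> and \<open>\<beta> * k\<close>, to which the inequality of the means
  applies. This is what lets kinetic bounds on adjacent intervals be glued.\<close>

lemma power2_norm_add_le:
  fixes x y :: "'a::real_inner"
  assumes x: "(norm x)\<^sup>2 \<le> \<alpha> * k" and y: "(norm y)\<^sup>2 \<le> \<beta> * l" and nn: "0 \<le> \<alpha>" "0 \<le> \<beta>" "0 \<le> k" "0 \<le> l"
  shows "(norm (x + y))\<^sup>2 \<le> (\<alpha> + \<beta>) * (k + l)"
proof -
  have "norm x * norm y \<le> sqrt (\<alpha> * k) * sqrt (\<beta> * l)"
    using x y by (intro mult_mono) (auto intro: real_le_rsqrt simp: nn)
  also have "\<dots> = sqrt (\<alpha> * l) * sqrt (\<beta> * k)"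
    by (simp flip: real_sqrt_mult add: mult_ac)
  also have "2 * \<dots> \<le> \<alpha> * l + \<beta> * k"
    using sum_squares_bound[of "sqrt (\<alpha> * l)" "sqrt (\<beta> * k)"] nn by simp
  finally have "2 * (norm x * norm y) \<le> \<alpha> * l + \<beta> * k" by simp
  moreover have "(norm (x + y))\<^sup>2 \<le> (norm x + norm y)\<^sup>2"
    by (intro power_mono norm_triangle_ineq) simp
  ultimately show ?thesis
    using x y by (simp add: power2_sum algebra_simps)
qed

lemma kinetic_bound_join:
  assumes 1: "kinetic_bound q m a b" and 2: "kinetic_bound q m b c"
  shows "kinetic_bound q m a c"
  unfolding kinetic_bound_def
proof (intro allI impI)
  fix s t assume st: "a \<le> s" "s \<le> t" "t \<le> c"
  consider "t \<le> b" | "b \<le> s" | "s \<le> b" "b \<le> t" by linarith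
  then show "(norm (q t - q s))\<^sup>2 \<le> (t - s) * (m t - m s)"
  proof cases
    case 1 then show ?thesis using kinetic_boundD[OF assms(1)] st by blast
  next
    case 2 then show ?thesis using kinetic_boundD[OF assms(2)] st by blast
  next
    case 3
    have "(norm ((q b - q s) + (q t - q b)))\<^sup>2 \<le> ((b - s) + (t - b)) * ((m b - m s) + (m t - m b))"
      using 3 st kinetic_boundD[OF 1, of s b] kinetic_boundD[OF 2, of b t]
        kinetic_bound_mono[OF 1, of s b] kinetic_bound_mono[OF 2, of b t]
      by (intro power2_norm_add_le) auto
    then show ?thesis by simp
  qed
qed

lemma kinetic_bound_cong:
  assumes "kinetic_bound q m a b" "\<And>t. t \<in> {a..b} \<Longrightarrow> q' t = q t"
    "\<And>t. t \<in> {a..b} \<Longrightarrow> m' t = m t + d"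
  shows "kinetic_bound q' m' a b"
  using assms by (auto simp: kinetic_bound_def)

lemma kinetic_bound_reparametrize:
  assumes "kinetic_bound q m (r * a + d) (r * b + d)" "r > 0"
  shows "kinetic_bound (\<lambda>t. q (r * t + d)) (\<lambda>t. r * m (r * t + d)) a b"
  unfolding kinetic_bound_def
proof (intro allI impI)
  fix s t assume "a \<le> s" "s \<le> t" "t \<le> b"
  then have "(norm (q (r * t + d) - q (r * s + d)))\<^sup>2
      \<le> (r * t + d - (r * s + d)) * (m (r * t + d) - m (r * s + d))"
    using assms by (intro kinetic_boundD[OF assms(1)]) auto
  then show "(norm (q (r * t + d) - q (r * s + d)))\<^sup>2
      \<le> (t - s) * (r * m (r * t + d) - r * m (r * s + d))"
    by (simp add: algebra_simps)
qed

lemma integral_affine_substitution: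
  fixes f :: "real \<Rightarrow> real"
  assumes "r > 0" "a \<le> b"
  shows "integral {a..b} (\<lambda>t. f (r * t + d)) = integral {r * a + d..r * b + d} f / r"
proof -
  have im: "(\<lambda>x. (1 / r) *\<^sub>R x + - ((1 / r) *\<^sub>R d)) ` cbox (r * a + d) (r * b + d) = cbox a b"
    using assms by (subst image_affinity_cbox) (auto simp: field_simps)
  show ?thesis
  proof (cases "f integrable_on {r * a + d..r * b + d}")
    case True
    have "((\<lambda>x. f (r *\<^sub>R x + d)) has_integral (1 / \<bar>r\<bar> ^ DIM(real)) *\<^sub>R integral {r * a + d..r * b + d} f)
       ((\<lambda>x. (1 / r) *\<^sub>R x + - ((1 / r) *\<^sub>R d)) ` cbox (r * a + d) (r * b + d))"
      using assms True by (intro has_integral_affinity) auto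
    then show ?thesis using assms unfolding im by (simp add: integral_unique)
  next
    \<comment> \<open>Both integrals then have the default value 0: integrability of the substituted
      function would come back through the inverse substitution.\<close>
    case False
    have "\<not> (\<lambda>t. f (r * t + d)) integrable_on {a..b}"
    proof
      assume "(\<lambda>t. f (r * t + d)) integrable_on {a..b}"
      then have "(\<lambda>x. f (r * ((1 / r) *\<^sub>R x + - (d / r)) + d)) integrable_on
          (\<lambda>x. (1 / (1 / r)) *\<^sub>R x + - ((1 / (1 / r)) *\<^sub>R (- (d / r)))) ` cbox a b"
        using assms by (intro integrable_affinity) auto
      moreover have "(\<lambda>x. (1 / (1 / r)) *\<^sub>R x + - ((1 / (1 / r)) *\<^sub>R (- (d / r)))) ` cbox a b
          = {r * a + d..r * b + d}"
        using assms by (subst image_affinity_cbox) auto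
      ultimately show False using False assms by (simp add: field_simps)
    qed
    with False show ?thesis by (simp add: not_integrable_integral)
  qed
qed

lemma action_reparametrize:
  assumes "r > 0" "a \<le> b"
  shows "action W (\<lambda>t. q (r * t + d)) (\<lambda>t. r * m (r * t + d)) a b
    = r * (m (r * b + d) - m (r * a + d)) / 2 + integral {r * a + d..r * b + d} (\<lambda>t. W (q t)) / r"
  using integral_affine_substitution[OF assms, of "\<lambda>t. W (q t)" d]
  by (simp add: action_def algebra_simps)

lemma action_cong:
  assumes "a \<le> b" "\<And>t. t \<in> {a..b} \<Longrightarrow> q' t = q t"
    "\<And>t. t \<in> {a..b} \<Longrightarrow> m' t = m t + d"
  shows "action W q' m' a b = action W q m a b"
proof -
  have "integral {a..b} (\<lambda>t. W (q' t)) = integral {a..b} (\<lambda>t. W (q t))"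
    by (rule Henstock_Kurzweil_Integration.integral_cong) (simp add: assms)
  then show ?thesis using assms by (simp add: action_def)
qed

lemma joinableI:
  "a \<le> b \<Longrightarrow> kinetic_bound q m a b \<Longrightarrow> action W q m a b \<le> C \<Longrightarrow> joinable W (q a) (q b) C"
  unfolding joinable_def by blast

lemma joinable_mono: "joinable W x y C \<Longrightarrow> C \<le> D \<Longrightarrow> joinable W x y D"
  unfolding joinable_def by (blast intro: order_trans)

text \<open>The segment is run in unit time at constant speed, so its certificate is linear and
  exact.\<close>

lemma joinable_segment:
  assumes W: "\<And>z. z \<in> closed_segment x y \<Longrightarrow> W z \<le> w" and cont: "continuous_on UNIV W"
  shows "joinable W x y ((norm (y - x))\<^sup>2 / 2 + w)"
proof -
  define q where "q = (\<lambda>t::real. x + t *\<^sub>R (y - x))"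
  define m where "m = (\<lambda>t::real. t * (norm (y - x))\<^sup>2)"
  have q: "q t - q s = (t - s) *\<^sub>R (y - x)" for t s
    by (simp add: q_def algebra_simps)
  have "(norm (q t - q s))\<^sup>2 = (t - s) * (m t - m s)" for t s
    unfolding q by (simp add: m_def power_mult_distrib flip: left_diff_distrib)
      (simp add: power2_eq_square)
  then have k: "kinetic_bound q m 0 1" by (simp add: kinetic_bound_def)
  have "q t \<in> closed_segment x y" if "t \<in> {0..1}" for t
    using that by (auto simp: closed_segment_def q_def algebra_simps intro!: exI[of _ t])
  moreover have "continuous_on {0..1} (\<lambda>t. W (q t))"
    by (rule continuous_on_compose2[OF cont]) (auto simp: q_def intro!: continuous_intros)
  ultimately have "integral {0..1} (\<lambda>t. W (q t)) \<le> integral {0..1} (\<lambda>t::real. w)"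
    by (intro integral_le integrable_continuous_real W) auto
  then have "action W q m 0 1 \<le> (norm (y - x))\<^sup>2 / 2 + w"
    by (simp add: action_def m_def)
  then show ?thesis
    using joinableI[OF _ k, of W] by (simp add: q_def)
qed

context
  fixes W :: "'a::euclidean_space \<Rightarrow> real"
  assumes W_cont: "continuous_on UNIV W" and W_nonneg: "\<And>x. 0 \<le> W x"
begin

lemma potential_integrable:
  assumes "kinetic_bound q m a b"
  shows "(\<lambda>t. W (q t)) integrable_on {a..b}"
  by (intro integrable_continuous_real continuous_on_compose2[OF W_cont kinetic_bound_continuous[OF assms]]) auto

lemma action_nonneg:
  assumes "kinetic_bound q m a b" "a \<le> b"
  shows "0 \<le> action W q m a b"
proof -
  have "0 \<le> integral {a..b} (\<lambda>t. W (q t))"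
    using W_nonneg by (intro Henstock_Kurzweil_Integration.integral_nonneg potential_integrable[OF assms(1)]) auto
  then show ?thesis
    using kinetic_bound_mono[OF assms(1), of a b] assms(2) by (simp add: action_def)
qed

lemma action_split:
  assumes "kinetic_bound q m a c" "a \<le> b" "b \<le> c"
  shows "action W q m a c = action W q m a b + action W q m b c"
  using Henstock_Kurzweil_Integration.integral_combine[OF assms(2,3) potential_integrable[OF assms(1)]]
  by (simp add: action_def field_simps)

lemma action_subinterval:
  assumes "kinetic_bound q m a b" "a \<le> a'" "a' \<le> b'" "b' \<le> b"
  shows "action W q m a' b' \<le> action W q m a b"
proof -
  have "action W q m a b = action W q m a a' + (action W q m a' b' + action W q m b' b)"
    using assms kinetic_bound_subinterval[OF assms(1)]
    by (subst action_split[of q m a b a']; (subst action_split[of q m a' b b'])?) auto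
  moreover have "0 \<le> action W q m a a'" "0 \<le> action W q m b' b"
    using assms by (auto intro!: action_nonneg kinetic_bound_subinterval[OF assms(1)])
  ultimately show ?thesis by simp
qed

lemma joinable_trans:
  assumes "joinable W x y C" "joinable W y z D"
  shows "joinable W x z (C + D)"
proof -
  obtain q m a b where 1: "a \<le> b" "kinetic_bound q m a b" "q a = x" "q b = y" "action W q m a b \<le> C"
    using assms(1) by (auto simp: joinable_def)
  obtain p l c d where 2: "c \<le> d" "kinetic_bound p l c d" "p c = y" "p d = z" "action W p l c d \<le> D"
    using assms(2) by (auto simp: joinable_def)
  define e where "e = b + (d - c)"
  define p' l' where "p' = (\<lambda>t. p (1 * t + (c - b)))" and "l' = (\<lambda>t. 1 * l (1 * t + (c - b)))"
  have "b \<le> e" using 2 by (simp add: e_def)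
  have p': "kinetic_bound p' l' b e"
    unfolding p'_def l'_def using 2 by (intro kinetic_bound_reparametrize) (auto simp: e_def)
  have ap': "action W p' l' b e = action W p l c d"
    unfolding p'_def l'_def using 2 \<open>b \<le> e\<close>
    by (subst action_reparametrize) (auto simp: e_def action_def)
  \<comment> \<open>The certificate of the second piece is shifted by a constant to match the first
    one at \<open>b\<close>; only increments of certificates matter.\<close>
  define Q where "Q = (\<lambda>t. if t \<le> b then q t else p' t)"
  define M where "M = (\<lambda>t. if t \<le> b then m t else l' t + (m b - l' b))"
  have Q: "Q t = p' t" if "t \<in> {b..e}" for t
    using that 1 2 by (auto simp: Q_def p'_def)
  have M: "M t = l' t + (m b - l' b)" if "t \<in> {b..e}" for t
    using that by (auto simp: M_def)
  have k: "kinetic_bound Q M a b" "kinetic_bound Q M b e"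
    using kinetic_bound_cong[OF 1(2), of Q M 0] kinetic_bound_cong[OF p' Q M]
    by (auto simp: Q_def M_def)
  have "action W Q M a b = action W q m a b"
    by (rule action_cong[where d = 0]) (use 1 in \<open>auto simp: Q_def M_def\<close>)
  moreover have "action W Q M b e = action W p' l' b e"
    by (rule action_cong[OF \<open>b \<le> e\<close> Q M])
  moreover have K: "kinetic_bound Q M a e" using kinetic_bound_join k by blast
  ultimately have "action W Q M a e \<le> C + D"
    using action_split[OF K 1(1) \<open>b \<le> e\<close>] 1 2 ap' by simp
  moreover have "Q a = x" "Q e = z"
    using 1 Q[of e] \<open>b \<le> e\<close> 2 by (auto simp: Q_def p'_def e_def)
  ultimately show ?thesis
    using joinableI[OF _ K] 1(1) \<open>b \<le> e\<close> by fastforce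
qed

text \<open>The inequality of the means for kinetic and potential energy: the action dominates the
  Jacobi length, whatever the transit time. This prices every crossing between the wells.\<close>

lemma crossing_cost:
  assumes k: "kinetic_bound q m s t" and "s \<le> t" and w: "0 \<le> w" "\<And>u. u \<in> {s..t} \<Longrightarrow> w \<le> W (q u)"
  shows "sqrt (2 * w) * norm (q t - q s) \<le> action W q m s t"
proof -
  define n h \<mu> where "n = norm (q t - q s)" and "h = t - s" and "\<mu> = m t - m s"
  have n: "n\<^sup>2 \<le> h * \<mu>" using kinetic_boundD[OF k, of s t] assms(2) by (simp add: n_def h_def \<mu>_def)
  have nn: "0 \<le> h" "0 \<le> \<mu>" using assms(2) kinetic_bound_mono[OF k, of s t] by (auto simp: h_def \<mu>_def)
  have "integral {s..t} (\<lambda>u. w) \<le> integral {s..t} (\<lambda>u. W (q u))"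
    using w by (intro integral_le potential_integrable[OF k]) auto
  then have P: "\<mu> / 2 + w * h \<le> action W q m s t"
    using assms(2) by (simp add: action_def \<mu>_def h_def mult.commute)
  have "sqrt (2 * w) * n \<le> sqrt (2 * w) * sqrt (h * \<mu>)"
    using n w by (intro mult_left_mono real_le_rsqrt) auto
  also have "\<dots> = 2 * (sqrt (w * h) * sqrt (\<mu> / 2))"
    by (simp add: real_sqrt_mult real_sqrt_divide field_simps)
  also have "\<dots> \<le> w * h + \<mu> / 2"
    using sum_squares_bound[of "sqrt (w * h)" "sqrt (\<mu> / 2)"] nn w by simp
  finally show ?thesis using P by (simp add: n_def)
qed

end

section \<open>Potentials with two separated wells\<close>

text \<open>\<open>large_at_infinity\<close> expresses that the liminf of \<open>V\<close> at
  infinity exceeds \<open>c\<close>; it makes both wells compact.\<close>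

locale split_potential =
  fixes V :: "'a::euclidean_space \<Rightarrow> real" and c :: real and A B :: "'a set"
  assumes V_cont: "continuous_on UNIV V"
    and wells: "A \<noteq> {}" "B \<noteq> {}" "closed A" "closed B"
    and sublevel_eq: "{x. V x \<le> c} = A \<union> B"
    and separated: "setdist A B > 0"
    and large_at_infinity: "\<exists>R e. e > 0 \<and> (\<forall>x. R \<le> norm x \<longrightarrow> c + e \<le> V x)"
begin

abbreviation d :: real where "d \<equiv> setdist A B"

definition W :: "'a \<Rightarrow> real" where "W x = max (V x - c) 0"

lemma W_continuous: "continuous_on UNIV W"
  unfolding W_def by (intro continuous_intros V_cont)

lemma W_nonneg: "0 \<le> W x"
  by (simp add: W_def)

lemma in_wells_iff: "x \<in> A \<or> x \<in> B \<longleftrightarrow> V x \<le> c"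
  using sublevel_eq by blast

lemma W_eq_0: "x \<in> A \<or> x \<in> B \<Longrightarrow> W x = 0"
  by (simp add: W_def in_wells_iff)

lemma W_eq: "x \<notin> A \<Longrightarrow> x \<notin> B \<Longrightarrow> W x = V x - c \<and> W x > 0"
  using in_wells_iff[of x] by (auto simp: W_def)

lemmas W_pot = W_continuous W_nonneg

lemma bounded_wells: "bounded (A \<union> B)"
proof -
  obtain R e where "e > 0" "\<And>x. R \<le> norm x \<Longrightarrow> c + e \<le> V x"
    using large_at_infinity by blast
  then have "norm x \<le> R" if "x \<in> A \<union> B" for x
    using that in_wells_iff[of x] by (smt (verit) UnE)
  then show ?thesis by (auto simp: bounded_iff)
qed

lemma compact_wells: "compact A" "compact B" "compact (A \<union> B)"
  using bounded_wells wells by (auto simp: compact_eq_bounded_closed)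

lemma infdist_wells_add: "d \<le> infdist x A + infdist x B"
proof -
  obtain y z where y: "y \<in> A" "infdist x A = dist x y" and z: "z \<in> B" "infdist x B = dist x z"
    using wells by (metis infdist_attains_inf)
  have "d \<le> dist y z" by (rule setdist_le_dist) fact+
  also have "\<dots> \<le> infdist x A + infdist x B"
    unfolding y z using dist_triangle2[of y z x] by (simp add: dist_commute)
  finally show ?thesis .
qed

lemma infdist_wells: "x \<in> A \<Longrightarrow> d \<le> infdist x B" "x \<in> B \<Longrightarrow> d \<le> infdist x A"
  using infdist_wells_add[of x] by auto

text \<open>In a large ball the points away from both wells form a compact set on which
  \<open>W\<close> is positive; outside the ball the gap \<open>e\<close> takes over.\<close>

lemma W_bounded_below:
  assumes "\<eta> > 0"
  obtains w where "w > 0" "\<And>x. \<eta> \<le> infdist x A \<Longrightarrow> \<eta> \<le> infdist x B \<Longrightarrow> w \<le> W x"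
proof -
  obtain R e where e: "e > 0" "\<And>x. R \<le> norm x \<Longrightarrow> c + e \<le> V x"
    using large_at_infinity by blast
  define K where "K = cball 0 R \<inter> {x. \<eta> \<le> infdist x A} \<inter> {x. \<eta> \<le> infdist x B}"
  have "compact K"
    unfolding K_def
    by (intro compact_Int_closed compact_cball closed_Collect_le continuous_intros)
  have far: "e \<le> W x" if "x \<notin> cball 0 R" for x
    using e(2)[of x] that by (auto simp: W_def)
  show ?thesis
  proof (cases "K = {}")
    case True
    then have "e \<le> W x" if "\<eta> \<le> infdist x A" "\<eta> \<le> infdist x B" for x
      using far[of x] that by (fastforce simp: K_def)
    then show ?thesis using e that by blast
  next
    case False
    obtain z where z: "z \<in> K" "\<And>x. x \<in> K \<Longrightarrow> W z \<le> W x"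
      using continuous_attains_inf[OF \<open>compact K\<close> False continuous_on_subset[OF W_continuous]] by auto
    have "z \<notin> A" "z \<notin> B" using z assms by (auto simp: K_def)
    then have "0 < W z" using W_eq by blast
    moreover have "min e (W z) \<le> W x" if "\<eta> \<le> infdist x A" "\<eta> \<le> infdist x B" for x
      using far[of x] z(2)[of x] that by (auto simp: K_def min_le_iff_disj)
    ultimately show ?thesis using e by (intro that[of "min e (W z)"]) auto
  qed
qed

text \<open>A short segment run in unit time: half of \<open>\<rho>\<close> pays for the motion, the
  other half for the potential, which vanishes on the wells and is uniformly continuous near them.
  Both directions occur, since competitors leave \<open>A\<close> and enter
  \<open>B\<close>.\<close>

lemma joinable_near_wells:
  assumes "\<rho> > 0"
  obtains \<eta> where "\<eta> > 0"
    "\<And>x y. y \<in> A \<union> B \<Longrightarrow> dist x y \<le> \<eta> \<Longrightarrow> joinable W x y \<rho> \<and> joinable W y x \<rho>"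
proof -
  define K where "K = {x. infdist x (A \<union> B) \<le> 1}"
  have "compact K"
    unfolding K_def using compact_wells wells by (intro compact_infdist_le) auto
  then have "uniformly_continuous_on K W"
    using compact_uniformly_continuous continuous_on_subset[OF W_continuous] by blast
  then obtain \<delta> where \<delta>: "\<delta> > 0" "\<And>x y. x \<in> K \<Longrightarrow> y \<in> K \<Longrightarrow> dist x y < \<delta> \<Longrightarrow> dist (W x) (W y) < \<rho> / 2"
    unfolding uniformly_continuous_on_def using assms by (metis half_gt_zero_iff)
  \<comment> \<open>The bound 1 keeps the segment inside \<open>K\<close> and makes the square of
    \<open>\<eta>\<close> at most \<open>\<eta>\<close>, hence at most
    \<open>\<rho>\<close>.\<close>
  define \<eta> where "\<eta> = min (\<delta> / 2) (min 1 \<rho>)"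
  have \<eta>: "\<eta> > 0" "\<eta> < \<delta>" "\<eta> \<le> 1" "\<eta> \<le> \<rho>" using \<delta> assms by (auto simp: \<eta>_def)
  have small: "W z \<le> \<rho> / 2" if "y \<in> A \<union> B" "dist z y \<le> \<eta>" for y z
  proof -
    have "infdist z (A \<union> B) \<le> 1" using infdist_le[OF that(1), of z] that \<eta> by simp
    moreover have "y \<in> K" using that by (simp add: K_def)
    ultimately have "dist (W z) (W y) < \<rho> / 2"
      using \<delta>(2)[of z y] that \<eta> by (simp add: K_def)
    moreover have "W y = 0" using W_eq_0 that by blast
    ultimately show ?thesis by (simp add: dist_real_def)
  qed
  have "joinable W x y \<rho> \<and> joinable W y x \<rho>" if y: "y \<in> A \<union> B" "dist x y \<le> \<eta>" for x y
  proof -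
    have "W z \<le> \<rho> / 2" if "z \<in> closed_segment x y" for z
    proof (rule small[OF y(1)])
      have "dist z y \<le> dist x y"
        using dist_in_closed_segment[OF that] by (simp add: dist_commute)
      then show "dist z y \<le> \<eta>" using y by simp
    qed
    then have W: "W z \<le> \<rho> / 2" if "z \<in> closed_segment x y \<or> z \<in> closed_segment y x" for z
      using that by (simp add: closed_segment_commute)
    have "(dist x y)\<^sup>2 \<le> \<eta>\<^sup>2" using y by (intro power_mono) auto
    also have "\<dots> \<le> \<eta>" using \<eta> by (simp add: power2_eq_square mult_left_le)
    finally have "(norm (y - x))\<^sup>2 / 2 + \<rho> / 2 \<le> \<rho>" "(norm (x - y))\<^sup>2 / 2 + \<rho> / 2 \<le> \<rho>"
      using \<eta> by (auto simp: dist_norm norm_minus_commute)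
    moreover have "joinable W x y ((norm (y - x))\<^sup>2 / 2 + \<rho> / 2)" "joinable W y x ((norm (x - y))\<^sup>2 / 2 + \<rho> / 2)"
      using W by (auto intro!: joinable_segment W_continuous)
    ultimately show ?thesis using joinable_mono by blast
  qed
  then show ?thesis using \<eta>(1) by (intro that[of \<eta>]) blast+
qed

text \<open>The value of the problem with free transit time. The curves may enter the region where
  \<open>V\<close> is below \<open>c\<close>, unlike those of \<open>Gam\<close>.\<close>

definition mu :: real where "mu = Inf {C. \<exists>x\<in>A. \<exists>y\<in>B. joinable W x y C}"

lemma joinable_nonneg: "joinable W x y C \<Longrightarrow> 0 \<le> C"
  unfolding joinable_def using action_nonneg[OF W_pot] by (meson order_trans)

lemma mu_le: "x \<in> A \<Longrightarrow> y \<in> B \<Longrightarrow> joinable W x y C \<Longrightarrow> mu \<le> C"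
  unfolding mu_def by (rule cInf_lower) (auto intro!: bdd_belowI[of _ 0] dest: joinable_nonneg)

lemma mu_approx:
  assumes "e > 0"
  obtains x y where "x \<in> A" "y \<in> B" "joinable W x y (mu + e)"
proof -
  obtain x y where xy: "x \<in> A" "y \<in> B" using wells by blast
  obtain z where "z \<in> closed_segment x y" "\<And>u. u \<in> closed_segment x y \<Longrightarrow> W u \<le> W z"
    using continuous_attains_sup[OF compact_segment _ continuous_on_subset[OF W_continuous], of x y]
    by (metis empty_iff ends_in_segment(1) subset_UNIV)
  then have "\<exists>C. joinable W x y C" using joinable_segment W_continuous by blast
  then have "{C. \<exists>x\<in>A. \<exists>y\<in>B. joinable W x y C} \<noteq> {}" using xy by blast
  from cInf_lessD[OF this, of "mu + e"] assms show ?thesis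
    unfolding mu_def[symmetric] by (auto intro: that joinable_mono[OF _ less_imp_le])
qed

text \<open>The curve is normalised in time so that 0 is the last time at distance \<open>d / 2\<close> from \<open>A\<close>.\<close>

lemma normalized_minimizing_curve:
  assumes "e > 0"
  obtains q m a b where "a \<le> 0" "0 \<le> b" "\<And>s t. kinetic_bound q m s t"
    "\<And>t. t \<le> a \<Longrightarrow> q t \<in> A \<and> m t = m a" "\<And>t. b \<le> t \<Longrightarrow> q t \<in> B \<and> m t = m b" "m 0 = 0"
    "action W q m a b \<le> mu + e"
    "infdist (q 0) A = d / 2" "\<And>t. 0 \<le> t \<Longrightarrow> d / 2 \<le> infdist (q t) A"
proof -
  obtain q0 m0 a b where ab: "a \<le> b" and k0: "kinetic_bound q0 m0 a b" and ends: "q0 a \<in> A" "q0 b \<in> B"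
    and act: "action W q0 m0 a b \<le> mu + e"
    using mu_approx[OF assms] unfolding joinable_def by metis
  \<comment> \<open>Clamping time freezes the curve at its end points in the wells. It is monotone
    and 1-Lipschitz, so the kinetic bound extends to all times.\<close>
  define cl where "cl t = max a (min b t)" for t
  have cl: "a \<le> cl t" "cl t \<le> b" "s \<le> t \<Longrightarrow> cl s \<le> cl t" "s \<le> t \<Longrightarrow> cl t - cl s \<le> t - s"
    "t \<le> a \<Longrightarrow> cl t = a" "b \<le> t \<Longrightarrow> cl t = b" "t \<in> {a..b} \<Longrightarrow> cl t = t" for s t
    using ab by (auto simp: cl_def max_def min_def)
  define q1 where "q1 t = q0 (cl t)" for t
  define m1 where "m1 t = m0 (cl t)" for t
  have k1: "kinetic_bound q1 m1 s t" for s t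
    unfolding kinetic_bound_def
  proof (intro allI impI)
    fix u v assume "s \<le> u" "u \<le> v" "v \<le> t"
    have "(norm (q1 v - q1 u))\<^sup>2 \<le> (cl v - cl u) * (m1 v - m1 u)"
      unfolding q1_def m1_def using cl \<open>u \<le> v\<close> by (intro kinetic_boundD[OF k0]) auto
    also have "\<dots> \<le> (v - u) * (m1 v - m1 u)"
      using cl \<open>u \<le> v\<close> kinetic_bound_mono[OF k0, of "cl u" "cl v"]
      by (intro mult_right_mono) (auto simp: m1_def)
    finally show "(norm (q1 v - q1 u))\<^sup>2 \<le> (v - u) * (m1 v - m1 u)" .
  qed
  have act1: "action W q1 m1 a b = action W q0 m0 a b"
    by (rule action_cong[OF ab, where d = 0]) (auto simp: q1_def m1_def cl)
  define f where "f t = infdist (q1 t) A" for t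
  have f_cont: "continuous_on {s..t} f" for s t
    unfolding f_def by (intro continuous_intros kinetic_bound_continuous[OF k1])
  have f_far: "d \<le> f t" if "b \<le> t" for t
    using that ends(2) infdist_wells(2) by (simp add: f_def q1_def cl)
  have "compact {t \<in> {a..b}. f t \<in> {..d / 2}}"
  proof -
    have "closed ({a..b} \<inter> f -` {..d / 2})"
      by (intro continuous_closed_preimage f_cont) auto
    then have "compact ({a..b} \<inter> ({a..b} \<inter> f -` {..d / 2}))"
      by (intro compact_Int_closed) auto
    moreover have "{a..b} \<inter> ({a..b} \<inter> f -` {..d / 2}) = {t \<in> {a..b}. f t \<in> {..d / 2}}"
      by blast
    ultimately show ?thesis by simp
  qed
  moreover have "a \<in> {t \<in> {a..b}. f t \<in> {..d / 2}}"
    using ends ab separated by (simp add: f_def q1_def cl)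
  ultimately obtain \<tau> where \<tau>: "a \<le> \<tau>" "\<tau> \<le> b" "f \<tau> \<le> d / 2"
    and \<tau>_max: "\<And>t. t \<in> {a..b} \<Longrightarrow> f t \<le> d / 2 \<Longrightarrow> t \<le> \<tau>"
    using compact_attains_sup[of "{t \<in> {a..b}. f t \<in> {..d / 2}}"] by auto
  have "d / 2 \<le> f b" using f_far[of b] separated by simp
  \<comment> \<open>The last time below or at the level \<open>d / 2\<close> attains it exactly: a
    later crossing would contradict the maximality of \<open>\<tau>\<close>.\<close>
  then obtain x where x: "\<tau> \<le> x" "x \<le> b" "f x = d / 2"
    using IVT'[of f \<tau> "d / 2" b] \<tau> f_cont by auto
  then have f\<tau>: "f \<tau> = d / 2" using \<tau>_max[of x] \<tau> by (simp add: order_antisym)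
  have later: "d / 2 \<le> f t" if "\<tau> \<le> t" for t
  proof (rule ccontr)
    assume *: "\<not> d / 2 \<le> f t"
    then have "t \<le> b" using f_far[of t] separated by force
    then have "t = \<tau>" using * that \<tau>_max[of t] \<tau> by simp
    then show False using * f\<tau> by simp
  qed
  define q where "q = (\<lambda>t. q1 (1 * t + \<tau>))"
  define m where "m = (\<lambda>t. 1 * m1 (1 * t + \<tau>) - m1 \<tau>)"
  have k: "kinetic_bound q m s t" for s t
    by (rule kinetic_bound_cong[OF kinetic_bound_reparametrize[OF k1, of 1 \<tau>], where d = "- m1 \<tau>"])
       (auto simp: q_def m_def)
  have "action W q m (a - \<tau>) (b - \<tau>) = action W q1 m1 a b"
    using action_reparametrize[of 1 "a - \<tau>" "b - \<tau>" W q1 \<tau> m1] ab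
    by (simp add: action_def q_def m_def)
  then show ?thesis
    using act act1 \<tau> ends f\<tau> later k cl
    by (intro that[of "a - \<tau>" "b - \<tau>" q m]) (auto simp: q_def m_def f_def q1_def m1_def)
qed

end

section \<open>Existence of a minimal curve\<close>

text \<open>\<open>v\<close> is the first time at level \<open>\<beta>\<close> or above,
  \<open>u\<close> the last time before it at level \<open>\<alpha>\<close> or below; in between the
  function cannot leave the strip.\<close>

lemma crossing_interval:
  fixes f :: "real \<Rightarrow> real"
  assumes cont: "continuous_on {s..t} f" and "s \<le> t" "f s \<le> \<alpha>" "\<beta> \<le> f t" "\<alpha> < \<beta>"
  obtains u v where "s \<le> u" "u \<le> v" "v \<le> t" "f u = \<alpha>" "f v = \<beta>"
    "\<And>x. x \<in> {u..v} \<Longrightarrow> \<alpha> \<le> f x \<and> f x \<le> \<beta>"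
proof -
  have comp: "compact {x \<in> {s'..t'}. f x \<in> S}" if "closed S" "s \<le> s'" "t' \<le> t" for S s' t'
  proof -
    have "closed ({s'..t'} \<inter> f -` S)"
      using that by (intro continuous_closed_preimage continuous_on_subset[OF cont]) auto
    then have "compact ({s'..t'} \<inter> ({s'..t'} \<inter> f -` S))"
      by (intro compact_Int_closed) auto
    moreover have "{s'..t'} \<inter> ({s'..t'} \<inter> f -` S) = {x \<in> {s'..t'}. f x \<in> S}" by blast
    ultimately show ?thesis by simp
  qed
  have "{x \<in> {s..t}. f x \<in> {\<beta>..}} \<noteq> {}" using assms by auto
  then obtain v where v: "s \<le> v" "v \<le> t" "\<beta> \<le> f v" and v_min: "\<And>x. s \<le> x \<Longrightarrow> x \<le> t \<Longrightarrow> \<beta> \<le> f x \<Longrightarrow> v \<le> x"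
    using compact_attains_inf[OF comp[of "{\<beta>..}" s t]] by auto
  have "{x \<in> {s..v}. f x \<in> {..\<alpha>}} \<noteq> {}" using assms v by auto
  then obtain u where u: "s \<le> u" "u \<le> v" "f u \<le> \<alpha>" and u_max: "\<And>x. s \<le> x \<Longrightarrow> x \<le> v \<Longrightarrow> f x \<le> \<alpha> \<Longrightarrow> x \<le> u"
    using compact_attains_sup[OF comp[of "{..\<alpha>}" s v]] v by auto
  have c: "continuous_on {u..v} f" using u v by (intro continuous_on_subset[OF cont]) auto
  obtain x where "u \<le> x" "x \<le> v" "f x = \<alpha>"
    using IVT'[of f u \<alpha> v] u v c assms by auto
  then have fu: "f u = \<alpha>" using u_max[of x] u by (simp add: order_antisym)
  obtain y where "u \<le> y" "y \<le> v" "f y = \<beta>"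
    using IVT'[of f u \<beta> v] u v c assms by auto
  then have fv: "f v = \<beta>" using v_min[of y] u v by (simp add: order_antisym)
  have "\<alpha> \<le> f x \<and> f x \<le> \<beta>" if "x \<in> {u..v}" for x
    using that fu fv u_max[of x] v_min[of x] u v by (cases "x = u"; cases "x = v") force+
  then show ?thesis using that u v fu fv by blast
qed

context split_potential
begin

text \<open>Chosen to survive the limit: the curve conditions are closed under pointwise
  convergence, and the action bound on all finite intervals passes to the limit by semicontinuity.
  The case \<open>e = 0\<close> describes a minimal curve on the whole line. \<open>m 0 = 0\<close>
  removes the free constant, so that the certificates are bounded.\<close>

definition near_minimizer :: "real \<Rightarrow> real \<Rightarrow> (real \<Rightarrow> 'a) \<Rightarrow> (real \<Rightarrow> real) \<Rightarrow> bool" where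
  "near_minimizer \<eta> e q m \<longleftrightarrow>
     (\<forall>s t. kinetic_bound q m s t) \<and> m 0 = 0 \<and> (\<forall>s t. s \<le> t \<longrightarrow> action W q m s t \<le> mu + e) \<and>
     infdist (q 0) A = d / 2 \<and> (\<forall>t\<ge>0. d / 2 \<le> infdist (q t) A) \<and> (\<forall>t\<le>0. \<eta> \<le> infdist (q t) B)"

text \<open>\<open>\<eta>\<close> does not depend on \<open>e\<close>. A curve within
  \<open>\<eta>\<close> of \<open>B\<close> before time 0 could have ended there for an extra
  \<open>\<kappa> / 2\<close>, but must still pay \<open>\<kappa>\<close> to move away from
  \<open>B\<close> before time 0; this wastes at least \<open>\<kappa> / 2\<close>, more than the
  error allows.\<close>

lemma near_minimizers_exist:
  obtains \<eta> where "\<eta> > 0" "\<And>e. e > 0 \<Longrightarrow> \<exists>q m. near_minimizer \<eta> e q m"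
proof -
  obtain w where w: "w > 0" "\<And>x. d / 4 \<le> infdist x A \<Longrightarrow> d / 4 \<le> infdist x B \<Longrightarrow> w \<le> W x"
    using W_bounded_below[of "d / 4"] separated by auto
  \<comment> \<open>The price of moving from distance \<open>d / 4\<close> to distance
    \<open>d / 2\<close> from \<open>B\<close>, where \<open>W\<close> is at least
    \<open>w\<close>.\<close>
  define \<kappa> where "\<kappa> = sqrt (2 * w) * (d / 4)"
  have "\<kappa> > 0" using w separated by (simp add: \<kappa>_def)
  then have "\<kappa> / 2 > 0" by simp
  then obtain \<eta>0 where \<eta>0: "\<eta>0 > 0"
    "\<And>x y. y \<in> A \<union> B \<Longrightarrow> dist x y \<le> \<eta>0 \<Longrightarrow> joinable W x y (\<kappa> / 2) \<and> joinable W y x (\<kappa> / 2)"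
    using joinable_near_wells by blast
  define \<eta> where "\<eta> = min \<eta>0 (d / 8)"
  have \<eta>: "\<eta> > 0" "\<eta> \<le> \<eta>0" "\<eta> < d / 4" using \<eta>0 separated by (auto simp: \<eta>_def)
  show ?thesis
  proof (rule that[OF \<eta>(1)])
    fix e :: real assume "e > 0"
    \<comment> \<open>Errors beyond \<open>\<kappa> / 4\<close> would spoil the argument, so a
      better curve is used for large \<open>e\<close>.\<close>
    define e' where "e' = min e (\<kappa> / 4)"
    have e': "e' > 0" "e' \<le> e" "e' \<le> \<kappa> / 4" using \<open>e > 0\<close> \<open>\<kappa> > 0\<close> by (auto simp: e'_def)
    obtain q m a b where ab: "a \<le> 0" "0 \<le> b" and k: "\<And>s t. kinetic_bound q m s t"
      and qa: "\<And>t. t \<le> a \<Longrightarrow> q t \<in> A \<and> m t = m a" and qb: "\<And>t. b \<le> t \<Longrightarrow> q t \<in> B \<and> m t = m b"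
      and m0: "m 0 = 0" and act: "action W q m a b \<le> mu + e'"
      and q0: "infdist (q 0) A = d / 2" and later: "\<And>t. 0 \<le> t \<Longrightarrow> d / 2 \<le> infdist (q t) A"
      using normalized_minimizing_curve[OF e'(1)] by metis
    note split = action_split[OF W_pot k] and nonneg = action_nonneg[OF W_pot k]
      and sub = action_subinterval[OF W_pot k]
    have total: "action W q m s t \<le> mu + e" if "s \<le> t" for s t
    proof -
      \<comment> \<open>Outside \<open>a..b\<close> the curve rests in a well with constant
        certificate, so enlarging the interval costs nothing.\<close>
      have "integral {min s a..a} (\<lambda>t. W (q t)) = integral {min s a..a} (\<lambda>_. 0)"
        using qa W_eq_0 by (intro Henstock_Kurzweil_Integration.integral_cong) auto
      moreover have "integral {b..max t b} (\<lambda>t. W (q t)) = integral {b..max t b} (\<lambda>_. 0)"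
        using qb W_eq_0 by (intro Henstock_Kurzweil_Integration.integral_cong) auto
      ultimately have "action W q m (min s a) a = 0" "action W q m b (max t b) = 0"
        using qa[of "min s a"] qb[of "max t b"] by (auto simp: action_def)
      then have "action W q m (min s a) (max t b) = action W q m a b"
        using split[of "min s a" a "max t b"] split[of a b "max t b"] ab by simp
      moreover have "action W q m s t \<le> action W q m (min s a) (max t b)"
        using that by (intro sub) auto
      ultimately show ?thesis using act e' by simp
    qed
    have "\<eta> \<le> infdist (q t) B" if "t \<le> 0" for t
    proof (rule ccontr)
      assume *: "\<not> \<eta> \<le> infdist (q t) B"
      have "a \<le> t"
        using * qa[of t] infdist_wells(1)[of "q t"] \<eta> separated by force
      have "d / 2 \<le> infdist (q 0) B" "infdist (q t) B \<le> d / 4" "d / 4 < d / 2"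
        using infdist_wells_add[of "q 0"] q0 * \<eta> separated by auto
      moreover have "continuous_on {t..0} (\<lambda>t. infdist (q t) B)"
        by (intro continuous_intros kinetic_bound_continuous[OF k])
      ultimately obtain u v where uv: "t \<le> u" "u \<le> v" "v \<le> 0" "infdist (q u) B = d / 4" "infdist (q v) B = d / 2"
        "\<And>x. x \<in> {u..v} \<Longrightarrow> d / 4 \<le> infdist (q x) B \<and> infdist (q x) B \<le> d / 2"
        using crossing_interval[of t 0 "\<lambda>t. infdist (q t) B" "d / 4" "d / 2"] \<open>t \<le> 0\<close> by blast
      have "w \<le> W (q x)" if "x \<in> {u..v}" for x
        using uv(6)[OF that] infdist_wells_add[of "q x"] separated by (intro w(2)) auto
      then have "sqrt (2 * w) * norm (q v - q u) \<le> action W q m u v"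
        using uv w by (intro crossing_cost[OF W_pot k]) auto
      moreover have "d / 4 \<le> norm (q v - q u)"
        using infdist_triangle_abs[of "q v" B "q u"] uv by (simp add: dist_norm)
      then have "\<kappa> \<le> sqrt (2 * w) * norm (q v - q u)"
        unfolding \<kappa>_def using w by (intro mult_left_mono) auto
      moreover have "action W q m u v \<le> action W q m t 0"
        using uv by (intro sub) auto
      moreover have "action W q m a b = action W q m a t + (action W q m t 0 + action W q m 0 b)"
        using split[of a t b] split[of t 0 b] \<open>a \<le> t\<close> that ab by simp
      ultimately have "action W q m a t + \<kappa> \<le> mu + e'"
        using act nonneg[of 0 b] ab by linarith
      \<comment> \<open>The competitor follows \<open>q\<close> up to time \<open>t\<close> and then
        ends at the nearest point of \<open>B\<close>.\<close>
      moreover obtain y where y: "y \<in> B" "infdist (q t) B = dist (q t) y"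
        using wells infdist_attains_inf by metis
      then have "joinable W (q t) y (\<kappa> / 2)" using \<eta>0(2)[of y "q t"] * \<eta> by simp
      then have "joinable W (q a) y (action W q m a t + \<kappa> / 2)"
        using joinable_trans[OF W_pot joinableI[OF \<open>a \<le> t\<close> k order_refl]] by blast
      then have "mu \<le> action W q m a t + \<kappa> / 2" using mu_le qa y by blast
      ultimately show False using e' \<open>\<kappa> > 0\<close> by linarith
    qed
    then show "\<exists>q m. near_minimizer \<eta> e q m"
      unfolding near_minimizer_def using k m0 total q0 later by blast
  qed
qed

lemma near_minimizer_bounds:
  assumes "near_minimizer \<eta> e q m" "e \<le> 1"
  shows "\<bar>m t\<bar> \<le> 2 * (mu + 1)"
    "norm (q t - q s) \<le> sqrt (\<bar>t - s\<bar> * (2 * (mu + 1)))"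
proof -
  have k: "kinetic_bound q m s t" for s t
    using assms by (simp add: near_minimizer_def)
  have *: "m t - m s \<le> 2 * (mu + 1)" if "s \<le> t" for s t
  proof -
    have "0 \<le> integral {s..t} (\<lambda>t. W (q t))"
      using W_nonneg by (intro Henstock_Kurzweil_Integration.integral_nonneg potential_integrable[OF W_pot k]) auto
    moreover have "action W q m s t \<le> mu + e" using assms that by (simp add: near_minimizer_def)
    ultimately have "(m t - m s) / 2 \<le> mu + 1" using assms(2) unfolding action_def by linarith
    then show ?thesis by simp
  qed
  have mono: "s \<le> t \<Longrightarrow> m s \<le> m t" for s t using kinetic_bound_mono[OF k[of s t]] by simp
  have "m 0 = 0" using assms by (simp add: near_minimizer_def)
  then show "\<bar>m t\<bar> \<le> 2 * (mu + 1)"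
    using *[of 0 t] *[of t 0] mono[of 0 t] mono[of t 0] by (cases "0 \<le> t") auto
  have "norm (q t - q s) \<le> sqrt (\<bar>t - s\<bar> * (m (max s t) - m (min s t)))"
    by (rule kinetic_bound_hoelder[OF k]) auto
  also have "\<dots> \<le> sqrt (\<bar>t - s\<bar> * (2 * (mu + 1)))"
    using *[of "min s t" "max s t"] by (intro real_sqrt_le_mono mult_left_mono) auto
  finally show "norm (q t - q s) \<le> sqrt (\<bar>t - s\<bar> * (2 * (mu + 1)))" .
qed

text \<open>Helly selection: a diagonal subsequence makes curves and certificates converge at
  rational times. Equicontinuity extends the convergence of the curves to all times; the
  certificates are only monotone, and their limit is extended to the reals as a supremum.\<close>

lemma minimizer_exists:
  obtains \<eta> q m where "\<eta> > 0" "near_minimizer \<eta> 0 q m"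
proof -
  obtain \<eta> where "\<eta> > 0" and ex: "\<And>e. e > 0 \<Longrightarrow> \<exists>q m. near_minimizer \<eta> e q m"
    using near_minimizers_exist by blast
  have "\<forall>n. \<exists>p. near_minimizer \<eta> (inverse (real (Suc n))) (fst p) (snd p)"
    using ex by (metis fst_conv snd_conv inverse_positive_iff_positive of_nat_0_less_iff zero_less_Suc)
  then obtain p where p: "\<And>n. near_minimizer \<eta> (inverse (real (Suc n))) (fst (p n)) (snd (p n))"
    by metis
  define qs ms where "qs n = fst (p n)" and "ms n = snd (p n)" for n
  have nm: "near_minimizer \<eta> (inverse (real (Suc n))) (qs n) (ms n)" for n
    unfolding qs_def ms_def by (rule p)
  have le1: "inverse (real (Suc n)) \<le> 1" for n by (simp add: inverse_le_1_iff)
  define C where "C = 2 * (mu + 1)"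
  note bnd = near_minimizer_bounds[OF nm le1, folded C_def]
  have ks: "kinetic_bound (qs n) (ms n) s t" for n s t
    using nm by (simp add: near_minimizer_def)
  have "C \<ge> 0" using bnd(1)[of 0 0] by simp
  obtain R where R: "\<And>x. x \<in> A \<Longrightarrow> norm x \<le> R" using bounded_wells by (auto simp: bounded_iff)
  define \<beta> where "\<beta> t = R + d + sqrt (\<bar>t\<bar> * C)" for t
  have q_bnd: "norm (qs n t) \<le> \<beta> t" for n t
  proof -
    obtain y where y: "y \<in> A" "infdist (qs n 0) A = dist (qs n 0) y"
      using wells infdist_attains_inf by metis
    have "norm (qs n 0) \<le> R + d / 2"
      using norm_triangle_sub[of "qs n 0" y] R[OF y(1)] y(2) nm[of n]
      by (simp add: near_minimizer_def dist_norm)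
    then show ?thesis
      using norm_triangle_sub[of "qs n t" "qs n 0"] bnd(2)[of n t 0] separated by (simp add: \<beta>_def)
  qed
  define b where "b t = \<beta> t + C + 1" for t
  have b_pos: "b t > 0" for t
    using norm_ge_zero[of "qs 0 t"] q_bnd[of 0 t] \<open>C \<ge> 0\<close> by (simp add: b_def del: norm_ge_zero)
  \<comment> \<open>The selection theorem requires a single bound for all times, hence the division
    by the time-dependent bound \<open>b t\<close>.\<close>
  define F where "F n t = (1 / b t) *\<^sub>R (qs n t, ms n t)" for n t
  have F_bnd: "norm (F n t) \<le> 1" if "t \<in> \<rat>" for n t
  proof -
    have "norm (qs n t, ms n t) \<le> norm (qs n t) + norm (ms n t)" by (rule norm_Pair_le)
    also have "\<dots> \<le> b t" using q_bnd[of n t] bnd(1)[of n t] by (simp add: b_def)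
    finally show ?thesis using b_pos[of t] by (simp add: F_def del: scaleR_Pair)
  qed
  obtain k where k: "strict_mono (k :: nat \<Rightarrow> nat)" "\<And>t. t \<in> \<rat> \<Longrightarrow> \<exists>l. (\<lambda>n. F (k n) t) \<longlonglongrightarrow> l"
  proof (rule function_convergent_subsequence[of "\<rat>" F 1])
    show "countable (\<rat> :: real set)" by (rule countable_rat)
    show "norm (F n t) \<le> 1" if "t \<in> \<rat>" for n t using F_bnd that .
    fix k assume "strict_mono (k :: nat \<Rightarrow> nat)" "\<And>t. t \<in> \<rat> \<Longrightarrow> \<exists>l. (\<lambda>n. F (k n) t) \<longlonglongrightarrow> l"
    then show thesis using that by blast
  qed
  have conv_rat: "\<exists>l. (\<lambda>n. (qs (k n) t, ms (k n) t)) \<longlonglongrightarrow> l" if "t \<in> \<rat>" for t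
  proof -
    obtain l where "(\<lambda>n. F (k n) t) \<longlonglongrightarrow> l" using k(2)[OF \<open>t \<in> \<rat>\<close>] by blast
    from tendsto_scaleR[OF tendsto_const[of "b t"] this]
    have "(\<lambda>n. b t *\<^sub>R F (k n) t) \<longlonglongrightarrow> b t *\<^sub>R l" .
    moreover have "b t *\<^sub>R F n t = (qs n t, ms n t)" for n
      using b_pos[of t] by (simp add: F_def del: scaleR_Pair)
    ultimately show ?thesis by (intro exI[of _ "b t *\<^sub>R l"]) simp
  qed
  define M where "M r = lim (\<lambda>n. ms (k n) r)" for r
  have M: "(\<lambda>n. ms (k n) r) \<longlonglongrightarrow> M r" if "r \<in> \<rat>" for r
    using conv_rat[OF that] tendsto_snd limI unfolding M_def by fastforce
  \<comment> \<open>A rational strictly inside the interval, close enough to the end point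
    \<open>t\<close> for the Hoelder estimate to give \<open>\<epsilon>\<close>.\<close>
  have near: "\<exists>r\<in>\<rat>. u < r \<and> r < v \<and> sqrt (\<bar>t - r\<bar> * C) < \<epsilon>"
    if "\<epsilon> > 0" "u < v" "t = u \<or> t = v" for t u v \<epsilon> :: real
  proof -
    note near_assms = that
    \<comment> \<open>\<open>C\<close> may be 0, hence the denominator \<open>C + 1\<close>.\<close>
    define \<delta> where "\<delta> = \<epsilon>\<^sup>2 / (C + 1)"
    have "\<delta> > 0" using \<open>C \<ge> 0\<close> that by (simp add: \<delta>_def)
    obtain r where r: "r \<in> \<rat>" "u < r" "r < v" "\<bar>t - r\<bar> < \<delta>"
    proof (cases "t = u")
      case True
      then show ?thesis
        using Rats_dense_in_real[of u "min v (u + \<delta>)"] \<open>\<delta> > 0\<close> near_assms that by auto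
    next
      case False
      obtain r where "r \<in> \<rat>" "max u (v - \<delta>) < r" "r < v"
        using Rats_dense_in_real[of "max u (v - \<delta>)" v] \<open>\<delta> > 0\<close> near_assms by auto
      then show ?thesis using False \<open>t = u \<or> t = v\<close> by (intro that[of r]) auto
    qed
    have "\<bar>t - r\<bar> * C \<le> \<delta> * C" using r \<open>C \<ge> 0\<close> by (intro mult_right_mono) auto
    also have "\<dots> < \<delta> * (C + 1)" using \<open>\<delta> > 0\<close> by simp
    also have "\<dots> = \<epsilon>\<^sup>2" using \<open>C \<ge> 0\<close> by (simp add: \<delta>_def)
    finally have "sqrt (\<bar>t - r\<bar> * C) < \<epsilon>" using that real_sqrt_less_mono by fastforce
    then show ?thesis using r by blast
  qed
  have "Cauchy (\<lambda>n. qs (k n) t)" for t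
  proof (rule metric_CauchyI)
    fix \<epsilon> :: real assume "\<epsilon> > 0"
    then obtain r where r: "r \<in> \<rat>" "sqrt (\<bar>t - r\<bar> * C) < \<epsilon> / 3"
      using near[of "\<epsilon> / 3" t "t + 1" t] by auto
    have "Cauchy (\<lambda>n. qs (k n) r)"
      using conv_rat[OF r(1)] tendsto_fst LIMSEQ_imp_Cauchy by fastforce
    then obtain N where N: "\<And>i j. i \<ge> N \<Longrightarrow> j \<ge> N \<Longrightarrow> dist (qs (k i) r) (qs (k j) r) < \<epsilon> / 3"
      using metric_CauchyD \<open>\<epsilon> > 0\<close> by (metis zero_less_divide_iff zero_less_numeral)
    have cl: "dist (qs i t) (qs i r) < \<epsilon> / 3" for i
      using bnd(2)[of i t r] r by (simp add: dist_norm)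
    have "dist (qs (k i) t) (qs (k j) t) < \<epsilon>" if "i \<ge> N" "j \<ge> N" for i j
    proof -
      have "dist (qs (k i) t) (qs (k j) t) \<le> dist (qs (k i) t) (qs (k i) r)
          + dist (qs (k i) r) (qs (k j) r) + dist (qs (k j) t) (qs (k j) r)"
        by metric
      then show ?thesis using N[OF that] cl[of "k i"] cl[of "k j"] by linarith
    qed
    then show "\<exists>N. \<forall>i\<ge>N. \<forall>j\<ge>N. dist (qs (k i) t) (qs (k j) t) < \<epsilon>" by blast
  qed
  then have "\<exists>l. (\<lambda>n. qs (k n) t) \<longlonglongrightarrow> l" for t
    by (simp add: Cauchy_convergent_iff convergent_def)
  then obtain q where q: "\<And>t. (\<lambda>n. qs (k n) t) \<longlonglongrightarrow> q t" by metis
  have q_hoelder: "norm (q t - q s) \<le> sqrt (\<bar>t - s\<bar> * C)" for s t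
    using bnd(2)
    by (intro tendsto_le[OF sequentially_bot tendsto_const tendsto_norm[OF tendsto_diff[OF q q]]]) auto
  have M_mono: "M r \<le> M r'" if "r \<in> \<rat>" "r' \<in> \<rat>" "r \<le> r'" for r r'
    using kinetic_bound_mono[OF ks[of _ r r']] that
    by (intro tendsto_le[OF sequentially_bot M M]) auto
  have M_bnd: "\<bar>M r\<bar> \<le> C" if "r \<in> \<rat>" for r
    using bnd(1)
    by (intro tendsto_le[OF sequentially_bot tendsto_const tendsto_rabs[OF M[OF that]]]) auto
  define m0 where "m0 t = (SUP r \<in> {r \<in> \<rat>. r \<le> t}. M r)" for t
  have m0_ge: "M r \<le> m0 t" if "r \<in> \<rat>" "r \<le> t" for r t
    unfolding m0_def using that M_bnd
    by (intro cSUP_upper bdd_aboveI2[where M = C]) (auto intro: order_trans[OF abs_ge_self])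
  have m0_le: "m0 t \<le> M r" if "r \<in> \<rat>" "t \<le> r" for r t
    unfolding m0_def
  proof (rule cSUP_least)
    show "{r \<in> \<rat>. r \<le> t} \<noteq> {}" using Rats_dense_in_real[of "t - 1" t] by fastforce
  qed (use M_mono that in auto)
  have kin: "kinetic_bound q m0 a b" for a b
    unfolding kinetic_bound_def
  proof (intro allI impI)
    fix s t assume "a \<le> s" "s \<le> t" "t \<le> b"
    show "(norm (q t - q s))\<^sup>2 \<le> (t - s) * (m0 t - m0 s)"
    proof (cases "s = t")
      case False
      with \<open>s \<le> t\<close> have "s < t" by simp
      have "norm (q t - q s) \<le> sqrt ((t - s) * (m0 t - m0 s))"
      proof (rule field_le_epsilon)
        fix \<epsilon> :: real assume "\<epsilon> > 0"
        \<comment> \<open>Locally the midpoint, hiding the level of the potential. It separates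
          \<open>r'\<close> from \<open>r\<close>, and both lie inside the interval, so
          \<open>M r - M r'\<close> is at most the increment of \<open>m0\<close>.\<close>
        define c where "c = (s + t) / 2"
        obtain r where r: "r \<in> \<rat>" "c < r" "r < t" "sqrt (\<bar>t - r\<bar> * C) < \<epsilon> / 2"
          using near[of "\<epsilon> / 2" c t t] \<open>\<epsilon> > 0\<close> \<open>s < t\<close> by (auto simp: c_def)
        obtain r' where r': "r' \<in> \<rat>" "s < r'" "r' < c" "sqrt (\<bar>s - r'\<bar> * C) < \<epsilon> / 2"
          using near[of "\<epsilon> / 2" s c s] \<open>\<epsilon> > 0\<close> \<open>s < t\<close> by (auto simp: c_def)
        have "(norm (qs (k n) r - qs (k n) r'))\<^sup>2 \<le> (r - r') * (ms (k n) r - ms (k n) r')" for n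
          using r r' by (intro kinetic_boundD[OF ks[of _ r' r]]) auto
        moreover have "(\<lambda>n. (norm (qs (k n) r - qs (k n) r'))\<^sup>2) \<longlonglongrightarrow> (norm (q r - q r'))\<^sup>2"
          by (intro tendsto_intros q)
        moreover have "(\<lambda>n. (r - r') * (ms (k n) r - ms (k n) r')) \<longlonglongrightarrow> (r - r') * (M r - M r')"
          using r r' by (intro tendsto_intros M)
        ultimately have "(norm (q r - q r'))\<^sup>2 \<le> (r - r') * (M r - M r')"
          by (intro LIMSEQ_le) auto
        also have "\<dots> \<le> (t - s) * (m0 t - m0 s)"
          using r r' m0_ge[of r t] m0_le[of r' s] M_mono[of r' r] by (intro mult_mono) auto
        finally have "norm (q r - q r') \<le> sqrt ((t - s) * (m0 t - m0 s))" by (rule real_le_rsqrt)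
        moreover have "norm (q t - q s) \<le> norm (q t - q r) + norm (q r - q r') + norm (q s - q r')"
          using norm_triangle_ineq[of "q t - q r" "q r - q s"] norm_triangle_ineq[of "q r - q r'" "q r' - q s"]
          by (simp add: norm_minus_commute)
        ultimately show "norm (q t - q s) \<le> sqrt ((t - s) * (m0 t - m0 s)) + \<epsilon>"
          using q_hoelder[of t r] q_hoelder[of s r'] r r' by linarith
      qed
      then have "(norm (q t - q s))\<^sup>2 \<le> (sqrt ((t - s) * (m0 t - m0 s)))\<^sup>2"
        by (intro power_mono) auto
      moreover obtain r where "r \<in> \<rat>" "s < r" "r < t"
        using Rats_dense_in_real[OF \<open>s < t\<close>] by blast
      then have "0 \<le> (t - s) * (m0 t - m0 s)"
        using m0_ge[of r t] m0_le[of r s] by (intro mult_nonneg_nonneg) auto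
      ultimately show ?thesis by simp
    qed simp
  qed
  have act: "action W q m0 s t \<le> mu" if "s \<le> t" for s t
  proof -
    \<comment> \<open>For the semicontinuity the rationals lie outside \<open>s..t\<close>: there
      the increment of \<open>M\<close> dominates that of \<open>m0\<close>, and near-minimality
      bounds the action on the larger interval just as well.\<close>
    obtain r where r: "r \<in> \<rat>" "t < r" using Rats_dense_in_real[of t "t + 1"] by auto
    obtain r' where r': "r' \<in> \<rat>" "r' < s" using Rats_dense_in_real[of "s - 1" s] by auto
    define \<gamma> where "\<gamma> = \<beta> (max \<bar>s\<bar> \<bar>t\<bar>)"
    have \<gamma>: "norm (qs n u) \<le> \<gamma>" if "u \<in> {s..t}" for n u
    proof -
      have "\<bar>u\<bar> * C \<le> \<bar>max \<bar>s\<bar> \<bar>t\<bar>\<bar> * C" using that \<open>C \<ge> 0\<close> by (intro mult_right_mono) auto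
      then show ?thesis using q_bnd[of n u] by (simp add: \<gamma>_def \<beta>_def order_trans[OF _ add_left_mono])
    qed
    have "compact (W ` cball 0 \<gamma>)"
      by (intro compact_continuous_image continuous_on_subset[OF W_continuous]) auto
    then obtain h where h: "\<And>x. x \<in> cball 0 \<gamma> \<Longrightarrow> norm (W x) \<le> h"
      using compact_imp_bounded bounded_iff by (metis imageI)
    have "(\<lambda>n. integral {s..t} (\<lambda>u. W (qs (k n) u))) \<longlonglongrightarrow> integral {s..t} (\<lambda>u. W (q u))"
    proof (rule dominated_convergence(2)[where h = "\<lambda>u. h"])
      show "(\<lambda>u. W (qs (k n) u)) integrable_on {s..t}" for n
        by (rule potential_integrable[OF W_pot ks])
      show "norm (W (qs (k n) u)) \<le> h" if "u \<in> {s..t}" for n u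
        using h \<gamma>[OF that] by simp
      show "(\<lambda>n. W (qs (k n) u)) \<longlonglongrightarrow> W (q u)" for u
        using continuous_on_tendsto_compose[OF W_continuous q] by simp
    qed auto
    then have lim: "(\<lambda>n. (ms (k n) r - ms (k n) r') / 2 + integral {s..t} (\<lambda>u. W (qs (k n) u)))
        \<longlonglongrightarrow> (M r - M r') / 2 + integral {s..t} (\<lambda>u. W (q u))"
      using M r r' by (intro tendsto_intros) auto
    have le: "(ms n r - ms n r') / 2 + integral {s..t} (\<lambda>u. W (qs n u)) \<le> mu + inverse (real (Suc n))" for n
    proof -
      have "integral {s..t} (\<lambda>u. W (qs n u)) \<le> integral {r'..r} (\<lambda>u. W (qs n u))"
        using r r' W_nonneg
        by (intro integral_subset_le potential_integrable[OF W_pot ks]) auto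
      moreover have "action W (qs n) (ms n) r' r \<le> mu + inverse (real (Suc n))"
        using nm[of n] r r' that by (simp add: near_minimizer_def)
      ultimately show ?thesis by (simp add: action_def)
    qed
    have "(\<lambda>n. mu + inverse (real (Suc (k n)))) \<longlonglongrightarrow> mu + 0"
      using LIMSEQ_subseq_LIMSEQ[OF LIMSEQ_inverse_real_of_nat k(1)]
      by (intro tendsto_intros) (simp add: o_def)
    then have "(M r - M r') / 2 + integral {s..t} (\<lambda>u. W (q u)) \<le> mu + 0"
      using le by (intro LIMSEQ_le[OF lim]) auto
    moreover have "(m0 t - m0 s) / 2 \<le> (M r - M r') / 2"
      using m0_le[of r t] m0_ge[of r' s] r r' by (intro divide_right_mono) auto
    ultimately show ?thesis unfolding action_def by linarith
  qed
  define m where "m t = m0 t - m0 0" for t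
  have inf: "(\<lambda>n. infdist (qs (k n) t) S) \<longlonglongrightarrow> infdist (q t) S" for t S
    by (intro tendsto_infdist q)
  have "infdist (qs n 0) A = d / 2" for n using nm by (simp add: near_minimizer_def)
  then have "(\<lambda>n. infdist (qs (k n) 0) A) = (\<lambda>n. d / 2)" by (simp only:)
  then have "infdist (q 0) A = d / 2"
    using inf[of 0 A] LIMSEQ_unique[OF tendsto_const] by metis
  moreover have "d / 2 \<le> infdist (q t) A" if "0 \<le> t" for t
    using nm that by (intro LIMSEQ_le_const[OF inf]) (auto simp: near_minimizer_def)
  moreover have "\<eta> \<le> infdist (q t) B" if "t \<le> 0" for t
    using nm that by (intro LIMSEQ_le_const[OF inf]) (auto simp: near_minimizer_def)
  moreover have "kinetic_bound q m s t" for s t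
    by (rule kinetic_bound_cong[OF kin, where d = "- m0 0"]) (auto simp: m_def)
  moreover have "action W q m s t = action W q m0 s t" for s t
    by (simp add: action_def m_def)
  ultimately have "near_minimizer \<eta> 0 q m"
    using act by (auto simp: near_minimizer_def m_def)
  then show ?thesis using that \<open>\<eta> > 0\<close> by blast
qed

end

section \<open>Local minimality\<close>

lemma has_vector_derivative_quotient_tendsto:
  fixes f :: "real \<Rightarrow> 'a::real_normed_vector"
  assumes "(f has_vector_derivative f') (at x within S)"
  shows "((\<lambda>y. (1 / (y - x)) *\<^sub>R (f y - f x)) \<longlongrightarrow> f') (at x within S)"
proof -
  have "((\<lambda>y. norm (f y - f x - (y - x) *\<^sub>R f') / norm (y - x)) \<longlongrightarrow> 0) (at x within S)"
    using assms by (simp add: has_vector_derivative_def has_derivative_iff_norm)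
  moreover have "\<forall>\<^sub>F y in at x within S.
      norm (f y - f x - (y - x) *\<^sub>R f') / norm (y - x) = norm ((1 / (y - x)) *\<^sub>R (f y - f x) - f')"
    unfolding eventually_at_filter
  proof (intro always_eventually allI impI)
    fix y assume "y \<noteq> x"
    then have "(1 / (y - x)) *\<^sub>R (f y - f x) - f' = (1 / (y - x)) *\<^sub>R (f y - f x - (y - x) *\<^sub>R f')"
      by (simp add: scaleR_diff_right)
    then show "norm (f y - f x - (y - x) *\<^sub>R f') / norm (y - x) = norm ((1 / (y - x)) *\<^sub>R (f y - f x) - f')"
      by simp
  qed
  ultimately have "((\<lambda>y. norm ((1 / (y - x)) *\<^sub>R (f y - f x) - f')) \<longlongrightarrow> 0) (at x within S)"
    by (rule Lim_transform_eventually)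
  then show ?thesis
    by (rule LIM_zero_cancel[OF tendsto_norm_zero_cancel])
qed

text \<open>Expanding the squared norm of an increment, the added terms are exactly
  \<open>t - s\<close> times an increment. An affine perturbation therefore changes the certificate
  explicitly, without a derivative of \<open>q\<close>.\<close>

lemma kinetic_bound_add_linear:
  fixes v :: "'a::euclidean_space"
  assumes "kinetic_bound q m a b"
  shows "kinetic_bound (\<lambda>t. q t + (t - c) *\<^sub>R v) (\<lambda>t. m t + 2 * (v \<bullet> q t) + t * (norm v)\<^sup>2) a b"
  unfolding kinetic_bound_def
proof (intro allI impI)
  fix s t assume st: "a \<le> s" "s \<le> t" "t \<le> b"
  have diff: "q t + (t - c) *\<^sub>R v - (q s + (s - c) *\<^sub>R v) = (q t - q s) + (t - s) *\<^sub>R v"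
    by (simp add: algebra_simps)
  have sq: "(norm (x + h *\<^sub>R v))\<^sup>2 = (norm x)\<^sup>2 + 2 * h * (v \<bullet> x) + h\<^sup>2 * (norm v)\<^sup>2" for x h
    unfolding power2_norm_eq_inner
    by (simp add: inner_add_left inner_add_right inner_commute[of x v] power2_eq_square distrib_left mult.assoc)
  have "(norm (q t + (t - c) *\<^sub>R v - (q s + (s - c) *\<^sub>R v)))\<^sup>2
      = (norm (q t - q s))\<^sup>2 + 2 * (t - s) * (v \<bullet> (q t - q s)) + (t - s)\<^sup>2 * (norm v)\<^sup>2"
    by (simp only: diff sq)
  also have "\<dots> \<le> (t - s) * (m t - m s) + 2 * (t - s) * (v \<bullet> (q t - q s)) + (t - s)\<^sup>2 * (norm v)\<^sup>2"
    using kinetic_boundD[OF assms st] by simp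
  also have "\<dots> = (t - s) * (m t + 2 * (v \<bullet> q t) + t * (norm v)\<^sup>2 - (m s + 2 * (v \<bullet> q s) + s * (norm v)\<^sup>2))"
    by (simp add: algebra_simps power2_eq_square)
  finally show "(norm (q t + (t - c) *\<^sub>R v - (q s + (s - c) *\<^sub>R v)))\<^sup>2
      \<le> (t - s) * (m t + 2 * (v \<bullet> q t) + t * (norm v)\<^sup>2 - (m s + 2 * (v \<bullet> q s) + s * (norm v)\<^sup>2))" .
qed

text \<open>Cauchy-Schwarz, obtained by integrating the square of \<open>norm (v u - w)\<close> for
  the mean velocity \<open>w\<close>. The energy identity needs this certificate as a
  competitor.\<close>

lemma kinetic_bound_velocity:
  fixes q v :: "real \<Rightarrow> 'a::euclidean_space"
  assumes v: "continuous_on {a..b} v"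
    and q: "\<And>t. t \<in> {a..b} \<Longrightarrow> (q has_vector_derivative v t) (at t within {a..b})"
  shows "kinetic_bound q (\<lambda>t. integral {a..t} (\<lambda>u. (norm (v u))\<^sup>2)) a b"
  unfolding kinetic_bound_def
proof (intro allI impI)
  fix s t assume st: "a \<le> s" "s \<le> t" "t \<le> b"
  define I where "I = integral {s..t} (\<lambda>u. (norm (v u))\<^sup>2)"
  have vc: "continuous_on {s..t} v" using st by (intro continuous_on_subset[OF v]) auto
  have "(\<lambda>u. (norm (v u))\<^sup>2) integrable_on {a..t}"
    using st by (intro integrable_continuous_real continuous_intros continuous_on_subset[OF v]) auto
  from Henstock_Kurzweil_Integration.integral_combine[OF st(1,2) this]
  have I: "integral {a..t} (\<lambda>u. (norm (v u))\<^sup>2) - integral {a..s} (\<lambda>u. (norm (v u))\<^sup>2) = I"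
    by (simp add: I_def)
  have w: "(v has_integral q t - q s) {s..t}"
  proof (rule fundamental_theorem_of_calculus[OF st(2)])
    fix x assume "x \<in> {s..t}"
    with st have "x \<in> {a..b}" "{s..t} \<subseteq> {a..b}" by auto
    then show "(q has_vector_derivative v x) (at x within {s..t})"
      using has_vector_derivative_within_subset q by blast
  qed
  show "(norm (q t - q s))\<^sup>2
      \<le> (t - s) * (integral {a..t} (\<lambda>u. (norm (v u))\<^sup>2) - integral {a..s} (\<lambda>u. (norm (v u))\<^sup>2))"
  proof (cases "s = t")
    case False
    define w where "w = (1 / (t - s)) *\<^sub>R (q t - q s)"
    have qw: "q t - q s = (t - s) *\<^sub>R w" using False by (simp add: w_def)
    have i1: "((\<lambda>u. (norm (v u))\<^sup>2) has_integral I) {s..t}"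
      unfolding I_def by (intro integrable_integral integrable_continuous_real continuous_intros vc)
    have i2: "((\<lambda>u. 2 * (w \<bullet> v u)) has_integral 2 * (w \<bullet> (q t - q s))) {s..t}"
      using has_integral_linear[OF w bounded_linear_inner_right[of w]]
      by (intro has_integral_mult_right) (simp add: o_def)
    have i3: "((\<lambda>u. (norm w)\<^sup>2) has_integral (t - s) * (norm w)\<^sup>2) {s..t}"
      using has_integral_const_real[of "(norm w)\<^sup>2" s t] st by simp
    have "((\<lambda>u. (norm (v u))\<^sup>2 - 2 * (w \<bullet> v u) + (norm w)\<^sup>2) has_integral
        I - 2 * (w \<bullet> (q t - q s)) + (t - s) * (norm w)\<^sup>2) {s..t}"
      by (intro has_integral_add has_integral_diff i1 i2 i3)
    moreover have "0 \<le> (norm (v u))\<^sup>2 - 2 * (w \<bullet> v u) + (norm w)\<^sup>2" for u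
    proof -
      have "(norm (v u))\<^sup>2 - 2 * (w \<bullet> v u) + (norm w)\<^sup>2 = (norm (v u - w))\<^sup>2"
        by (simp add: power2_norm_eq_inner algebra_simps inner_commute)
      then show ?thesis by simp
    qed
    ultimately have "0 \<le> I - 2 * (w \<bullet> (q t - q s)) + (t - s) * (norm w)\<^sup>2"
      by (rule has_integral_nonneg)
    then have "(t - s) * (norm w)\<^sup>2 \<le> I"
      by (simp add: qw power2_norm_eq_inner)
    then have "(t - s) * ((t - s) * (norm w)\<^sup>2) \<le> (t - s) * I"
      using st by (intro mult_left_mono) auto
    moreover have "(norm (q t - q s))\<^sup>2 = (t - s) * ((t - s) * (norm w)\<^sup>2)"
      unfolding qw by (simp add: power_mult_distrib) (simp add: power2_eq_square)
    ultimately show ?thesis unfolding I by simp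
  qed simp
qed

lemma has_real_derivative_integral_perturbation:
  fixes V :: "'a::euclidean_space \<Rightarrow> real" and p :: "real \<Rightarrow> 'a" and r :: "real \<Rightarrow> real"
  assumes V: "\<And>x. GDERIV V x :> G x" and G: "continuous_on UNIV G"
    and p: "continuous_on {a..b} p" and r: "continuous_on {a..b} r"
  shows "((\<lambda>z. integral {a..b} (\<lambda>t. V (p t + (z * r t) *\<^sub>R e))) has_real_derivative
           integral {a..b} (\<lambda>t. r t * (G (p t) \<bullet> e))) (at 0)"
proof -
  have V_cont: "continuous_on UNIV V"
    using V unfolding gderiv_def
    by (intro continuous_at_imp_continuous_on ballI) (rule has_derivative_continuous)
  have "((\<lambda>z. integral (cbox a b) (\<lambda>t. V (p t + (z * r t) *\<^sub>R e))) has_real_derivative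
           integral (cbox a b) (\<lambda>t. r t * (G (p t + (0 * r t) *\<^sub>R e) \<bullet> e))) (at 0 within UNIV)"
  proof (rule leibniz_rule_field_derivative)
    fix z t
    have "((\<lambda>z. V (p t + (z * r t) *\<^sub>R e)) has_derivative
        (\<lambda>h. ((h * r t) *\<^sub>R e) \<bullet> G (p t + (z * r t) *\<^sub>R e))) (at z)"
      by (rule has_derivative_compose[OF _ V[unfolded gderiv_def], of "\<lambda>z. p t + (z * r t) *\<^sub>R e"])
         (auto intro!: derivative_eq_intros)
    then show "((\<lambda>z. V (p t + (z * r t) *\<^sub>R e)) has_real_derivative
        r t * (G (p t + (z * r t) *\<^sub>R e) \<bullet> e)) (at z within UNIV)"
      by (simp add: has_field_derivative_def inner_commute mult_ac mult_commute_abs)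
  next
    fix z
    show "(\<lambda>t. V (p t + (z * r t) *\<^sub>R e)) integrable_on cbox a b"
      by (intro integrable_continuous continuous_on_compose2[OF V_cont] continuous_intros)
         (auto simp: p r)
  next
    have p': "continuous_on (UNIV \<times> cbox a b) (\<lambda>x. p (snd x))"
      by (rule continuous_on_compose2[OF p continuous_on_snd[OF continuous_on_id]]) auto
    have r': "continuous_on (UNIV \<times> cbox a b) (\<lambda>x. r (snd x))"
      by (rule continuous_on_compose2[OF r continuous_on_snd[OF continuous_on_id]]) auto
    have "continuous_on (UNIV \<times> cbox a b) (\<lambda>x. G (p (snd x) + (fst x * r (snd x)) *\<^sub>R e))"
      by (rule continuous_on_compose2[OF G _ subset_UNIV]) (intro continuous_intros p' r')
    then show "continuous_on (UNIV \<times> cbox a b) (\<lambda>(z, t). r t * (G (p t + (z * r t) *\<^sub>R e) \<bullet> e))"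
      unfolding split_beta by (intro continuous_intros r')
  qed auto
  then show ?thesis by simp
qed

locale minimal_curve = split_potential V c A B
  for V :: "'a::euclidean_space \<Rightarrow> real" and c A B +
  fixes G :: "'a \<Rightarrow> 'a" and \<eta> :: real and q :: "real \<Rightarrow> 'a" and m :: "real \<Rightarrow> real"
  assumes V_deriv: "\<And>x. GDERIV V x :> G x" and G_continuous: "continuous_on UNIV G"
    and \<eta>_pos: "\<eta> > 0" and minimizer: "near_minimizer \<eta> 0 q m"
begin

lemma kin: "kinetic_bound q m s t"
  and action_le_mu: "s \<le> t \<Longrightarrow> action W q m s t \<le> mu"
  and q_zero: "infdist (q 0) A = d / 2"
  and q_right: "0 \<le> t \<Longrightarrow> d / 2 \<le> infdist (q t) A"
  and q_left: "t \<le> 0 \<Longrightarrow> \<eta> \<le> infdist (q t) B"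
  using minimizer by (auto simp: near_minimizer_def)

lemma q_continuous: "continuous_on {s..t} q"
  by (rule kinetic_bound_continuous[OF kin])

lemma q_continuous_UNIV: "continuous_on UNIV q"
proof (rule continuous_at_imp_continuous_on, rule)
  fix t :: real
  show "isCont q t"
    using q_continuous[of "t - 1" "t + 1"]
    by (rule continuous_on_interior) simp
qed

section \<open>Behaviour of the minimal curve at both ends, and its minimality in between\<close>

lemma unbounded_cost:
  assumes "w > 0" "\<And>t. t \<in> {s..s + (mu + 1) / w} \<Longrightarrow> w \<le> W (q t)"
  shows False
proof -
  define T where "T = (mu + 1) / w"
  have "0 \<le> mu"
    using action_nonneg[OF W_pot kin[of 0 0]] action_le_mu[of 0 0] by simp
  then have "T > 0" using assms by (simp add: T_def)
  have "w * T = integral {s..s + T} (\<lambda>t. w)" using \<open>T > 0\<close> by simp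
  also have "\<dots> \<le> integral {s..s + T} (\<lambda>t. W (q t))"
    using assms by (intro integral_le potential_integrable[OF W_pot kin]) (auto simp: T_def)
  also have "\<dots> \<le> action W q m s (s + T)"
    using kinetic_bound_mono[OF kin[of s "s + T"], of s "s + T"] \<open>T > 0\<close> by (simp add: action_def)
  also have "\<dots> \<le> mu" using \<open>T > 0\<close> by (intro action_le_mu) simp
  finally show False using assms(1) by (simp add: T_def)
qed

text \<open>After time 0 the curve stays away from \<open>A\<close>. Staying away from
  \<open>B\<close> as well would keep \<open>W\<close> above a positive constant forever, at
  unbounded cost.\<close>

lemma reaches_B:
  assumes "\<epsilon> > 0"
  obtains t where "t \<ge> 0" "infdist (q t) B < \<epsilon>"
proof -
  obtain w where w: "w > 0" "\<And>x. min \<epsilon> (d / 2) \<le> infdist x A \<Longrightarrow> min \<epsilon> (d / 2) \<le> infdist x B \<Longrightarrow> w \<le> W x"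
    using W_bounded_below[of "min \<epsilon> (d / 2)"] assms separated by auto
  note reach = that
  show ?thesis
  proof (rule ccontr)
    assume no: "\<not> thesis"
    have "\<epsilon> \<le> infdist (q t) B" if "t \<ge> 0" for t using reach[OF that] no by force
    then have "w \<le> W (q t)" if "t \<ge> 0" for t
      using q_right[OF that] that by (intro w(2)) (auto intro: min.coboundedI1 min.coboundedI2)
    then show False by (intro unbounded_cost[OF w(1), of 0]) simp
  qed
qed

lemma reaches_A:
  assumes "\<epsilon> > 0"
  obtains t where "t \<le> 0" "infdist (q t) A < \<epsilon>"
proof -
  obtain w where w: "w > 0" "\<And>x. min \<epsilon> \<eta> \<le> infdist x A \<Longrightarrow> min \<epsilon> \<eta> \<le> infdist x B \<Longrightarrow> w \<le> W x"
    using W_bounded_below[of "min \<epsilon> \<eta>"] assms \<eta>_pos by auto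
  note reach = that
  show ?thesis
  proof (rule ccontr)
    assume no: "\<not> thesis"
    have "\<epsilon> \<le> infdist (q t) A" if "t \<le> 0" for t using reach[OF that] no by force
    then have "w \<le> W (q t)" if "t \<le> 0" for t
      using q_left[OF that] that by (intro w(2)) (auto intro: min.coboundedI1 min.coboundedI2)
    \<comment> \<open>The window of length \<open>(mu + 1) / w\<close> is placed so as to end at
      time 0, because the bound on \<open>W\<close> holds only in the past.\<close>
    then show False by (intro unbounded_cost[OF w(1), of "- ((mu + 1) / w)"]) simp
  qed
qed

lemma compact_range_infdist_pos:
  assumes "\<And>x. x \<in> {s..t} \<Longrightarrow> q x \<notin> S" "closed S" "S \<noteq> {}"
  obtains \<delta> where "\<delta> > 0" "\<And>x. x \<in> {s..t} \<Longrightarrow> \<delta> \<le> infdist (q x) S"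
proof (cases "{s..t} = {}")
  case True
  then show ?thesis using that[of 1] by auto
next
  case False
  have "continuous_on {s..t} (\<lambda>x. infdist (q x) S)"
    by (intro continuous_intros q_continuous)
  from continuous_attains_inf[OF compact_Icc False this]
  obtain x where x: "x \<in> {s..t}" "\<And>y. y \<in> {s..t} \<Longrightarrow> infdist (q x) S \<le> infdist (q y) S" by blast
  moreover have "infdist (q x) S > 0"
    using assms x(1) in_closed_iff_infdist_zero infdist_nonneg by (metis less_eq_real_def)
  ultimately show ?thesis using that by blast
qed

text \<open>On the compact interval up to \<open>s\<close> the curve keeps a positive distance from
  \<open>B\<close>, so any closer approach must happen later.\<close>

lemma reaches_B_after:
  assumes U: "\<And>x. x \<in> {0..s} \<Longrightarrow> c < V (q x)" and "\<epsilon> > 0"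
  obtains t where "t \<ge> s" "t \<ge> 0" "infdist (q t) B < \<epsilon>"
proof -
  have "q x \<notin> B" if "x \<in> {0..s}" for x using U[OF that] in_wells_iff by (metis not_le)
  then obtain \<delta> where \<delta>: "\<delta> > 0" "\<And>x. x \<in> {0..s} \<Longrightarrow> \<delta> \<le> infdist (q x) B"
    using compact_range_infdist_pos[of 0 s B] wells by metis
  obtain t where t: "t \<ge> 0" "infdist (q t) B < min \<epsilon> \<delta>"
    using reaches_B[of "min \<epsilon> \<delta>"] \<delta> assms(2) by auto
  then have "t \<ge> s" using \<delta>(2)[of t] by (cases "t \<le> s") auto
  then show ?thesis using t by (intro that[of t]) simp_all
qed

lemma reaches_A_before:
  assumes U: "\<And>x. x \<in> {s..0} \<Longrightarrow> c < V (q x)" and "\<epsilon> > 0"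
  obtains t where "t \<le> s" "t \<le> 0" "infdist (q t) A < \<epsilon>"
proof -
  have "q x \<notin> A" if "x \<in> {s..0}" for x using U[OF that] in_wells_iff by (metis not_le)
  then obtain \<delta> where \<delta>: "\<delta> > 0" "\<And>x. x \<in> {s..0} \<Longrightarrow> \<delta> \<le> infdist (q x) A"
    using compact_range_infdist_pos[of s 0 A] wells by metis
  obtain t where t: "t \<le> 0" "infdist (q t) A < min \<epsilon> \<delta>"
    using reaches_A[of "min \<epsilon> \<delta>"] \<delta> assms(2) by auto
  then have "t \<le> s" using \<delta>(2)[of t] by (cases "s \<le> t") auto
  then show ?thesis using t by (intro that[of t]) simp_all
qed

text \<open>A cheaper connection from \<open>q s\<close> to \<open>q t\<close>, completed by the
  curve itself to times near the wells and by short segments into them, would join \<open>A\<close>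
  to \<open>B\<close> below \<open>mu\<close>. Stating it through \<open>joinable\<close> admits
  competitors with another transit time or another certificate.\<close>

lemma locally_minimal:
  assumes st: "s \<le> 0" "0 \<le> t" and U: "\<And>x. x \<in> {s..t} \<Longrightarrow> c < V (q x)"
    and C: "joinable W (q s) (q t) C"
  shows "action W q m s t \<le> C"
proof (rule field_le_epsilon)
  fix \<epsilon> :: real assume "\<epsilon> > 0"
  then have "\<epsilon> / 2 > 0" by simp
  then obtain \<delta> where \<delta>: "\<delta> > 0"
    "\<And>x y. y \<in> A \<union> B \<Longrightarrow> dist x y \<le> \<delta> \<Longrightarrow> joinable W x y (\<epsilon> / 2) \<and> joinable W y x (\<epsilon> / 2)"
    using joinable_near_wells by blast
  obtain s' where s': "s' \<le> s" "s' \<le> 0" "infdist (q s') A < \<delta>"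
    using reaches_A_before[of s \<delta>] U st \<delta> by auto
  obtain t' where t': "t \<le> t'" "0 \<le> t'" "infdist (q t') B < \<delta>"
    using reaches_B_after[of t \<delta>] U st \<delta> by auto
  obtain y where y: "y \<in> A" "dist (q s') y \<le> \<delta>"
    using wells infdist_attains_inf s' by (metis less_eq_real_def)
  obtain z where z: "z \<in> B" "dist (q t') z \<le> \<delta>"
    using wells infdist_attains_inf t' by (metis less_eq_real_def)
  note tr = joinable_trans[OF W_pot]
  have "joinable W y (q s') (\<epsilon> / 2)" using \<delta>(2)[of y "q s'"] y by blast
  from tr[OF this joinableI[OF s'(1) kin order_refl]]
  have "joinable W y (q s) (\<epsilon> / 2 + action W q m s' s)" .
  from tr[OF tr[OF this C] joinableI[OF t'(1) kin order_refl]]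
  have "joinable W y (q t') (\<epsilon> / 2 + action W q m s' s + C + action W q m t t')" .
  moreover have "joinable W (q t') z (\<epsilon> / 2)" using \<delta>(2)[of z "q t'"] z by blast
  ultimately have "joinable W y z (\<epsilon> / 2 + action W q m s' s + C + action W q m t t' + \<epsilon> / 2)"
    using tr by blast
  then have "mu \<le> action W q m s' s + C + action W q m t t' + \<epsilon>"
    using mu_le[OF y(1) z(1)] by fastforce
  moreover have "action W q m s' t' \<le> mu" using s' t' by (intro action_le_mu) simp
  moreover have "action W q m s' t' = action W q m s' s + (action W q m s t + action W q m t t')"
    using action_split[OF W_pot kin, of s' s t'] action_split[OF W_pot kin, of s t t'] s' t' st by simp
  ultimately show "action W q m s t \<le> C + \<epsilon>" by linarith
qed

end

section \<open>Newton's equation and the energy\<close>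

context minimal_curve
begin

text \<open>The perturbations are the hat functions on \<open>{s..t}\<close> with vertex at \<open>b\<close>. They are affine on
  both pieces, so the kinetic bounds of the perturbed curve are explicit and no derivative of \<open>q\<close>
  is needed.\<close>

lemma weak_euler_lagrange:
  assumes sbt: "s < b" "b < t" "s \<le> 0" "0 \<le> t" and U: "\<And>x. x \<in> {s..t} \<Longrightarrow> c < V (q x)"
  shows "e \<bullet> ((1 / (b - s)) *\<^sub>R (q b - q s) - (1 / (t - b)) *\<^sub>R (q t - q b))
    + integral {s..b} (\<lambda>x. (x - s) / (b - s) * (G (q x) \<bullet> e))
    + integral {b..t} (\<lambda>x. (t - x) / (t - b) * (G (q x) \<bullet> e)) = 0"
proof -
  define r1 r2 where "r1 x = (x - s) / (b - s)" and "r2 x = (t - x) / (t - b)" for x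
  \<comment> \<open>The action of the perturbed curve up to terms independent of \<open>z\<close>.
    The kinetic part is an explicit quadratic polynomial, so only the potential is differentiated
    under the integral.\<close>
  define h where "h z = z * (e \<bullet> ((1 / (b - s)) *\<^sub>R (q b - q s) - (1 / (t - b)) *\<^sub>R (q t - q b)))
      + z\<^sup>2 * ((norm e)\<^sup>2 / (2 * (b - s)) + (norm e)\<^sup>2 / (2 * (t - b)))
      + integral {s..b} (\<lambda>x. V (q x + (z * r1 x) *\<^sub>R e))
      + integral {b..t} (\<lambda>x. V (q x + (z * r2 x) *\<^sub>R e))" for z :: real
  have r_cont: "continuous_on {s..b} r1" "continuous_on {b..t} r2"
    unfolding r1_def r2_def using sbt by (auto intro!: continuous_intros)
  note deriv = has_real_derivative_integral_perturbation[OF V_deriv G_continuous q_continuous]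
  have "(h has_real_derivative (e \<bullet> ((1 / (b - s)) *\<^sub>R (q b - q s) - (1 / (t - b)) *\<^sub>R (q t - q b)))
    + integral {s..b} (\<lambda>x. r1 x * (G (q x) \<bullet> e))
    + integral {b..t} (\<lambda>x. r2 x * (G (q x) \<bullet> e))) (at 0)"
    unfolding h_def by (auto intro!: derivative_eq_intros deriv r_cont)
  moreover have "compact (q ` {s..t})"
    by (intro compact_continuous_image q_continuous) auto
  \<comment> \<open>A margin within which perturbations stay in the open set above level
    \<open>c\<close>; there \<open>W\<close> is \<open>V - c\<close> and hence
    differentiable.\<close>
  then obtain \<epsilon> where \<epsilon>: "\<epsilon> > 0" "(\<Union>x\<in>q ` {s..t}. ball x \<epsilon>) \<subseteq> {x. c < V x}"
    using compact_subset_open_imp_ball_epsilon_subset[of "q ` {s..t}" "{x. c < V x}"] U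
      open_Collect_less[OF continuous_on_const V_cont] by blast
  \<comment> \<open>The hat is at most 1, so \<open>\<bar>z\<bar> < \<delta>\<close> keeps the
    displacement below \<open>\<epsilon>\<close>; adding 1 covers \<open>e = 0\<close>.\<close>
  define \<delta> where "\<delta> = \<epsilon> / (norm e + 1)"
  have "\<delta> > 0" using \<epsilon> by (simp add: \<delta>_def add_nonneg_pos)
  have large: "c < V (q x + (z * r) *\<^sub>R e)" if "\<bar>z\<bar> < \<delta>" "x \<in> {s..t}" "0 \<le> r" "r \<le> 1" for z r x
  proof -
    have "norm ((z * r) *\<^sub>R e) = \<bar>z\<bar> * (r * norm e)" using that by (simp add: abs_mult)
    also have "\<dots> \<le> \<bar>z\<bar> * norm e"
      using that by (intro mult_left_mono mult_left_le_one_le) auto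
    also have "\<dots> \<le> \<delta> * norm e" using that by (intro mult_right_mono) auto
    also have "\<dots> < \<delta> * (norm e + 1)" using \<open>\<delta> > 0\<close> by simp
    also have "\<dots> = \<epsilon>" by (simp add: \<delta>_def add_nonneg_eq_0_iff)
    finally have "q x + (z * r) *\<^sub>R e \<in> ball (q x) \<epsilon>" by (simp add: dist_norm)
    then show ?thesis using \<epsilon>(2) that(2) by blast
  qed
  have "h 0 \<le> h z" if z: "\<bar>0 - z\<bar> < \<delta>" for z
  proof -
    define v1 v2 where "v1 = (z / (b - s)) *\<^sub>R e" and "v2 = (- z / (t - b)) *\<^sub>R e"
    define q1 m1 where "q1 = (\<lambda>x. q x + (x - s) *\<^sub>R v1)"
      and "m1 = (\<lambda>x. m x + 2 * (v1 \<bullet> q x) + x * (norm v1)\<^sup>2)"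
    define q2 m2 where "q2 = (\<lambda>x. q x + (x - t) *\<^sub>R v2)"
      and "m2 = (\<lambda>x. m x + 2 * (v2 \<bullet> q x) + x * (norm v2)\<^sup>2)"
    have r2: "(x - t) * (- z / (t - b)) = z * r2 x" for x
      by (simp add: r2_def flip: minus_mult_right) (simp add: algebra_simps diff_divide_distrib)
    have q12: "q1 x = q x + (z * r1 x) *\<^sub>R e" "q2 x = q x + (z * r2 x) *\<^sub>R e" for x
      by (simp add: q1_def v1_def r1_def mult.commute)
        (simp only: q2_def v2_def scaleR_scaleR r2)
    have ends: "q1 s = q s" "q1 b = q b + z *\<^sub>R e" "q2 b = q b + z *\<^sub>R e" "q2 t = q t"
      using sbt by (auto simp: q12 r1_def r2_def)
    have k: "kinetic_bound q1 m1 s b" "kinetic_bound q2 m2 b t"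
      unfolding q1_def m1_def q2_def m2_def by (intro kinetic_bound_add_linear kin)+
    have "joinable W (q1 s) (q1 b) (action W q1 m1 s b)" "joinable W (q2 b) (q2 t) (action W q2 m2 b t)"
      using k sbt by (auto intro!: joinableI)
    then have "joinable W (q s) (q t) (action W q1 m1 s b + action W q2 m2 b t)"
      using joinable_trans[OF W_pot] ends by metis
    then have "action W q m s t \<le> action W q1 m1 s b + action W q2 m2 b t"
      using sbt U by (intro locally_minimal) auto
    moreover have "action W q m s t = action W q m s b + action W q m b t"
      using sbt by (intro action_split[OF W_pot kin]) auto
    ultimately have le: "action W q m s b + action W q m b t \<le> action W q1 m1 s b + action W q2 m2 b t"
      by simp
    have int: "integral {x..y} (\<lambda>u. W (p u)) = integral {x..y} (\<lambda>u. V (p u)) - c * (y - x)"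
      if "kinetic_bound p n x y" "\<And>u. u \<in> {x..y} \<Longrightarrow> c < V (p u)" "x \<le> y" for p n x y
    proof -
      have "integral {x..y} (\<lambda>u. W (p u)) = integral {x..y} (\<lambda>u. V (p u) - c)"
        using that(2) by (intro Henstock_Kurzweil_Integration.integral_cong) (force simp: W_def)
      also have "\<dots> = integral {x..y} (\<lambda>u. V (p u)) - integral {x..y} (\<lambda>u. c)"
        by (intro Henstock_Kurzweil_Integration.integral_diff integrable_continuous_real
            continuous_on_compose2[OF V_cont kinetic_bound_continuous[OF that(1)]]) auto
      finally show ?thesis using that(3) by (simp add: mult.commute)
    qed
    have "c < V (q1 x)" if "x \<in> {s..b}" for x
      unfolding q12 using that sbt z by (intro large) (auto simp: r1_def)
    then have i1: "integral {s..b} (\<lambda>u. W (q1 u)) = integral {s..b} (\<lambda>u. V (q1 u)) - c * (b - s)"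
      using sbt by (intro int[OF k(1)]) auto
    have "c < V (q2 x)" if "x \<in> {b..t}" for x
      unfolding q12 using that sbt z by (intro large) (auto simp: r2_def)
    then have i2: "integral {b..t} (\<lambda>u. W (q2 u)) = integral {b..t} (\<lambda>u. V (q2 u)) - c * (t - b)"
      using sbt by (intro int[OF k(2)]) auto
    have i3: "integral {s..b} (\<lambda>u. W (q u)) = integral {s..b} (\<lambda>u. V (q u)) - c * (b - s)"
      and i4: "integral {b..t} (\<lambda>u. W (q u)) = integral {b..t} (\<lambda>u. V (q u)) - c * (t - b)"
      using sbt U by (auto intro!: int[OF kin])
    have m1: "(m1 b - m1 s) / 2 = (m b - m s) / 2 + z * (e \<bullet> ((1 / (b - s)) *\<^sub>R (q b - q s)))
        + z\<^sup>2 * ((norm e)\<^sup>2 / (2 * (b - s)))"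
    proof -
      have "(norm v1)\<^sup>2 = z\<^sup>2 * (norm e)\<^sup>2 / (b - s)\<^sup>2"
        by (simp add: v1_def power_mult_distrib power_divide)
      then have "(b - s) * (norm v1)\<^sup>2 / 2 = z\<^sup>2 * ((norm e)\<^sup>2 / (2 * (b - s)))"
        using sbt by (simp add: power2_eq_square)
      moreover have "v1 \<bullet> q b - v1 \<bullet> q s = z * (e \<bullet> ((1 / (b - s)) *\<^sub>R (q b - q s)))"
        by (simp add: v1_def inner_diff_right right_diff_distrib)
      moreover have "(m1 b - m1 s) / 2 = (m b - m s) / 2 + (v1 \<bullet> q b - v1 \<bullet> q s)
          + (b - s) * (norm v1)\<^sup>2 / 2"
        by (simp add: m1_def field_simps)
      ultimately show ?thesis by linarith
    qed
    have m2: "(m2 t - m2 b) / 2 = (m t - m b) / 2 - z * (e \<bullet> ((1 / (t - b)) *\<^sub>R (q t - q b)))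
        + z\<^sup>2 * ((norm e)\<^sup>2 / (2 * (t - b)))"
    proof -
      have "(norm v2)\<^sup>2 = z\<^sup>2 * (norm e)\<^sup>2 / (t - b)\<^sup>2"
        by (simp add: v2_def power_mult_distrib power_divide)
      then have "(t - b) * (norm v2)\<^sup>2 / 2 = z\<^sup>2 * ((norm e)\<^sup>2 / (2 * (t - b)))"
        using sbt by (simp add: power2_eq_square)
      moreover have "v2 \<bullet> q t - v2 \<bullet> q b = - (z * (e \<bullet> ((1 / (t - b)) *\<^sub>R (q t - q b))))"
        by (simp add: v2_def inner_diff_right right_diff_distrib)
      moreover have "(m2 t - m2 b) / 2 = (m t - m b) / 2 + (v2 \<bullet> q t - v2 \<bullet> q b)
          + (t - b) * (norm v2)\<^sup>2 / 2"
        by (simp add: m2_def field_simps)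
      ultimately show ?thesis by linarith
    qed
    have h0: "h 0 = integral {s..b} (\<lambda>u. V (q u)) + integral {b..t} (\<lambda>u. V (q u))"
      by (simp add: h_def)
    have hz: "h z = z * (e \<bullet> ((1 / (b - s)) *\<^sub>R (q b - q s))) - z * (e \<bullet> ((1 / (t - b)) *\<^sub>R (q t - q b)))
        + z\<^sup>2 * ((norm e)\<^sup>2 / (2 * (b - s))) + z\<^sup>2 * ((norm e)\<^sup>2 / (2 * (t - b)))
        + integral {s..b} (\<lambda>u. V (q1 u)) + integral {b..t} (\<lambda>u. V (q2 u))"
      unfolding h_def q12
      by (simp only: inner_diff_right[of e "(1 / (b - s)) *\<^sub>R (q b - q s)"] right_diff_distrib[of z] distrib_left[of "z\<^sup>2"] add.assoc)
    show ?thesis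
      using le unfolding action_def i1 i2 i3 i4 m1 m2 h0 hz by linarith
  qed
  ultimately show ?thesis
    using DERIV_local_min[OF _ \<open>\<delta> > 0\<close>] by (simp add: r1_def r2_def)
qed

text \<open>Du Bois-Reymond with hats: subtracting the second primitive \<open>P\<close> of the
  force from \<open>q\<close> removes the integrals from the weak equation. What remains says that
  the slopes on both sides of every \<open>b\<close> agree, so \<open>r\<close> is affine and
  \<open>q\<close> inherits the regularity of \<open>P\<close>.\<close>

lemma newton:
  assumes st: "s < t" "s \<le> 0" "0 \<le> t" and U: "\<And>x. x \<in> {s..t} \<Longrightarrow> c < V (q x)"
  obtains v where
    "\<And>x. x \<in> {s..t} \<Longrightarrow> (q has_vector_derivative v x) (at x within {s..t})"
    "\<And>x. x \<in> {s..t} \<Longrightarrow> (v has_vector_derivative G (q x)) (at x within {s..t})"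
proof -
  have Gq: "continuous_on {s..t} (\<lambda>x. G (q x))"
    by (rule continuous_on_compose2[OF G_continuous q_continuous]) auto
  define P1 where "P1 x = integral {s..x} (\<lambda>x. G (q x))" for x
  define P where "P x = integral {s..x} P1" for x
  have P1: "(P1 has_vector_derivative G (q x)) (at x within {s..t})" if "x \<in> {s..t}" for x
    unfolding P1_def by (rule integral_has_vector_derivative[OF Gq that])
  then have "continuous_on {s..t} P1"
    by (rule continuous_on_vector_derivative)
  then have P: "(P has_vector_derivative P1 x) (at x within {s..t})" if "x \<in> {s..t}" for x
    unfolding P_def using that by (rule integral_has_vector_derivative)
  define r where "r x = q x - P x" for x
  have r: "r b = r s + (b - s) *\<^sub>R ((1 / (t - s)) *\<^sub>R (r t - r s))" if b: "b \<in> {s..t}" for b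
  proof (cases "b = s \<or> b = t")
    case True
    then show ?thesis using st by auto
  next
    case False
    then have sb: "s < b" "b < t" using b by auto
    \<comment> \<open>Integration by parts against the affine weights. The boundary terms
      \<open>P1 b\<close> of the two sides cancel in the weak equation, leaving difference quotients
      of \<open>P\<close>.\<close>
    have left: "((\<lambda>x. (x - s) *\<^sub>R G (q x)) has_integral (b - s) *\<^sub>R P1 b - (P b - P s)) {s..b}"
    proof -
      have "((\<lambda>x. (x - s) *\<^sub>R P1 x - P x) has_vector_derivative (x - s) *\<^sub>R G (q x)) (at x within {s..b})"
        if "x \<in> {s..b}" for x
        by (rule has_vector_derivative_within_subset[of _ _ _ "{s..t}"])
           (use that sb in \<open>auto intro!: derivative_eq_intros P1 P\<close>)
      from fundamental_theorem_of_calculus[OF _ this] show ?thesis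
        using sb by (simp add: algebra_simps)
    qed
    have right: "((\<lambda>x. (t - x) *\<^sub>R G (q x)) has_integral (P t - P b) - (t - b) *\<^sub>R P1 b) {b..t}"
    proof -
      have "((\<lambda>x. (t - x) *\<^sub>R P1 x + P x) has_vector_derivative (t - x) *\<^sub>R G (q x)) (at x within {b..t})"
        if "x \<in> {b..t}" for x
        by (rule has_vector_derivative_within_subset[of _ _ _ "{s..t}"])
           (use that sb in \<open>auto intro!: derivative_eq_intros P1 P\<close>)
      from fundamental_theorem_of_calculus[OF _ this] show ?thesis
        using sb by (simp add: algebra_simps)
    qed
    have "e \<bullet> ((1 / (b - s)) *\<^sub>R (r b - r s) - (1 / (t - b)) *\<^sub>R (r t - r b)) = 0" for e
    proof -
      have "((\<lambda>x. 1 / (b - s) * ((x - s) * (G (q x) \<bullet> e)))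
          has_integral 1 / (b - s) * (((b - s) *\<^sub>R P1 b - (P b - P s)) \<bullet> e)) {s..b}"
        using has_integral_linear[OF left bounded_linear_inner_left[of e]]
        by (intro has_integral_mult_right) (simp add: o_def)
      then have 1: "((\<lambda>x. (x - s) / (b - s) * (G (q x) \<bullet> e))
          has_integral 1 / (b - s) * (((b - s) *\<^sub>R P1 b - (P b - P s)) \<bullet> e)) {s..b}"
        by simp
      have "((\<lambda>x. 1 / (t - b) * ((t - x) * (G (q x) \<bullet> e)))
          has_integral 1 / (t - b) * (((P t - P b) - (t - b) *\<^sub>R P1 b) \<bullet> e)) {b..t}"
        using has_integral_linear[OF right bounded_linear_inner_left[of e]]
        by (intro has_integral_mult_right) (simp add: o_def)
      then have 2: "((\<lambda>x. (t - x) / (t - b) * (G (q x) \<bullet> e))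
          has_integral 1 / (t - b) * (((P t - P b) - (t - b) *\<^sub>R P1 b) \<bullet> e)) {b..t}"
        by simp
      have "e \<bullet> ((1 / (b - s)) *\<^sub>R (q b - q s) - (1 / (t - b)) *\<^sub>R (q t - q b))
          + 1 / (b - s) * (((b - s) *\<^sub>R P1 b - (P b - P s)) \<bullet> e)
          + 1 / (t - b) * (((P t - P b) - (t - b) *\<^sub>R P1 b) \<bullet> e) = 0"
        using weak_euler_lagrange[OF sb st(2,3) U, of e]
        unfolding integral_unique[OF 1] integral_unique[OF 2] .
      moreover have "1 / (b - s) * (((b - s) *\<^sub>R P1 b - (P b - P s)) \<bullet> e)
          = P1 b \<bullet> e - 1 / (b - s) * ((P b - P s) \<bullet> e)"
        "1 / (t - b) * (((P t - P b) - (t - b) *\<^sub>R P1 b) \<bullet> e)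
          = 1 / (t - b) * ((P t - P b) \<bullet> e) - P1 b \<bullet> e"
        using sb by (simp_all add: inner_diff_left right_diff_distrib)
      moreover have "e \<bullet> ((1 / (b - s)) *\<^sub>R (r b - r s) - (1 / (t - b)) *\<^sub>R (r t - r b))
          = e \<bullet> ((1 / (b - s)) *\<^sub>R (q b - q s) - (1 / (t - b)) *\<^sub>R (q t - q b))
            - 1 / (b - s) * ((P b - P s) \<bullet> e) + 1 / (t - b) * ((P t - P b) \<bullet> e)"
        by (simp add: r_def inner_diff_left inner_diff_right inner_commute[of e] diff_divide_distrib)
      ultimately show ?thesis by simp
    qed
    then have "(1 / (b - s)) *\<^sub>R (r b - r s) - (1 / (t - b)) *\<^sub>R (r t - r b) = 0"
      by (metis inner_eq_zero_iff)
    then have eq: "(1 / (b - s)) *\<^sub>R (r b - r s) = (1 / (t - b)) *\<^sub>R (r t - r b)" by simp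
    define w where "w = (1 / (b - s)) *\<^sub>R (r b - r s)"
    have 1: "r b - r s = (b - s) *\<^sub>R w" using sb by (simp add: w_def)
    have 2: "r t - r b = (t - b) *\<^sub>R w" using sb by (simp add: w_def eq)
    have "r t - r s = (r t - r b) + (r b - r s)" by simp
    also have "\<dots> = (t - s) *\<^sub>R w"
      unfolding 1 2 by (simp flip: scaleR_add_left)
    finally have 3: "r t - r s = (t - s) *\<^sub>R w" .
    have "r b = r s + (b - s) *\<^sub>R w" using 1 by (simp add: algebra_simps)
    then show ?thesis unfolding 3 using st by simp
  qed
  define w where "w = (1 / (t - s)) *\<^sub>R (r t - r s)"
  show ?thesis
  proof (rule that[of "\<lambda>x. P1 x + w"])
    fix x assume x: "x \<in> {s..t}"
    have D: "((\<lambda>x. P x + (r s + (x - s) *\<^sub>R w)) has_vector_derivative P1 x + w) (at x within {s..t})"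
      by (auto intro!: derivative_eq_intros P x)
    have "q y = P y + (r s + (y - s) *\<^sub>R w)" if "y \<in> {s..t}" for y
      using r[OF that] by (simp add: w_def r_def algebra_simps)
    then show "(q has_vector_derivative P1 x + w) (at x within {s..t})"
      by (rule has_vector_derivative_transform[OF x _ D])
    show "((\<lambda>x. P1 x + w) has_vector_derivative G (q x)) (at x within {s..t})"
      by (auto intro!: derivative_eq_intros P1 x)
  qed
qed

text \<open>Running the piece at speed \<open>r\<close> keeps its end points and turns the action
  into \<open>f r\<close>; minimality at \<open>r = 1\<close> makes kinetic and potential parts
  equal.\<close>

lemma virial:
  assumes st: "s < t" "s \<le> 0" "0 \<le> t" and U: "\<And>x. x \<in> {s..t} \<Longrightarrow> c < V (q x)"
  shows "m t - m s = 2 * integral {s..t} (\<lambda>x. W (q x))"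
proof -
  define k P where "k = m t - m s" and "P = integral {s..t} (\<lambda>x. W (q x))"
  define f where "f \<equiv> \<lambda>r::real. r * k / 2 + P / r"
  have "f 1 \<le> f r" if "r > 0" for r
  proof -
    have le: "s / r \<le> t / r" using st that by (intro divide_right_mono) auto
    have "joinable W (q (r * (s / r) + 0)) (q (r * (t / r) + 0))
      (action W (\<lambda>x. q (r * x + 0)) (\<lambda>x. r * m (r * x + 0)) (s / r) (t / r))"
      by (rule joinableI[OF le kinetic_bound_reparametrize[OF kin that] order_refl])
    then have "joinable W (q s) (q t) (f r)"
      unfolding action_reparametrize[OF that le] using that by (simp add: f_def k_def P_def)
    then show ?thesis
      using locally_minimal[OF st(2,3) U] by (simp add: f_def k_def P_def action_def)
  qed
  moreover have "(f has_real_derivative k / 2 - P) (at 1)"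
    unfolding f_def by (auto intro!: derivative_eq_intros)
  ultimately have "k / 2 - P = 0"
    by (intro DERIV_local_min[of f _ 1 1]) auto
  then show ?thesis by (simp add: k_def P_def)
qed

text \<open>Equipartition on subintervals makes \<open>m\<close> differentiable with derivative
  \<open>2 * W (q x)\<close>, and difference quotients bound the squared speed by it. Equality
  follows because the integral of the squared speed is an admissible certificate that minimality
  does not allow to be smaller.\<close>

lemma newton_energy:
  assumes st: "s < t" "s \<le> 0" "0 \<le> t" and U: "\<And>x. x \<in> {s..t} \<Longrightarrow> c < V (q x)"
  obtains v where
    "\<And>x. x \<in> {s..t} \<Longrightarrow> (q has_vector_derivative v x) (at x within {s..t})"
    "\<And>x. x \<in> {s..t} \<Longrightarrow> (v has_vector_derivative G (q x)) (at x within {s..t})"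
    "\<And>x. x \<in> {s..t} \<Longrightarrow> (norm (v x))\<^sup>2 = 2 * W (q x)"
proof -
  obtain v where
    v: "\<And>x. x \<in> {s..t} \<Longrightarrow> (q has_vector_derivative v x) (at x within {s..t})"
    "\<And>x. x \<in> {s..t} \<Longrightarrow> (v has_vector_derivative G (q x)) (at x within {s..t})"
    using newton[OF st U] by blast
  have v_cont: "continuous_on {s..t} v"
    using v(2) by (rule continuous_on_vector_derivative)
  have Wq: "continuous_on {s..t} (\<lambda>x. W (q x))"
    by (rule continuous_on_compose2[OF W_continuous q_continuous]) auto
  have m_eq: "m x = m s + 2 * integral {s..x} (\<lambda>x. W (q x))" if x: "x \<in> {s..t}" for x
  proof (cases "x = s")
    case False
    then have "s < x" using x by simp
    show ?thesis
    proof (cases "x \<ge> 0")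
      case True
      have "m x - m s = 2 * integral {s..x} (\<lambda>x. W (q x))"
        using True \<open>s < x\<close> st x U by (intro virial) auto
      then show ?thesis by simp
    next
      \<comment> \<open>Local minimality is available on intervals containing 0, so for negative
        \<open>x\<close> the identity on \<open>s..x\<close> is the difference of those on
        \<open>s..t\<close> and \<open>x..t\<close>.\<close>
      case False
      have "m t - m x = 2 * integral {x..t} (\<lambda>x. W (q x))"
        using False st x U by (intro virial) auto
      moreover have "m t - m s = 2 * integral {s..t} (\<lambda>x. W (q x))"
        by (intro virial st U)
      moreover have "integral {s..x} (\<lambda>x. W (q x)) + integral {x..t} (\<lambda>x. W (q x)) = integral {s..t} (\<lambda>x. W (q x))"
        using x by (intro Henstock_Kurzweil_Integration.integral_combine integrable_continuous_real Wq) auto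
      ultimately show ?thesis by linarith
    qed
  qed simp
  have le: "(norm (v x))\<^sup>2 \<le> 2 * W (q x)" if x: "x \<in> {s..t}" for x
  proof -
    have nontriv: "at x within {s..t} \<noteq> bot"
      using st x by (simp add: trivial_limit_within islimpt_Icc)
    have D: "((\<lambda>x. m s + 2 * integral {s..x} (\<lambda>x. W (q x))) has_vector_derivative 2 * W (q x)) (at x within {s..t})"
      using integral_has_vector_derivative[OF Wq x]
      by (auto intro!: derivative_eq_intros simp: has_real_derivative_iff_has_vector_derivative[symmetric])
    have "(m has_vector_derivative 2 * W (q x)) (at x within {s..t})"
      by (rule has_vector_derivative_transform[OF x _ D]) (rule m_eq)
    note lim_m = has_vector_derivative_quotient_tendsto[OF this]
    note lim_q = tendsto_power[OF tendsto_norm[OF has_vector_derivative_quotient_tendsto[OF v(1)[OF x]]], of 2]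
    show ?thesis
    proof (rule tendsto_le[OF nontriv lim_m lim_q])
      have "(norm ((1 / (y - x)) *\<^sub>R (q y - q x)))\<^sup>2 \<le> (1 / (y - x)) *\<^sub>R (m y - m x)" if "y \<noteq> x" for y
      proof -
        have "(norm (q y - q x))\<^sup>2 \<le> (y - x) * (m y - m x)"
          using kinetic_boundD[OF kin[of x y], of x y] kinetic_boundD[OF kin[of y x], of y x]
          by (cases "x \<le> y") (auto simp: norm_minus_commute algebra_simps)
        then have "(norm (q y - q x))\<^sup>2 / (y - x)\<^sup>2 \<le> (y - x) * (m y - m x) / (y - x)\<^sup>2"
          by (intro divide_right_mono) auto
        also have "\<dots> = (m y - m x) / (y - x)" using that by (simp add: power2_eq_square)
        finally show ?thesis by (simp add: power_divide)
      qed
      then show "\<forall>\<^sub>F y in at x within {s..t}.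
          (norm ((1 / (y - x)) *\<^sub>R (q y - q x)))\<^sup>2 \<le> (1 / (y - x)) *\<^sub>R (m y - m x)"
        by (auto simp: eventually_at_filter)
    qed
  qed
  define n where "n x = integral {s..x} (\<lambda>u. (norm (v u))\<^sup>2)" for x
  have "kinetic_bound q n s t"
    unfolding n_def by (rule kinetic_bound_velocity[OF v_cont v(1)])
  then have "action W q m s t \<le> action W q n s t"
    using st U by (intro locally_minimal joinableI) auto
  then have "2 * integral {s..t} (\<lambda>x. W (q x)) \<le> integral {s..t} (\<lambda>u. (norm (v u))\<^sup>2)"
    using m_eq[of t] st by (simp add: action_def n_def)
  moreover have "integral {s..t} (\<lambda>x. 2 * W (q x) - (norm (v x))\<^sup>2)
      = integral {s..t} (\<lambda>x. 2 * W (q x)) - integral {s..t} (\<lambda>x. (norm (v x))\<^sup>2)"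
    by (intro Henstock_Kurzweil_Integration.integral_diff integrable_continuous_real continuous_intros Wq v_cont)
  moreover have "0 \<le> integral {s..t} (\<lambda>x. 2 * W (q x) - (norm (v x))\<^sup>2)"
    using le by (intro Henstock_Kurzweil_Integration.integral_nonneg integrable_continuous_real continuous_intros Wq v_cont) auto
  ultimately have "integral {s..t} (\<lambda>x. 2 * W (q x) - (norm (v x))\<^sup>2) = 0" by simp
  moreover have "continuous_on {s..t} (\<lambda>x. 2 * W (q x) - (norm (v x))\<^sup>2)"
    by (intro continuous_intros Wq v_cont)
  \<comment> \<open>A continuous nonnegative function with integral 0 vanishes everywhere.\<close>
  ultimately have "\<forall>x\<in>{s..t}. 2 * W (q x) - (norm (v x))\<^sup>2 = 0"
    using integral_eq_0_iff[of s t "\<lambda>x. 2 * W (q x) - (norm (v x))\<^sup>2"] le st by simp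
  then show ?thesis using that[of v] v by simp
qed

end

section \<open>Reflection at the wells\<close>

text \<open>The equation holds only in the interior of the piece between the wells. Continuity of
  the right-hand side carries it to the end points as one-sided derivatives, which are then glued to
  the reflected piece.\<close>

lemma has_vector_derivative_closed_interval:
  fixes f g :: "real \<Rightarrow> 'a::banach"
  assumes f: "continuous_on {x..y} f" and g: "continuous_on {x..y} g"
    and deriv: "\<And>z. z \<in> {x<..<y} \<Longrightarrow> (f has_vector_derivative g z) (at z)"
    and z: "z \<in> {x..y}"
  shows "(f has_vector_derivative g z) (at z within {x..y})"
proof -
  have "((\<lambda>u. f x + integral {x..u} g) has_vector_derivative 0 + g z) (at z within {x..y})"
    by (intro has_vector_derivative_add has_vector_derivative_const integral_has_vector_derivative g z)
  then have D: "((\<lambda>u. f x + integral {x..u} g) has_vector_derivative g z) (at z within {x..y})"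
    by simp
  have "f u = f x + integral {x..u} g" if u: "u \<in> {x..y}" for u
  proof -
    have "(g has_integral f u - f x) {x..u}"
      using u by (intro fundamental_theorem_of_calculus_interior continuous_on_subset[OF f] deriv) auto
    then show ?thesis by (simp add: integral_unique)
  qed
  then show ?thesis by (rule has_vector_derivative_transform[OF z _ D])
qed

lemma has_vector_derivative_left_right:
  fixes f :: "real \<Rightarrow> 'a::real_normed_vector"
  assumes "x < t" "t < y"
    and "(f has_vector_derivative D) (at t within {x..t})" "(f has_vector_derivative D) (at t within {t..y})"
  shows "(f has_vector_derivative D) (at t)"
proof -
  have "(f has_vector_derivative D) (at t within {x..t} \<union> {t..y})"
    using assms(3,4) unfolding has_vector_derivative_def has_derivative_within Lim_within_Un by auto
  moreover have "{x..t} \<union> {t..y} = {x..y}" using assms by auto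
  ultimately show ?thesis using assms by (simp add: at_within_Icc_at)
qed

text \<open>On \<open>x..y\<close> the time change \<open>\<phi>\<close> has slope \<open>s\<close>,
  either 1 or -1. The sign \<open>\<sigma> t\<close> is compared with \<open>s\<close> only after
  multiplication by the velocity, so one value of \<open>\<sigma>\<close> serves both neighbouring
  pieces at a turning point, where the velocity is 0.\<close>

definition isometric_piece ::
  "real set \<Rightarrow> (real \<Rightarrow> 'a::real_normed_vector) \<Rightarrow> (real \<Rightarrow> real) \<Rightarrow> (real \<Rightarrow> real) \<Rightarrow> real \<Rightarrow> real \<Rightarrow> bool" where
  "isometric_piece T v \<phi> \<sigma> x y \<longleftrightarrow>
     (\<exists>s\<in>{1, -1}. \<forall>t\<in>{x..y}. \<phi> t = \<phi> x + s * (t - x) \<and> \<phi> t \<in> T \<and> \<sigma> t *\<^sub>R v (\<phi> t) = s *\<^sub>R v (\<phi> t))"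

lemma isometric_piece_derivatives:
  fixes q v g :: "real \<Rightarrow> 'a::real_normed_vector"
  assumes seg: "\<And>x y z. x < y \<Longrightarrow> {x..y} \<subseteq> T \<Longrightarrow> z \<in> {x..y} \<Longrightarrow>
      (q has_vector_derivative v z) (at z within {x..y}) \<and> (v has_vector_derivative g z) (at z within {x..y})"
    and piece: "isometric_piece T v \<phi> \<sigma> x y" and "x < y" and t: "t \<in> {x..y}"
  shows "((\<lambda>t. q (\<phi> t)) has_vector_derivative \<sigma> t *\<^sub>R v (\<phi> t)) (at t within {x..y})"
    and "((\<lambda>t. \<sigma> t *\<^sub>R v (\<phi> t)) has_vector_derivative g (\<phi> t)) (at t within {x..y})"
proof -
  obtain s where s: "s = 1 \<or> s = -1" and p: "\<And>t. t \<in> {x..y} \<Longrightarrow> \<phi> t = \<phi> x + s * (t - x)"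
    and T: "\<And>t. t \<in> {x..y} \<Longrightarrow> \<phi> t \<in> T" and v: "\<And>t. t \<in> {x..y} \<Longrightarrow> \<sigma> t *\<^sub>R v (\<phi> t) = s *\<^sub>R v (\<phi> t)"
    using piece unfolding isometric_piece_def by blast
  define l where "l = (\<lambda>t. \<phi> x + s * (t - x))"
  have lt: "l u = \<phi> u" if "u \<in> {x..y}" for u
    unfolding l_def by (rule p[OF that, symmetric])
  define x' y' where "x' = (if s = 1 then \<phi> x else \<phi> x - (y - x))" and "y' = x' + (y - x)"
  have im: "l ` {x..y} = {x'..y'}"
  proof (intro equalityI subsetI)
    fix u assume "u \<in> l ` {x..y}"
    then show "u \<in> {x'..y'}" using s by (auto simp: l_def x'_def y'_def)
  next
    fix u assume u: "u \<in> {x'..y'}"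
    have "u = l (x + s * (u - \<phi> x))" using s by (auto simp: l_def)
    moreover have "x + s * (u - \<phi> x) \<in> {x..y}" using s u by (auto simp: x'_def y'_def)
    ultimately show "u \<in> l ` {x..y}" by (rule image_eqI)
  qed
  have xy: "x' < y'" using \<open>x < y\<close> by (simp add: y'_def)
  have sub: "{x'..y'} \<subseteq> T" unfolding im[symmetric] using lt T by auto
  have "l t \<in> {x'..y'}" unfolding im[symmetric] using t by (rule imageI)
  note d = seg[OF xy sub this, folded im]
  have l: "(l has_vector_derivative s) (at t within {x..y})"
    unfolding l_def has_real_derivative_iff_has_vector_derivative[symmetric]
    by (auto intro!: derivative_eq_intros)
  have "((q \<circ> l) has_vector_derivative s *\<^sub>R v (l t)) (at t within {x..y})"
    by (rule vector_diff_chain_within[OF l conjunct1[OF d]])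
  then have "((q \<circ> l) has_vector_derivative \<sigma> t *\<^sub>R v (\<phi> t)) (at t within {x..y})"
    by (simp only: v[OF t] lt[OF t])
  then show "((\<lambda>t. q (\<phi> t)) has_vector_derivative \<sigma> t *\<^sub>R v (\<phi> t)) (at t within {x..y})"
    by (rule has_vector_derivative_transform[OF t, rotated]) (simp only: lt o_def)
  have "((\<lambda>u. s *\<^sub>R (v \<circ> l) u) has_vector_derivative s *\<^sub>R (s *\<^sub>R g (l t))) (at t within {x..y})"
    by (intro bounded_linear.has_vector_derivative[OF bounded_linear_scaleR_right]
        vector_diff_chain_within[OF l conjunct2[OF d]])
  then have "((\<lambda>u. s *\<^sub>R (v \<circ> l) u) has_vector_derivative g (\<phi> t)) (at t within {x..y})"
    \<comment> \<open>The sign enters the second derivative twice, which is why time reversal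
      preserves Newton's equation.\<close>
    using s by (elim disjE) (simp_all add: lt[OF t])
  then show "((\<lambda>t. \<sigma> t *\<^sub>R v (\<phi> t)) has_vector_derivative g (\<phi> t)) (at t within {x..y})"
    by (rule has_vector_derivative_transform[OF t, rotated]) (simp only: lt v o_def)
qed

text \<open>Each time is the end of one piece and the start of another. Both give the same formulas
  for the one-sided derivatives, so the two-sided ones exist, also at turning points.\<close>

lemma folded_solution:
  fixes q v g :: "real \<Rightarrow> 'a::real_normed_vector"
  assumes seg: "\<And>x y z. x < y \<Longrightarrow> {x..y} \<subseteq> T \<Longrightarrow> z \<in> {x..y} \<Longrightarrow>
      (q has_vector_derivative v z) (at z within {x..y}) \<and> (v has_vector_derivative g z) (at z within {x..y})"
    and right: "\<And>t. \<exists>y>t. isometric_piece T v \<phi> \<sigma> t y"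
    and left: "\<And>t. \<exists>x<t. isometric_piece T v \<phi> \<sigma> x t"
  shows "((\<lambda>t. q (\<phi> t)) has_vector_derivative \<sigma> t *\<^sub>R v (\<phi> t)) (at t)"
    and "((\<lambda>t. \<sigma> t *\<^sub>R v (\<phi> t)) has_vector_derivative g (\<phi> t)) (at t)"
    and "\<phi> t \<in> T" and "norm (\<sigma> t *\<^sub>R v (\<phi> t)) = norm (v (\<phi> t))"
proof -
  obtain y where y: "t < y" "isometric_piece T v \<phi> \<sigma> t y" using right by blast
  obtain x where x: "x < t" "isometric_piece T v \<phi> \<sigma> x t" using left by blast
  have "t \<in> {t..y}" "t \<in> {x..t}" using x y by auto
  note R = isometric_piece_derivatives[OF seg y(2,1) this(1)]
    and L = isometric_piece_derivatives[OF seg x(2,1) this(2)]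
  show "((\<lambda>t. q (\<phi> t)) has_vector_derivative \<sigma> t *\<^sub>R v (\<phi> t)) (at t)"
    by (rule has_vector_derivative_left_right[OF x(1) y(1) L(1) R(1)])
  show "((\<lambda>t. \<sigma> t *\<^sub>R v (\<phi> t)) has_vector_derivative g (\<phi> t)) (at t)"
    by (rule has_vector_derivative_left_right[OF x(1) y(1) L(2) R(2)])
  obtain s where s: "s = 1 \<or> s = -1" "\<forall>u\<in>{t..y}. \<phi> u \<in> T \<and> \<sigma> u *\<^sub>R v (\<phi> u) = s *\<^sub>R v (\<phi> u)"
    using y(2) unfolding isometric_piece_def by blast
  then have "\<phi> t \<in> T \<and> \<sigma> t *\<^sub>R v (\<phi> t) = s *\<^sub>R v (\<phi> t)" using y(1) by simp
  then show "\<phi> t \<in> T" "norm (\<sigma> t *\<^sub>R v (\<phi> t)) = norm (v (\<phi> t))" using s(1) by auto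
qed

text \<open>The reflections turn a brake orbit into a periodic one and a half-line solution that stops at a
  boundary point into a homoclinic one. They are smooth because the velocity vanishes at the finite
  ends of \<open>T\<close>.\<close>

lemma exists_folding:
  fixes v :: "real \<Rightarrow> 'a::real_normed_vector"
  assumes "(\<forall>x\<ge>0. x \<in> T) \<or> (\<exists>b>0. (\<forall>x\<in>{0..b}. x \<in> T) \<and> v b = 0 \<and> (\<forall>x>b. x \<notin> T))"
    and "(\<forall>x\<le>0. x \<in> T) \<or> (\<exists>a<0. (\<forall>x\<in>{a..0}. x \<in> T) \<and> v a = 0 \<and> (\<forall>x<a. x \<notin> T))"
  obtains \<phi> \<sigma> where "\<And>t. \<exists>y>t. isometric_piece T v \<phi> \<sigma> t y" "\<And>t. \<exists>x<t. isometric_piece T v \<phi> \<sigma> x t"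
    "\<And>t. t \<in> T \<Longrightarrow> \<phi> t = t"
proof -
  consider (line) "T = UNIV" | (left) b where "T = {..b}" "v b = 0"
    | (right) a where "T = {a..}" "v a = 0" | (both) a b where "a < b" "T = {a..b}" "v a = 0" "v b = 0"
  proof -
    have pos: "(\<forall>x\<ge>0. x \<in> T) \<or> (\<exists>b>0. (\<forall>x\<ge>0. x \<in> T \<longleftrightarrow> x \<le> b) \<and> v b = 0)"
      using assms(1)
    proof (elim disjE exE conjE)
      fix b assume "0 < b" "v b = 0" "\<forall>x\<in>{0..b}. x \<in> T" "\<forall>x>b. x \<notin> T"
      then have "\<forall>x\<ge>0. x \<in> T \<longleftrightarrow> x \<le> b" by (auto simp: not_le[symmetric])
      with \<open>0 < b\<close> \<open>v b = 0\<close> show ?thesis by blast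
    qed blast
    have neg: "(\<forall>x\<le>0. x \<in> T) \<or> (\<exists>a<0. (\<forall>x\<le>0. x \<in> T \<longleftrightarrow> a \<le> x) \<and> v a = 0)"
      using assms(2)
    proof (elim disjE exE conjE)
      fix a assume "a < 0" "v a = 0" "\<forall>x\<in>{a..0}. x \<in> T" "\<forall>x<a. x \<notin> T"
      then have "\<forall>x\<le>0. x \<in> T \<longleftrightarrow> a \<le> x" by (auto simp: not_le[symmetric])
      with \<open>a < 0\<close> \<open>v a = 0\<close> show ?thesis by blast
    qed blast
    from pos neg show thesis
    proof (elim disjE exE conjE)
      assume "\<forall>x\<ge>0. x \<in> T" "\<forall>x\<le>0. x \<in> T"
      then have "T = UNIV" by (metis UNIV_eq_I linear)
      then show thesis by (rule line)
    next
      fix a assume *: "\<forall>x\<ge>0. x \<in> T" "\<forall>x\<le>0. x \<in> T \<longleftrightarrow> a \<le> x" "a < 0" "v a = 0"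
      have "x \<in> T \<longleftrightarrow> a \<le> x" for x using * by (cases "0 \<le> x") auto
      then show thesis using right[of a] * by auto
    next
      fix b assume *: "\<forall>x\<le>0. x \<in> T" "\<forall>x\<ge>0. x \<in> T \<longleftrightarrow> x \<le> b" "0 < b" "v b = 0"
      have "x \<in> T \<longleftrightarrow> x \<le> b" for x using * by (cases "0 \<le> x") auto
      then show thesis using left[of b] * by auto
    next
      fix a b assume *: "\<forall>x\<le>0. x \<in> T \<longleftrightarrow> a \<le> x" "a < 0" "v a = 0" "\<forall>x\<ge>0. x \<in> T \<longleftrightarrow> x \<le> b" "0 < b" "v b = 0"
      have "x \<in> T \<longleftrightarrow> a \<le> x \<and> x \<le> b" for x
      proof (cases "0 \<le> x")
        case True
        then have "x \<in> T \<longleftrightarrow> x \<le> b" using *(4) by blast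
        with True *(2) show ?thesis by linarith
      next
        case False
        then have "x \<in> T \<longleftrightarrow> a \<le> x" using *(1) by simp
        with False *(5) show ?thesis by linarith
      qed
      then have T: "T = {a..b}" by (simp add: set_eq_iff)
      have "a < b" using *(2,5) by linarith
      from both[OF this T *(3,6)] show thesis .
    qed
  qed
  then show thesis
  proof cases
    case line
    show thesis
    proof (rule that[of "\<lambda>t. t" "\<lambda>t. 1"])
      show "\<exists>y>t. isometric_piece T v (\<lambda>t. t) (\<lambda>t. 1) t y" for t
        by (intro exI[of _ "t + 1"]) (auto simp: isometric_piece_def line)
      show "\<exists>x<t. isometric_piece T v (\<lambda>t. t) (\<lambda>t. 1) x t" for t
        by (intro exI[of _ "t - 1"]) (auto simp: isometric_piece_def line)
    qed auto
  next
    case (left b)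
    define \<phi> \<sigma> where "\<phi> t = b - \<bar>t - b\<bar>" and "\<sigma> t = (if t \<le> b then 1 else - 1 :: real)" for t
    have "isometric_piece T v \<phi> \<sigma> x y" if "y \<le> b" for x y
      unfolding isometric_piece_def using that left by (intro bexI[of _ 1]) (auto simp: \<phi>_def \<sigma>_def)
    moreover have "isometric_piece T v \<phi> \<sigma> x y" if "b \<le> x" for x y
      unfolding isometric_piece_def
    proof (intro bexI[of _ "-1"] ballI)
      fix t assume "t \<in> {x..y}"
      then show "\<phi> t = \<phi> x + - 1 * (t - x) \<and> \<phi> t \<in> T \<and> \<sigma> t *\<^sub>R v (\<phi> t) = - 1 *\<^sub>R v (\<phi> t)"
        using that left by (cases "t = b") (auto simp: \<phi>_def \<sigma>_def)
    qed auto
    ultimately have P: "y \<le> b \<or> b \<le> x \<Longrightarrow> isometric_piece T v \<phi> \<sigma> x y" for x y by blast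
    show thesis
    proof (rule that[of \<phi> \<sigma>])
      show "\<exists>y>t. isometric_piece T v \<phi> \<sigma> t y" for t
        by (rule exI[of _ "if t < b then b else t + 1"]) (auto intro: P)
      show "\<exists>x<t. isometric_piece T v \<phi> \<sigma> x t" for t
        by (rule exI[of _ "if b < t then b else t - 1"]) (auto intro: P)
    qed (auto simp: \<phi>_def left)
  next
    case (right a)
    define \<phi> \<sigma> where "\<phi> t = a + \<bar>t - a\<bar>" and "\<sigma> t = (if a \<le> t then 1 else - 1 :: real)" for t
    have "isometric_piece T v \<phi> \<sigma> x y" if "y \<le> a" for x y
      unfolding isometric_piece_def
    proof (intro bexI[of _ "-1"] ballI)
      fix t assume "t \<in> {x..y}"
      then show "\<phi> t = \<phi> x + - 1 * (t - x) \<and> \<phi> t \<in> T \<and> \<sigma> t *\<^sub>R v (\<phi> t) = - 1 *\<^sub>R v (\<phi> t)"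
        using that right by (cases "t = a") (auto simp: \<phi>_def \<sigma>_def)
    qed auto
    moreover have "isometric_piece T v \<phi> \<sigma> x y" if "a \<le> x" for x y
      unfolding isometric_piece_def using that right by (intro bexI[of _ 1]) (auto simp: \<phi>_def \<sigma>_def)
    ultimately have P: "y \<le> a \<or> a \<le> x \<Longrightarrow> isometric_piece T v \<phi> \<sigma> x y" for x y by blast
    show thesis
    proof (rule that[of \<phi> \<sigma>])
      show "\<exists>y>t. isometric_piece T v \<phi> \<sigma> t y" for t
        by (rule exI[of _ "if t < a then a else t + 1"]) (auto intro: P)
      show "\<exists>x<t. isometric_piece T v \<phi> \<sigma> x t" for t
        by (rule exI[of _ "if a < t then a else t - 1"]) (auto intro: P)
    qed (auto simp: \<phi>_def right)
  next
    case (both a b)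
    \<comment> \<open>The triangle wave of period \<open>2 * L\<close>: \<open>k t\<close> is the
      index of the cell containing \<open>t\<close>, and odd cells are run backwards.\<close>
    define L where "L = b - a"
    have "L > 0" using both by (simp add: L_def)
    define k where "k t = \<lfloor>(t - a) / L\<rfloor>" for t
    define \<phi> where "\<phi> t = (if even (k t) then t - k t * L else 2 * a + (k t + 1) * L - t)" for t
    define \<sigma> where "\<sigma> t = (if even (k t) then 1 else - 1 :: real)" for t
    have k: "k t = n" if "a + n * L \<le> t" "t < a + (n + 1) * L" for t and n :: int
      unfolding k_def using that \<open>L > 0\<close> by (intro floor_unique) (auto simp: field_simps)
    \<comment> \<open>The cell is closed on the right although the floor assigns that point to the
      next cell: the two formulas for \<open>\<phi>\<close> agree there, and the sign is irrelevant
      because \<open>v\<close> vanishes at \<open>a\<close> and \<open>b\<close>.\<close>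
    have cell: "\<phi> t = (if even n then t - n * L else 2 * a + (n + 1) * L - t)
        \<and> \<sigma> t *\<^sub>R v (\<phi> t) = (if even n then 1 else - 1 :: real) *\<^sub>R v (\<phi> t)"
      if "a + n * L \<le> t" "t \<le> a + (n + 1) * L" for t and n :: int
    proof (cases "t < a + (n + 1) * L")
      case True
      then show ?thesis using k[of n t] that by (simp add: \<phi>_def \<sigma>_def)
    next
      case False
      then have t: "t = a + (n + 1) * L" using that by simp
      have "k t = n + 1" using \<open>L > 0\<close> by (intro k) (auto simp: t algebra_simps)
      then have "\<phi> t = (if even n then b else a)"
        by (auto simp: \<phi>_def t L_def algebra_simps)
      then show ?thesis using both by (auto simp: t L_def algebra_simps)
    qed
    have P: "isometric_piece T v \<phi> \<sigma> x y" if "x < y" "a + n * L \<le> x" "y \<le> a + (n + 1) * L" for x y and n :: int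
      unfolding isometric_piece_def
    proof (rule bexI[of _ "if even n then 1 else - 1"])
      show "\<forall>t\<in>{x..y}. \<phi> t = \<phi> x + (if even n then 1 else - 1) * (t - x) \<and> \<phi> t \<in> T
          \<and> \<sigma> t *\<^sub>R v (\<phi> t) = (if even n then 1 else - 1) *\<^sub>R v (\<phi> t)"
      proof
        fix t assume t: "t \<in> {x..y}"
        then have *: "a + n * L \<le> t" "t \<le> a + (n + 1) * L" "a + n * L \<le> x" "x \<le> a + (n + 1) * L"
          using that by auto
        then have "\<phi> t \<in> T"
          using cell[of n t] both by (auto simp: L_def algebra_simps split: if_splits)
        then show "\<phi> t = \<phi> x + (if even n then 1 else - 1) * (t - x) \<and> \<phi> t \<in> T
          \<and> \<sigma> t *\<^sub>R v (\<phi> t) = (if even n then 1 else - 1) *\<^sub>R v (\<phi> t)"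
          using cell[OF *(1,2)] cell[OF *(3,4)] by auto
      qed
    qed auto
    show thesis
    proof (rule that[of \<phi> \<sigma>])
      fix t
      define n where "n = \<lfloor>(t - a) / L\<rfloor>"
      have "n \<le> (t - a) / L" "(t - a) / L < n + 1"
        unfolding n_def by linarith+
      then have "a + n * L \<le> t" "t < a + (n + 1) * L"
        using \<open>L > 0\<close> by (auto simp: pos_le_divide_eq pos_divide_less_eq)
      then show "\<exists>y>t. isometric_piece T v \<phi> \<sigma> t y"
        by (intro exI[of _ "a + (n + 1) * L"]) (auto intro: P)
      \<comment> \<open>Ceiling minus 1 rather than floor, so that the cell starts strictly before
        \<open>t\<close> even when \<open>t\<close> is a turning point.\<close>
      define l where "l = \<lceil>(t - a) / L\<rceil> - 1"
      have "l < (t - a) / L" "(t - a) / L \<le> l + 1"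
        unfolding l_def by linarith+
      then have "a + l * L < t" "t \<le> a + (l + 1) * L"
        using \<open>L > 0\<close> by (auto simp: pos_less_divide_eq pos_divide_le_eq)
      then show "\<exists>x<t. isometric_piece T v \<phi> \<sigma> x t"
        by (intro exI[of _ "a + l * L"]) (auto intro: P)
      show "\<phi> t = t" if "t \<in> T"
        using cell[of 0 t] that both by (simp add: L_def)
    qed
  qed
qed

section \<open>The minimal curve up to its first contact with the wells\<close>

context minimal_curve
begin

text \<open>The limit curve need not be differentiable where it meets a well. The value 0 is the
  continuous extension from within \<open>life\<close>, since the squared speed equals
  \<open>2 * W (q x)\<close>.\<close>

definition vel :: "real \<Rightarrow> 'a" where
  "vel x = (if c < V (q x) then vector_derivative q (at x) else 0)"

text \<open>The interval around 0 up to and including the first times at which the curve meets a well;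
  at these times \<open>vel\<close> takes the value 0.\<close>

definition life :: "real set" where
  "life = {x. \<forall>y. 0 \<le> y \<and> y < x \<or> x < y \<and> y \<le> 0 \<longrightarrow> c < V (q y)}"

lemma V_q_continuous: "continuous_on S (\<lambda>x. V (q x))"
  by (rule continuous_on_compose2[OF V_cont continuous_on_subset[OF q_continuous_UNIV]]) auto

lemma V_q_zero: "c < V (q 0)"
proof -
  have "q 0 \<notin> B" using q_zero separated infdist_wells(2)[of "q 0"] by linarith
  moreover have "q 0 \<notin> A" using q_zero separated infdist_zero[of "q 0" A] by linarith
  ultimately show ?thesis using in_wells_iff[of "q 0"] by simp
qed

lemma vel_interior:
  assumes st: "s < x" "x < t" "s \<le> 0" "0 \<le> t" and U: "\<And>x. x \<in> {s..t} \<Longrightarrow> c < V (q x)"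
  shows "(q has_vector_derivative vel x) (at x)" "(vel has_vector_derivative G (q x)) (at x)"
    "(norm (vel x))\<^sup>2 = 2 * W (q x)"
proof -
  have "s < t" using st by linarith
  then obtain v where
    v: "\<And>x. x \<in> {s..t} \<Longrightarrow> (q has_vector_derivative v x) (at x within {s..t})"
    "\<And>x. x \<in> {s..t} \<Longrightarrow> (v has_vector_derivative G (q x)) (at x within {s..t})"
    "\<And>x. x \<in> {s..t} \<Longrightarrow> (norm (v x))\<^sup>2 = 2 * W (q x)"
    using newton_energy[OF _ st(3,4) U] by blast
  have at: "at y within {s..t} = at y" if "y \<in> {s<..<t}" for y
    using that by (intro at_within_Icc_at) auto
  \<comment> \<open>The velocity supplied for one interval is the derivative of \<open>q\<close> in
    its interior, so the choices for different intervals are all restrictions of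
    \<open>vel\<close>.\<close>
  have eq: "vel y = v y" if "y \<in> {s<..<t}" for y
    using v(1)[of y] U[of y] that by (auto simp: vel_def at vector_derivative_at)
  show "(q has_vector_derivative vel x) (at x)" "(norm (vel x))\<^sup>2 = 2 * W (q x)"
    using v(1,3)[of x] st eq[of x] by (auto simp: at)
  have "(v has_vector_derivative G (q x)) (at x)" using v(2)[of x] st by (simp add: at)
  then show "(vel has_vector_derivative G (q x)) (at x)"
    by (rule has_vector_derivative_transform_within_open[of _ _ _ "{s<..<t}"]) (use st eq in auto)
qed

lemma vel_life:
  assumes "x \<in> life" "c < V (q x)"
  shows "(q has_vector_derivative vel x) (at x)" "(vel has_vector_derivative G (q x)) (at x)"
    "(norm (vel x))\<^sup>2 = 2 * W (q x)"
proof -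
  have "open {x. c < V (q x)}" by (intro open_Collect_less V_q_continuous continuous_on_const)
  moreover have "x \<in> {x. c < V (q x)}" using assms(2) by simp
  ultimately obtain e where e: "e > 0" "\<And>y. dist y x < e \<Longrightarrow> c < V (q y)"
    unfolding open_dist by blast
  \<comment> \<open>The neighbourhood of \<open>x\<close> is joined to 0, since Newton's equation
    was proved on intervals around 0 only; the points in between are above level \<open>c\<close> by
    the definition of \<open>life\<close>.\<close>
  have U: "c < V (q y)" if "y \<in> {min 0 (x - e / 2)..max 0 (x + e / 2)}" for y
  proof (cases "dist y x < e")
    case False
    then have "0 \<le> y \<and> y < x \<or> x < y \<and> y \<le> 0"
      using that e by (auto simp: dist_real_def min_def max_def split: if_splits)
    then show ?thesis using assms(1) by (auto simp: life_def)
  qed (use e in auto)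
  show "(q has_vector_derivative vel x) (at x)" "(vel has_vector_derivative G (q x)) (at x)"
    "(norm (vel x))\<^sup>2 = 2 * W (q x)"
    using e by (intro vel_interior[OF _ _ _ _ U]; auto)+
qed

lemma vel_norm: "x \<in> life \<Longrightarrow> (norm (vel x))\<^sup>2 = 2 * W (q x)"
  using vel_life(3)[of x] by (cases "c < V (q x)") (auto simp: vel_def W_def)

lemma life_interior:
  assumes "{x..y} \<subseteq> life" "x < z" "z < y"
  shows "z \<in> life" "c < V (q z)"
proof -
  have "x \<in> life" "y \<in> life" "z \<in> life" using assms by auto
  then show "z \<in> life" "c < V (q z)" using assms(2,3) by (cases "0 \<le> z"; auto simp: life_def)+
qed

text \<open>Above level \<open>c\<close> the velocity is differentiable; at a contact time its norm
  is squeezed by the square root of \<open>2 * W (q y)\<close>, which tends to 0.\<close>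

lemma vel_continuous: "continuous_on life vel"
  unfolding continuous_on_def
proof
  fix x assume x: "x \<in> life"
  show "(vel \<longlongrightarrow> vel x) (at x within life)"
  proof (cases "c < V (q x)")
    case True
    then show ?thesis
      using has_vector_derivative_continuous[OF vel_life(2)[OF x]] continuous_within
        continuous_at_imp_continuous_at_within by blast
  next
    case False
    have "continuous_on life (\<lambda>y. sqrt (2 * W (q y)))"
      by (intro continuous_intros continuous_on_compose2[OF W_continuous continuous_on_subset[OF q_continuous_UNIV]]) auto
    moreover have "sqrt (2 * W (q x)) = 0" using False by (simp add: W_def)
    ultimately have "((\<lambda>y. sqrt (2 * W (q y))) \<longlongrightarrow> 0) (at x within life)"
      using x by (metis continuous_on_def)
    moreover have "\<forall>\<^sub>F y in at x within life. norm (vel y) \<le> sqrt (2 * W (q y))"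
      unfolding eventually_at_filter
      by (intro always_eventually) (auto intro!: real_le_rsqrt simp: vel_norm)
    ultimately have "(vel \<longlongrightarrow> 0) (at x within life)"
      by (rule Lim_null_comparison[rotated])
    then show ?thesis using False by (simp add: vel_def)
  qed
qed

lemma life_segment:
  assumes "x < y" "{x..y} \<subseteq> life" "z \<in> {x..y}"
  shows "(q has_vector_derivative vel z) (at z within {x..y}) \<and> (vel has_vector_derivative G (q z)) (at z within {x..y})"
proof
  have vc: "continuous_on {x..y} vel" by (rule continuous_on_subset[OF vel_continuous assms(2)])
  have Gq: "continuous_on {x..y} (\<lambda>z. G (q z))"
    by (rule continuous_on_compose2[OF G_continuous q_continuous]) auto
  show "(q has_vector_derivative vel z) (at z within {x..y})"
    using life_interior[OF assms(2)]
    by (intro has_vector_derivative_closed_interval[OF q_continuous vc _ assms(3)] vel_life) auto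
  show "(vel has_vector_derivative G (q z)) (at z within {x..y})"
    using life_interior[OF assms(2)]
    by (intro has_vector_derivative_closed_interval[OF vc Gq _ assms(3)] vel_life) auto
qed

text \<open>The factor \<open>r\<close> is instantiated with 1 and -1, to treat both time directions
  at once.\<close>

lemma first_exit:
  assumes "0 \<le> t" "V (q (r * t)) \<le> c"
  obtains b where "0 < b" "V (q (r * b)) \<le> c" "\<And>x. 0 \<le> x \<Longrightarrow> x < b \<Longrightarrow> c < V (q (r * x))"
proof -
  define S where "S = {0..t} \<inter> ({0..t} \<inter> (\<lambda>x. V (q (r * x))) -` {..c})"
  have cont: "continuous_on {0..t} (\<lambda>x. V (q (r * x)))"
    by (rule continuous_on_compose2[OF V_q_continuous[of UNIV]]) (auto intro!: continuous_intros)
  have "closed ({0..t} \<inter> (\<lambda>x. V (q (r * x))) -` {..c})"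
    by (intro continuous_closed_preimage cont) auto
  then have comp: "compact S"
    unfolding S_def by (intro compact_Int_closed) auto
  have "t \<in> S" using assms by (simp add: S_def)
  then have "S \<noteq> {}" by blast
  then obtain b where b: "b \<in> S" "\<And>x. x \<in> S \<Longrightarrow> b \<le> x"
    using compact_attains_inf[OF comp] by blast
  have b': "0 \<le> b" "b \<le> t" "V (q (r * b)) \<le> c" using b(1) by (auto simp: S_def)
  have "c < V (q (r * x))" if "0 \<le> x" "x < b" for x
  proof (rule ccontr)
    assume "\<not> c < V (q (r * x))"
    then have "x \<in> S" using that b' by (simp add: S_def)
    then show False using b(2)[of x] that by simp
  qed
  moreover have "b \<noteq> 0" using b'(3) V_q_zero by auto
  then have "0 < b" using b'(1) by simp
  ultimately show ?thesis using that b'(3) by blast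
qed

lemma life_right: "(\<forall>x\<ge>0. x \<in> life) \<or> (\<exists>b>0. (\<forall>x\<in>{0..b}. x \<in> life) \<and> V (q b) \<le> c \<and> (\<forall>x>b. x \<notin> life))"
proof (cases "\<exists>t\<ge>0. V (q t) \<le> c")
  case True
  then obtain b where b: "0 < b" "V (q b) \<le> c" "\<And>x. 0 \<le> x \<Longrightarrow> x < b \<Longrightarrow> c < V (q x)"
    using first_exit[of _ 1] by (metis mult_1)
  have "x \<in> life" if "x \<in> {0..b}" for x using that b by (auto simp: life_def)
  moreover have "x \<notin> life" if "x > b" for x
  proof
    assume "x \<in> life"
    then have "0 \<le> b \<and> b < x \<longrightarrow> c < V (q b)" unfolding life_def by blast
    then show False using that b(1,2) by simp
  qed
  ultimately show ?thesis using b(1,2) by blast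
next
  case False
  then have "c < V (q y)" if "y \<ge> 0" for y using that by (meson not_le)
  then have "x \<in> life" if "x \<ge> 0" for x using that by (auto simp: life_def)
  then show ?thesis by blast
qed

lemma life_left: "(\<forall>x\<le>0. x \<in> life) \<or> (\<exists>a<0. (\<forall>x\<in>{a..0}. x \<in> life) \<and> V (q a) \<le> c \<and> (\<forall>x<a. x \<notin> life))"
proof (cases "\<exists>t\<le>0. V (q t) \<le> c")
  case True
  then obtain t where "t \<le> 0" "V (q t) \<le> c" by blast
  then obtain b where b: "0 < b" "V (q (- b)) \<le> c" "\<And>x. 0 \<le> x \<Longrightarrow> x < b \<Longrightarrow> c < V (q (- x))"
    using first_exit[of "- t" "-1"] by auto
  have b': "c < V (q x)" if "x \<le> 0" "- b < x" for x using b(3)[of "- x"] that by simp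
  have "x \<in> life" if "x \<in> {- b..0}" for x using that b' by (auto simp: life_def)
  moreover have "x \<notin> life" if "x < - b" for x
  proof
    assume "x \<in> life"
    then have "x < - b \<and> - b \<le> 0 \<longrightarrow> c < V (q (- b))" unfolding life_def by blast
    then show False using that b(1,2) by simp
  qed
  ultimately show ?thesis using b(1,2) by (intro disjI2 exI[of _ "- b"]) auto
next
  case False
  then have "c < V (q y)" if "y \<le> 0" for y using that by (meson not_le)
  then have "x \<in> life" if "x \<le> 0" for x using that by (auto simp: life_def)
  then show ?thesis by blast
qed

text \<open>A value below \<open>c\<close> would persist at slightly earlier times towards 0, where
  the potential exceeds \<open>c\<close>. Hence \<open>W\<close> is exactly \<open>V - c\<close>
  along the curve, as the energy identity requires.\<close>

lemma life_V_ge: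
  assumes "x \<in> life"
  shows "c \<le> V (q x)"
proof (rule ccontr)
  assume less: "\<not> c \<le> V (q x)"
  then have "x \<noteq> 0" using V_q_zero by auto
  have "open {x. V (q x) < c}" by (intro open_Collect_less V_q_continuous continuous_on_const)
  moreover have "x \<in> {x. V (q x) < c}" using less by simp
  ultimately obtain e where e: "e > 0" "\<And>y. dist y x < e \<Longrightarrow> V (q y) < c"
    unfolding open_dist by blast
  define y where "y = (if x > 0 then max 0 (x - e / 2) else min 0 (x + e / 2))"
  have "V (q y) < c" using e \<open>x \<noteq> 0\<close> by (intro e(2)) (auto simp: y_def dist_real_def)
  moreover have "c < V (q y)"
    using assms \<open>x \<noteq> 0\<close> e(1) by (auto simp: life_def y_def)
  ultimately show False by simp
qed

text \<open>If the curve stops in finite time it stops in \<open>B\<close>, because after time 0 it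
  stays away from \<open>A\<close>; otherwise the approach at large times applies.\<close>

lemma life_reaches_B:
  assumes "\<epsilon> > 0"
  obtains t where "t \<in> life" "infdist (q t) B < \<epsilon>"
  using life_right
proof (elim disjE exE conjE)
  assume "\<forall>x\<ge>0. x \<in> life"
  then show thesis using reaches_B[OF assms] that by metis
next
  fix b assume b: "0 < b" "\<forall>x\<in>{0..b}. x \<in> life" "V (q b) \<le> c"
  have "q b \<notin> A" using q_right[of b] b(1) separated infdist_zero[of "q b" A] by linarith
  then have "q b \<in> B" using in_wells_iff[of "q b"] b by simp
  then show thesis using that[of b] assms b by simp
qed

lemma life_reaches_A:
  assumes "\<epsilon> > 0"
  obtains t where "t \<in> life" "infdist (q t) A < \<epsilon>"
  using life_left
proof (elim disjE exE conjE)
  assume "\<forall>x\<le>0. x \<in> life"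
  then show thesis using reaches_A[OF assms] that by metis
next
  fix a assume a: "a < 0" "\<forall>x\<in>{a..0}. x \<in> life" "V (q a) \<le> c"
  have "q a \<notin> B" using q_left[of a] a(1) \<eta>_pos infdist_zero[of "q a" B] by linarith
  then have "q a \<in> A" using in_wells_iff[of "q a"] a by simp
  then show thesis using that[of a] assms a by simp
qed

theorem connecting_solution:
  obtains p v where "\<And>t. (p has_vector_derivative v t) (at t)"
    "\<And>t. (v has_vector_derivative G (p t)) (at t)"
    "\<And>t. (norm (v t))\<^sup>2 / 2 - V (p t) = - c"
    "\<And>\<epsilon>. \<epsilon> > 0 \<Longrightarrow> \<exists>t. infdist (p t) A < \<epsilon>" "\<And>\<epsilon>. \<epsilon> > 0 \<Longrightarrow> \<exists>t. infdist (p t) B < \<epsilon>"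
proof -
  obtain \<phi> \<sigma> where f: "\<And>t. \<exists>y>t. isometric_piece life vel \<phi> \<sigma> t y" "\<And>t. \<exists>x<t. isometric_piece life vel \<phi> \<sigma> x t"
    and id: "\<And>t. t \<in> life \<Longrightarrow> \<phi> t = t"
  proof (rule exists_folding)
    show "(\<forall>x\<ge>0. x \<in> life) \<or> (\<exists>b>0. (\<forall>x\<in>{0..b}. x \<in> life) \<and> vel b = 0 \<and> (\<forall>x>b. x \<notin> life))"
      using life_right by (auto simp: vel_def)
    show "(\<forall>x\<le>0. x \<in> life) \<or> (\<exists>a<0. (\<forall>x\<in>{a..0}. x \<in> life) \<and> vel a = 0 \<and> (\<forall>x<a. x \<notin> life))"
      using life_left by (auto simp: vel_def)
  qed blast
  note sol = folded_solution[OF life_segment f]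
  show ?thesis
  proof (rule that[of "\<lambda>t. q (\<phi> t)" "\<lambda>t. \<sigma> t *\<^sub>R vel (\<phi> t)"])
    show "((\<lambda>t. q (\<phi> t)) has_vector_derivative \<sigma> t *\<^sub>R vel (\<phi> t)) (at t)" for t by (rule sol)
    show "((\<lambda>t. \<sigma> t *\<^sub>R vel (\<phi> t)) has_vector_derivative G (q (\<phi> t))) (at t)" for t by (rule sol)
    show "(norm (\<sigma> t *\<^sub>R vel (\<phi> t)))\<^sup>2 / 2 - V (q (\<phi> t)) = - c" for t
    proof -
      have "\<phi> t \<in> life" by (rule sol)
      then have "W (q (\<phi> t)) = V (q (\<phi> t)) - c" using life_V_ge[of "\<phi> t"] by (simp add: W_def)
      moreover have "norm (\<sigma> t *\<^sub>R vel (\<phi> t)) = norm (vel (\<phi> t))" by (rule sol)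
      ultimately show ?thesis using vel_norm[OF \<open>\<phi> t \<in> life\<close>] by (simp add: field_simps del: norm_scaleR)
    qed
    \<comment> \<open>The folding is the identity on \<open>life\<close>, so the original approach
      to the well is part of the folded curve.\<close>
    show "\<exists>t. infdist (q (\<phi> t)) A < \<epsilon>" if "\<epsilon> > 0" for \<epsilon>
      using life_reaches_A[OF that] id by metis
    show "\<exists>t. infdist (q (\<phi> t)) B < \<epsilon>" if "\<epsilon> > 0" for \<epsilon>
      using life_reaches_B[OF that] id by metis
  qed
qed

end

section \<open>Coercivity\<close>

lemma L2_loc_set_integrable:
  assumes "g \<in> L2_loc"
  shows "set_integrable lborel {a..b} g"
  unfolding set_integrable_def
proof (rule Bochner_Integration.integrable_bound)
  have g: "g \<in> borel_measurable lborel" "set_integrable lborel {a..b} (\<lambda>t. (norm (g t))\<^sup>2)"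
    using assms by (auto simp: L2_loc_def)
  show "integrable lborel (\<lambda>t. indicator {a..b} t *\<^sub>R 1 + indicator {a..b} t *\<^sub>R (norm (g t))\<^sup>2 :: real)"
    using Bochner_Integration.integrable_add[OF borel_integrable_compact[of "{a..b}" "\<lambda>_. 1 :: real"]] g(2)
    unfolding set_integrable_def by simp
  show "(\<lambda>t. indicator {a..b} t *\<^sub>R g t) \<in> borel_measurable lborel"
    using g(1) by measurable
  have "x \<le> 1 + x\<^sup>2" for x :: real
  proof -
    have "2 * x \<le> x\<^sup>2 + 1" using sum_squares_bound[of x 1] by simp
    then show ?thesis using zero_le_power2[of x] by linarith
  qed
  then show "AE t in lborel. norm (indicator {a..b} t *\<^sub>R g t)
      \<le> norm (indicator {a..b} t *\<^sub>R 1 + indicator {a..b} t *\<^sub>R (norm (g t))\<^sup>2 :: real)"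
    by (intro AE_I2) (auto split: split_indicator)
qed

text \<open>A quadratic spline rising from 0 to 1 on the unit interval: class C1 is all that
  \<open>test_function\<close> demands. Writing it with \<open>max\<close> avoids case distinctions
  in the derivative.\<close>

definition smooth_step :: "real \<Rightarrow> real" where
  "smooth_step x = 2 * (max 0 x)\<^sup>2 - 4 * (max 0 (x - 1 / 2))\<^sup>2 + 2 * (max 0 (x - 1))\<^sup>2"

text \<open>The derivative of \<open>smooth_step\<close>: a hat of height 2 on the unit interval, of
  integral 1, hence a mollifier.\<close>

definition tent :: "real \<Rightarrow> real" where
  "tent x = 4 * max 0 x - 8 * max 0 (x - 1 / 2) + 4 * max 0 (x - 1)"

lemma has_real_derivative_max_square:
  "((\<lambda>x::real. (max 0 x)\<^sup>2) has_real_derivative 2 * max 0 x) (at x)"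
proof -
  consider "x < 0" | "x = 0" | "x > 0" by linarith
  then show ?thesis
  proof cases
    case 1
    have "((\<lambda>x::real. 0) has_real_derivative 2 * max 0 x) (at x)" using 1 by simp
    then show ?thesis
      by (rule has_field_derivative_transform_within_open[of _ _ _ "{..<0}"]) (use 1 in auto)
  next
    case 2
    have "((\<lambda>y::real. max 0 y) \<longlongrightarrow> max 0 0) (at 0)" by (intro tendsto_intros)
    then have "((\<lambda>y::real. max 0 y) \<longlongrightarrow> 0) (at 0)" by simp
    then have "((\<lambda>y::real. (max 0 y)\<^sup>2 / y) \<longlongrightarrow> 0) (at 0)"
      by (rule Lim_transform_eventually)
         (auto simp: eventually_at_filter power2_eq_square max_def intro!: always_eventually)
    then show ?thesis by (simp add: 2 has_field_derivative_iff)
  next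
    case 3
    have "((\<lambda>x::real. x\<^sup>2) has_real_derivative 2 * max 0 x) (at x)"
      using 3 by (auto intro!: derivative_eq_intros)
    then show ?thesis
      by (rule has_field_derivative_transform_within_open[of _ _ _ "{0<..}"]) (use 3 in auto)
  qed
qed

lemma has_real_derivative_smooth_step: "(smooth_step has_real_derivative tent x) (at x)"
proof -
  have *: "((\<lambda>x::real. (max 0 (x - c))\<^sup>2) has_real_derivative 2 * max 0 (x - c)) (at x)" for c
  proof -
    have "((\<lambda>x. x - c) has_real_derivative 1) (at x)" by (auto intro!: derivative_eq_intros)
    from DERIV_chain2[of "\<lambda>x. (max 0 x)\<^sup>2" _ "\<lambda>x. x - c", OF has_real_derivative_max_square this]
    show ?thesis by simp
  qed
  show ?thesis
    unfolding smooth_step_def[abs_def] tent_def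
    using DERIV_add[OF DERIV_diff[OF DERIV_cmult[OF has_real_derivative_max_square[of x], of 2]
          DERIV_cmult[OF *[of "1 / 2"], of 4]] DERIV_cmult[OF *[of 1], of 2]]
    by simp
qed

lemma smooth_step_simps: "x \<le> 0 \<Longrightarrow> smooth_step x = 0" "1 \<le> x \<Longrightarrow> smooth_step x = 1"
  by (auto simp: smooth_step_def max_def power2_eq_square algebra_simps)

lemma tent_bounds: "0 \<le> tent x" "tent x \<le> 2" "x \<notin> {0..1} \<Longrightarrow> tent x = 0"
  by (auto simp: tent_def max_def)

lemma smooth_step_bounds: "0 \<le> smooth_step x" "smooth_step x \<le> 1"
proof -
  have mono: "smooth_step x \<le> smooth_step y" if "x \<le> y" for x y
    using that has_real_derivative_smooth_step tent_bounds(1) DERIV_nonneg_imp_nondecreasing by metis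
  show "0 \<le> smooth_step x" using mono[of "min 0 x" x] by (simp add: smooth_step_simps)
  show "smooth_step x \<le> 1" using mono[of x "max 1 x"] by (simp add: smooth_step_simps)
qed

lemma continuous_on_tent: "continuous_on S tent"
  unfolding tent_def[abs_def] by (intro continuous_intros)

lemma tent_integral: "integrable lborel tent" "(LINT x|lborel. tent x) = 1"
proof -
  have eq: "(\<lambda>x. indicator {0..1} x *\<^sub>R tent x) = tent"
    using tent_bounds(3) by (intro ext) (auto split: split_indicator)
  show "integrable lborel tent"
    using borel_integrable_compact[OF compact_Icc continuous_on_tent, of 0 1] unfolding eq .
  have "(LINT x|lborel. indicator {0..1} x *\<^sub>R tent x) = smooth_step 1 - smooth_step 0"
    using has_real_derivative_smooth_step
    by (intro integral_FTC_atLeastAtMost continuous_on_tent)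
       (auto simp: has_real_derivative_iff_has_vector_derivative intro: has_vector_derivative_at_within)
  then show "(LINT x|lborel. tent x) = 1" unfolding eq by (simp add: smooth_step_simps)
qed

text \<open>After rescaling, the kernel is fixed and the argument of \<open>q\<close> tends to
  \<open>a\<close> from the right; dominated convergence applies because all arguments stay in
  \<open>a..a + 1\<close>.\<close>

lemma mollified_value_tendsto:
  fixes q :: "real \<Rightarrow> 'a::euclidean_space"
  assumes q: "continuous_on UNIV q"
  shows "(\<lambda>n. LINT t|lborel. (real (Suc n) * tent (real (Suc n) * (t - a))) *\<^sub>R q t) \<longlonglongrightarrow> q a"
proof -
  have "compact (q ` {a..a + 1})"
    by (intro compact_continuous_image continuous_on_subset[OF q]) auto
  then obtain C where C: "\<And>t. t \<in> {a..a + 1} \<Longrightarrow> norm (q t) \<le> C"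
    using compact_imp_bounded bounded_iff by (metis imageI)
  have qm: "q \<in> borel_measurable borel" using q by (rule borel_measurable_continuous_onI)
  have tm: "tent \<in> borel_measurable borel" by (rule borel_measurable_continuous_onI[OF continuous_on_tent])
  have eq: "(LINT t|lborel. (real (Suc n) * tent (real (Suc n) * (t - a))) *\<^sub>R q t)
      = (LINT s|lborel. tent s *\<^sub>R q (a + s / real (Suc n)))" for n
    by (subst lborel_integral_real_affine[of "1 / real (Suc n)" _ a])
       (auto simp: field_simps simp flip: integral_scaleR_right simp del: of_nat_Suc)
  have "(\<lambda>n. LINT s|lborel. tent s *\<^sub>R q (a + s / real (Suc n))) \<longlonglongrightarrow> (LINT s|lborel. tent s *\<^sub>R q a)"
  proof (rule integral_dominated_convergence[where w = "\<lambda>s. indicator {0..1} s *\<^sub>R (2 * C)"])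
    show "integrable lborel (\<lambda>s::real. indicator {0..1} s *\<^sub>R (2 * C))"
      by (rule borel_integrable_compact[OF compact_Icc continuous_on_const])
    show "(\<lambda>s. tent s *\<^sub>R q a) \<in> borel_measurable lborel" using tm by measurable
    show "(\<lambda>s. tent s *\<^sub>R q (a + s / real (Suc n))) \<in> borel_measurable lborel" for n
      using tm qm by measurable
    show "AE s in lborel. (\<lambda>n. tent s *\<^sub>R q (a + s / real (Suc n))) \<longlonglongrightarrow> tent s *\<^sub>R q a"
    proof (intro AE_I2 tendsto_scaleR tendsto_const)
      fix s
      have "(\<lambda>n. a + s * inverse (real (Suc n))) \<longlonglongrightarrow> a + s * 0"
        by (intro tendsto_intros LIMSEQ_inverse_real_of_nat)
      then have "(\<lambda>n. a + s / real (Suc n)) \<longlonglongrightarrow> a" by (simp add: divide_inverse)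
      then show "(\<lambda>n. q (a + s / real (Suc n))) \<longlonglongrightarrow> q a"
        using continuous_on_tendsto_compose[OF q] by simp
    qed
    show "AE s in lborel. norm (tent s *\<^sub>R q (a + s / real (Suc n))) \<le> indicator {0..1} s *\<^sub>R (2 * C)" for n
    proof (rule AE_I2)
      fix s
      show "norm (tent s *\<^sub>R q (a + s / real (Suc n))) \<le> indicator {0..1} s *\<^sub>R (2 * C)"
      proof (cases "s \<in> {0..1}")
        case True
        then have "s \<le> real (Suc n)" by simp
        then have "norm (q (a + s / real (Suc n))) \<le> C" using True by (intro C) (auto simp: divide_le_eq simp del: of_nat_Suc)
        then have "norm (tent s *\<^sub>R q (a + s / real (Suc n))) \<le> 2 * C"
          using tent_bounds[of s] by (simp add: mult_mono del: of_nat_Suc)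
        then show ?thesis using True by simp
      qed (simp add: tent_bounds(3))
    qed
  qed
  then show ?thesis unfolding eq by (simp add: tent_integral)
qed

text \<open>Testing with smoothed indicators of \<open>a<..b\<close>: the derivative side tends to
  \<open>q a - q b\<close> by mollification, the other side to the integral of
  \<open>g\<close>.\<close>

lemma weak_derivative_increment:
  fixes q g :: "real \<Rightarrow> 'a::euclidean_space"
  assumes q: "continuous_on UNIV q" and g: "g \<in> L2_loc" and weak: "is_weak_derivative q g" and ab: "a \<le> b"
  shows "norm (q b - q a) \<le> (LINT t:{a..b}|lborel. norm (g t))"
proof -
  define N where "N n = real (Suc n)" for n
  have N: "N n \<ge> 1" for n by (simp add: N_def)
  \<comment> \<open>The step at \<open>b\<close> is complete by \<open>b + 1\<close> since
    \<open>N n\<close> is at least 1, so all supports lie in \<open>a..b + 1\<close>.\<close>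
  define \<phi> where "\<phi> n t = smooth_step (N n * (t - a)) - smooth_step (N n * (t - b))" for n t
  define \<phi>' where "\<phi>' n t = N n * tent (N n * (t - a)) - N n * tent (N n * (t - b))" for n t
  have deriv: "(\<phi> n has_real_derivative \<phi>' n t) (at t)" for n t
    unfolding \<phi>_def[abs_def] \<phi>'_def
    by (auto intro!: derivative_eq_intros DERIV_chain2[OF has_real_derivative_smooth_step])
  have supp: "\<phi> n t = 0" if "t \<notin> {a..b + 1}" for n t
  proof (cases "t < a")
    case True
    then have "N n * (t - a) \<le> 0" "N n * (t - b) \<le> 0"
      using ab N[of n] by (auto simp: mult_le_0_iff)
    then show ?thesis by (simp add: \<phi>_def smooth_step_simps)
  next
    case False
    then have "1 \<le> t - b" "1 \<le> t - a" using that ab by auto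
    then have "1 * 1 \<le> N n * (t - a)" "1 * 1 \<le> N n * (t - b)"
      using N[of n] by (intro mult_mono; simp)+
    then show ?thesis by (simp add: \<phi>_def smooth_step_simps)
  qed
  have \<phi>'_cont: "continuous_on UNIV (\<phi>' n)" for n
    unfolding \<phi>'_def[abs_def]
    by (intro continuous_intros continuous_on_compose2[OF continuous_on_tent[of UNIV]]) auto
  have test: "test_function (\<phi> n)" for n
    unfolding test_function_def
  proof
    show "\<phi> n C1_differentiable_on UNIV"
      unfolding C1_differentiable_on_def
      using deriv \<phi>'_cont by (auto simp: has_real_derivative_iff_has_vector_derivative)
    have "closure {t. \<phi> n t \<noteq> 0} \<subseteq> {a..b + 1}"
    proof (rule closure_minimal)
      show "{t. \<phi> n t \<noteq> 0} \<subseteq> {a..b + 1}" using supp[of _ n] by blast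
    qed simp
    then show "compact (closure {t. \<phi> n t \<noteq> 0})"
      by (meson bounded_closed_interval bounded_subset closed_closure compact_eq_bounded_closed)
  qed
  have part: "integrable lborel (\<lambda>t. (N n * tent (N n * (t - x))) *\<^sub>R q t)" for n x
  proof -
    have "integrable lborel (\<lambda>t. indicator {x..x + 1} t *\<^sub>R ((N n * tent (N n * (t - x))) *\<^sub>R q t))"
      by (intro borel_integrable_compact continuous_intros continuous_on_subset[OF q]
          continuous_on_compose2[OF continuous_on_tent[of UNIV]]) auto
    moreover have "tent (N n * (t - x)) = 0" if "t \<notin> {x..x + 1}" for t
    proof (rule tent_bounds(3))
      consider "t - x < 0" | "1 < t - x" using \<open>t \<notin> {x..x + 1}\<close> by force
      then show "N n * (t - x) \<notin> {0..1}"
      proof cases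
        case 1
        then have "N n * (t - x) < 0" using N[of n] by (simp add: mult_less_0_iff)
        then show ?thesis by simp
      next
        case 2
        then have "1 * 1 < N n * (t - x)" using N[of n] by (intro mult_le_less_imp_less) auto
        then show ?thesis by simp
      qed
    qed
    then have "(\<lambda>t. indicator {x..x + 1} t *\<^sub>R ((N n * tent (N n * (t - x))) *\<^sub>R q t))
        = (\<lambda>t. (N n * tent (N n * (t - x))) *\<^sub>R q t)"
      by (intro ext) (auto split: split_indicator)
    ultimately show ?thesis by simp
  qed
  have left: "(LINT t|lborel. deriv (\<phi> n) t *\<^sub>R q t)
      = (LINT t|lborel. (N n * tent (N n * (t - a))) *\<^sub>R q t) - (LINT t|lborel. (N n * tent (N n * (t - b))) *\<^sub>R q t)" for n
    using Bochner_Integration.integral_diff[OF part[of n a] part[of n b]]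
    by (simp add: DERIV_imp_deriv[OF deriv] \<phi>'_def scaleR_diff_left)
  have eq: "(LINT t|lborel. \<phi> n t *\<^sub>R g t)
      = (LINT t|lborel. (N n * tent (N n * (t - b))) *\<^sub>R q t) - (LINT t|lborel. (N n * tent (N n * (t - a))) *\<^sub>R q t)" for n
  proof -
    have "(LINT t|lborel. deriv (\<phi> n) t *\<^sub>R q t) = - (LINT t|lborel. \<phi> n t *\<^sub>R g t)"
      using weak test[of n] unfolding is_weak_derivative_def by blast
    then have "(LINT t|lborel. \<phi> n t *\<^sub>R g t) = - (LINT t|lborel. deriv (\<phi> n) t *\<^sub>R q t)" by simp
    then show ?thesis unfolding left minus_diff_eq .
  qed
  have "(\<lambda>n. LINT t|lborel. \<phi> n t *\<^sub>R g t) \<longlonglongrightarrow> q b - q a"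
    unfolding eq N_def by (intro tendsto_diff mollified_value_tendsto q)
  moreover have "(\<lambda>n. LINT t|lborel. \<phi> n t *\<^sub>R g t) \<longlonglongrightarrow> (LINT t|lborel. indicator {a<..b} t *\<^sub>R g t)"
  proof (rule integral_dominated_convergence[where w = "\<lambda>t. norm (indicator {a..b + 1} t *\<^sub>R g t)"])
    have gm: "g \<in> borel_measurable lborel" using g by (simp add: L2_loc_def)
    have \<phi>m: "\<phi> n \<in> borel_measurable borel" for n
      using deriv by (intro borel_measurable_continuous_onI continuous_at_imp_continuous_on) (auto intro: DERIV_isCont)
    show "integrable lborel (\<lambda>t. norm (indicator {a..b + 1} t *\<^sub>R g t))"
      using L2_loc_set_integrable[OF g, of a "b + 1"] unfolding set_integrable_def by (rule integrable_norm)
    show "(\<lambda>t. indicator {a<..b} t *\<^sub>R g t) \<in> borel_measurable lborel" using gm by measurable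
    show "(\<lambda>t. \<phi> n t *\<^sub>R g t) \<in> borel_measurable lborel" for n using gm \<phi>m[of n] by measurable
    show "AE t in lborel. (\<lambda>n. \<phi> n t *\<^sub>R g t) \<longlonglongrightarrow> indicator {a<..b} t *\<^sub>R g t"
    proof (intro AE_I2 tendsto_scaleR tendsto_const)
      fix t
      have step: "(\<lambda>n. smooth_step (N n * (t - x))) \<longlonglongrightarrow> indicator {x<..} t" for x
      proof (cases "t \<le> x")
        case True
        then have "N n * (t - x) \<le> 0" for n using N[of n] by (auto simp: mult_le_0_iff)
        then show ?thesis using True by (simp add: smooth_step_simps)
      next
        case False
        obtain n0 where n0: "1 / (t - x) < real n0" using reals_Archimedean2 by blast
        have "smooth_step (N n * (t - x)) = 1" if "n \<ge> n0" for n
        proof -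
          have "1 / (t - x) \<le> N n" using n0 that by (simp add: N_def)
          then have "1 \<le> N n * (t - x)" using False by (simp add: divide_le_eq)
          then show ?thesis by (rule smooth_step_simps)
        qed
        then have "\<forall>\<^sub>F n in sequentially. smooth_step (N n * (t - x)) = 1"
          by (auto simp: eventually_sequentially)
        then have "(\<lambda>n. smooth_step (N n * (t - x))) \<longlonglongrightarrow> 1" by (rule tendsto_eventually)
        then show ?thesis using False by simp
      qed
      have "(\<lambda>n. \<phi> n t) \<longlonglongrightarrow> indicator {a<..} t - indicator {b<..} t"
        unfolding \<phi>_def by (intro tendsto_diff step)
      moreover have "indicator {a<..} t - indicator {b<..} t = (indicator {a<..b} t :: real)"
        using ab by (auto split: split_indicator)
      ultimately show "(\<lambda>n. \<phi> n t) \<longlonglongrightarrow> indicator {a<..b} t" by simp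
    qed
    show "AE t in lborel. norm (\<phi> n t *\<^sub>R g t) \<le> norm (indicator {a..b + 1} t *\<^sub>R g t)" for n
    proof (rule AE_I2)
      fix t
      have "\<bar>\<phi> n t\<bar> \<le> indicator {a..b + 1} t"
        using supp[of t n] smooth_step_bounds[of "N n * (t - a)"] smooth_step_bounds[of "N n * (t - b)"]
        by (auto simp: \<phi>_def split: split_indicator)
      then show "norm (\<phi> n t *\<^sub>R g t) \<le> norm (indicator {a..b + 1} t *\<^sub>R g t)"
        by (simp add: mult_right_mono)
    qed
  qed
  ultimately have "q b - q a = (LINT t|lborel. indicator {a<..b} t *\<^sub>R g t)"
    by (rule LIMSEQ_unique)
  also have "norm \<dots> \<le> (LINT t|lborel. norm (indicator {a<..b} t *\<^sub>R g t))"
    by (rule integral_norm_bound)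
  also have "\<dots> \<le> (LINT t|lborel. norm (indicator {a..b} t *\<^sub>R g t))"
  proof (rule integral_mono')
    show "integrable lborel (\<lambda>t. norm (indicator {a..b} t *\<^sub>R g t))"
      using L2_loc_set_integrable[OF g, of a b] unfolding set_integrable_def by (rule integrable_norm)
  qed (auto split: split_indicator)
  finally show ?thesis by (simp add: set_lebesgue_integral_def)
qed

text \<open>On \<open>a..b\<close> the integrand dominates \<open>sqrt (2 * e)\<close> times the
  speed by the inequality of the means; elsewhere it is nonnegative because \<open>V\<close> stays
  above \<open>c\<close>.\<close>

lemma action_lower_bound:
  fixes q :: "real \<Rightarrow> 'a::euclidean_space"
  assumes q: "q \<in> H1_loc" and V: "\<And>t. c \<le> V (q t)" and "a \<le> b" "e > 0"
    and e: "\<And>t. t \<in> {a..b} \<Longrightarrow> c + e \<le> V (q t)"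
  shows "ennreal (sqrt (2 * e) * norm (q b - q a)) \<le> J V c q"
proof -
  define g where "g = weak_derivative q"
  \<comment> \<open>Membership in \<open>H1_loc\<close> guarantees that the choice in
    \<open>weak_derivative\<close> returns a genuine weak derivative.\<close>
  have "\<exists>g. g \<in> L2_loc \<and> is_weak_derivative q g" using q by (auto simp: H1_loc_def)
  from someI_ex[OF this] have g: "g \<in> L2_loc" "is_weak_derivative q g"
    by (auto simp: g_def weak_derivative_def)
  have i: "integrable lborel (\<lambda>t. norm (indicator {a..b} t *\<^sub>R g t))"
    using L2_loc_set_integrable[OF g(1), of a b] unfolding set_integrable_def by (rule integrable_norm)
  have "norm (q b - q a) \<le> (LINT t|lborel. norm (indicator {a..b} t *\<^sub>R g t))"
    using weak_derivative_increment[OF _ g \<open>a \<le> b\<close>] q by (simp add: H1_loc_def set_lebesgue_integral_def)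
  then have "sqrt (2 * e) * norm (q b - q a) \<le> sqrt (2 * e) * (LINT t|lborel. norm (indicator {a..b} t *\<^sub>R g t))"
    using \<open>e > 0\<close> by (intro mult_left_mono) auto
  also have "\<dots> = (LINT t|lborel. sqrt (2 * e) * norm (indicator {a..b} t *\<^sub>R g t))"
    by (rule integral_mult_right_zero[symmetric])
  finally have "ennreal (sqrt (2 * e) * norm (q b - q a))
      \<le> ennreal (LINT t|lborel. sqrt (2 * e) * norm (indicator {a..b} t *\<^sub>R g t))"
    by (rule ennreal_leI)
  also have "\<dots> = (\<integral>\<^sup>+ t. ennreal (sqrt (2 * e) * norm (indicator {a..b} t *\<^sub>R g t)) \<partial>lborel)"
    using \<open>e > 0\<close> by (intro nn_integral_eq_integral[symmetric] integrable_mult_right i) auto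
  also have "\<dots> \<le> J V c q"
    unfolding J_def g_def[symmetric]
  proof (intro nn_integral_mono ennreal_leI)
    fix t
    show "sqrt (2 * e) * norm (indicator {a..b} t *\<^sub>R g t) \<le> 1 / 2 * (norm (g t))\<^sup>2 + (V (q t) - c)"
    proof (cases "t \<in> {a..b}")
      case True
      have "2 * (sqrt (2 * e) * norm (g t)) \<le> 2 * e + (norm (g t))\<^sup>2"
        using sum_squares_bound[of "sqrt (2 * e)" "norm (g t)"] \<open>e > 0\<close> by simp
      then show ?thesis using True e[OF True] by simp
    qed (use V[of t] in simp)
  qed
  finally show ?thesis .
qed

lemma Gam_visits_ball:
  assumes "q \<in> Gam V c Vm Vp" and R: "\<And>x. x \<in> Vm \<Longrightarrow> norm x \<le> R" and Vm: "closed Vm" "Vm \<noteq> {}"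
  obtains s where "s \<le> t" "norm (q s) \<le> R + 1"
proof -
  have "\<exists>s\<le>t. infdist (q s) Vm < 1"
  proof (rule ccontr)
    assume "\<not> (\<exists>s\<le>t. infdist (q s) Vm < 1)"
    then have "1 \<le> infdist (q s) Vm" if "s \<le> t" for s using that by (meson not_le)
    then have "\<forall>\<^sub>F s in at_bot. (1 :: ereal) \<le> ereal (infdist (q s) Vm)"
      unfolding eventually_at_bot_linorder by (intro exI[of _ t]) simp
    then have "1 \<le> Liminf at_bot (\<lambda>s. ereal (infdist (q s) Vm))" by (rule Liminf_bounded)
    then show False using assms(1) by (simp add: Gam_def)
  qed
  then obtain s where s: "s \<le> t" "infdist (q s) Vm < 1" by blast
  obtain y where "y \<in> Vm" "infdist (q s) Vm = dist (q s) y"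
    using infdist_attains_inf[OF Vm] by metis
  then have "norm (q s) \<le> R + 1"
    using norm_triangle_sub[of "q s" y] R[of y] s(2) by (simp add: dist_norm)
  then show ?thesis using that s(1) by blast
qed

lemma (in split_potential) coercive_wells: "coercive V c A B"
proof -
  define m where "m = (INF q \<in> Gam V c A B. J V c q)"
  obtain R0 e where e: "e > 0" "\<And>x. R0 \<le> norm x \<Longrightarrow> c + e \<le> V x"
    using large_at_infinity by blast
  have A: "norm x \<le> R0" if "x \<in> A" for x
  proof (rule ccontr)
    assume "\<not> norm x \<le> R0"
    then have "c + e \<le> V x" by (intro e(2)) simp
    moreover have "V x \<le> c" using that in_wells_iff by blast
    ultimately show False using e(1) by simp
  qed
  \<comment> \<open>\<open>R0 + 1\<close> is a level below which the curve lies at some earlier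
    time, and the quotient is the longest excursion that an action below \<open>m + 1\<close> can
    pay for. The absolute value makes \<open>R\<close> positive.\<close>
  define R where "R = \<bar>R0\<bar> + 2 + enn2real (m + 1) / sqrt (2 * e)"
  have "R > 0" using e(1) by (simp add: R_def add_pos_nonneg)
  have bound: "norm (q t) \<le> R" if q: "q \<in> Gam V c A B" and J: "J V c q < m + 1" and fin: "m < top" for q t
  proof (rule ccontr)
    assume big: "\<not> norm (q t) \<le> R"
    obtain s where s: "s \<le> t" "norm (q s) \<le> R0 + 1"
      using Gam_visits_ball[OF q A wells(3,1)] by blast
    have H1: "q \<in> H1_loc" "\<And>t. c \<le> V (q t)" using q by (auto simp: Gam_def)
    then have "continuous_on UNIV q" by (simp add: H1_loc_def)
    then have cont: "continuous_on {s..t} (\<lambda>t. norm (q t))"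
      by (intro continuous_intros) (rule continuous_on_subset, auto)
    have "0 \<le> enn2real (m + 1) / sqrt (2 * e)" using e(1) by simp
    then have less: "R0 + 1 < norm (q t)" using big by (simp add: R_def)
    \<comment> \<open>The piece of the excursion that lies entirely outside the ball of radius
      \<open>R0 + 1\<close>, where the gap \<open>e\<close> is available.\<close>
    obtain u v where uv: "s \<le> u" "u \<le> v" "v \<le> t" "norm (q u) = R0 + 1" "norm (q v) = norm (q t)"
      "\<And>x. x \<in> {u..v} \<Longrightarrow> R0 + 1 \<le> norm (q x) \<and> norm (q x) \<le> norm (q t)"
      by (rule crossing_interval[OF cont s order_refl less]) (assumption | rule that)+
    have "c + e \<le> V (q x)" if "x \<in> {u..v}" for x
      using uv(6)[OF that] by (intro e(2)) simp
    then have "ennreal (sqrt (2 * e) * norm (q v - q u)) \<le> J V c q"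
      using H1 uv(2) e(1) by (intro action_lower_bound) auto
    also have "\<dots> < m + 1" by (rule J)
    finally have lt: "ennreal (sqrt (2 * e) * norm (q v - q u)) < m + 1" .
    then have "ennreal (sqrt (2 * e) * norm (q v - q u)) < ennreal (enn2real (m + 1))"
      using fin by (simp add: ennreal_enn2real)
    then have "sqrt (2 * e) * norm (q v - q u) < enn2real (m + 1)"
      using e(1) by (subst (asm) ennreal_less_iff) auto
    moreover have "enn2real (m + 1) / sqrt (2 * e) \<le> norm (q v - q u)"
      using norm_triangle_ineq2[of "q v" "q u"] uv(4,5) big by (simp add: R_def)
    then have "enn2real (m + 1) \<le> sqrt (2 * e) * norm (q v - q u)"
      using e(1) by (simp add: pos_divide_le_eq mult.commute)
    ultimately show False by simp
  qed
  have le: "m \<le> (INF q \<in> {q \<in> Gam V c A B. Linfty_norm q \<le> ereal r}. J V c q)" for r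
    unfolding m_def by (intro INF_superset_mono) auto
  show ?thesis
  proof (cases "m = top")
    \<comment> \<open>With infinite infimum there is no curve of finite action; the infimum over a
      smaller set is infinite as well, so any radius will do.\<close>
    case True
    then show ?thesis
      using le[of 1] unfolding coercive_def m_def[symmetric]
      by (intro exI[of _ 1]) (simp add: top_unique)
  next
    case False
    then have fin: "m < top" by (simp add: less_top)
    have "(INF q \<in> {q \<in> Gam V c A B. Linfty_norm q \<le> ereal R}. J V c q) \<le> m"
    proof (rule ccontr)
      define M where "M = (INF q \<in> {q \<in> Gam V c A B. Linfty_norm q \<le> ereal R}. J V c q)"
      assume "\<not> (INF q \<in> {q \<in> Gam V c A B. Linfty_norm q \<le> ereal R}. J V c q) \<le> m"
      then have "m < M" by (simp add: M_def)
      moreover have "m < m + 1"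
        using ennreal_add_left_cancel_less[of m 0 1] fin by simp
      \<comment> \<open>One curve is enough: action below \<open>M\<close> and below
        \<open>m + 1\<close> makes it admissible for \<open>M\<close> by the bound, a
        contradiction.\<close>
      ultimately have "(INF q \<in> Gam V c A B. J V c q) < min M (m + 1)"
        unfolding m_def[symmetric] by simp
      then obtain q where q: "q \<in> Gam V c A B" "J V c q < min M (m + 1)"
        unfolding INF_less_iff by blast
      have "q \<in> borel_measurable borel"
        using q(1) by (auto simp: Gam_def H1_loc_def intro: borel_measurable_continuous_onI)
      then have "Linfty_norm q \<le> ereal R"
        unfolding Linfty_norm_def using bound[OF q(1) _ fin] q(2)
        by (intro esssup_I AE_I2) auto
      then have "M \<le> J V c q" unfolding M_def using q(1) by (intro INF_lower) simp
      then show False using q(2) by (meson leD min_less_iff_conj)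
    qed
    then show ?thesis
      using le[of R] \<open>R > 0\<close> unfolding coercive_def m_def[symmetric] by (intro exI[of _ R]) simp
  qed
qed

section \<open>The main theorem\<close>

text \<open>\<open>grad\<close> is a definite description, so existence comes from the Riesz
  representative of the derivative and uniqueness from testing with \<open>E - D\<close>.\<close>

lemma C1_function_GDERIV:
  fixes V :: "'a::euclidean_space \<Rightarrow> real"
  assumes "C1_function V"
  shows "GDERIV V x :> grad V x"
proof -
  obtain f where f: "(V has_derivative f) (at x)"
    using assms by (auto simp: C1_function_def differentiable_def)
  then have lin: "linear f" using has_derivative_linear by blast
  define D where "D = (\<Sum>i\<in>Basis. f i *\<^sub>R i)"
  have "f h = h \<bullet> D" for h
  proof -
    have "f h = f (\<Sum>i\<in>Basis. (h \<bullet> i) *\<^sub>R i)" by (simp add: euclidean_representation)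
    also have "\<dots> = (\<Sum>i\<in>Basis. (h \<bullet> i) * f i)"
      by (simp add: linear_sum[OF lin] linear_cmul[OF lin])
    also have "\<dots> = h \<bullet> D" by (simp add: D_def inner_sum_right mult.commute)
    finally show ?thesis .
  qed
  then have "f = (\<lambda>h. h \<bullet> D)" by (rule ext)
  with f have D: "GDERIV V x :> D" by (simp add: gderiv_def)
  moreover have "E = D" if "GDERIV V x :> E" for E
  proof -
    have "(\<lambda>h. h \<bullet> E) = (\<lambda>h. h \<bullet> D)"
      using that D unfolding gderiv_def by (rule has_derivative_unique)
    then have "(E - D) \<bullet> E = (E - D) \<bullet> D" by metis
    then have "(E - D) \<bullet> (E - D) = 0" by (simp add: inner_diff_right)
    then show ?thesis by simp
  qed
  ultimately show ?thesis unfolding grad_def by (rule theI)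
qed

lemma INF_eq_0:
  fixes f :: "real \<Rightarrow> real"
  assumes "\<And>t. 0 \<le> f t" "\<And>\<epsilon>. \<epsilon> > 0 \<Longrightarrow> \<exists>t. f t < \<epsilon>"
  shows "(INF t. f t) = 0"
proof (rule antisym)
  show "0 \<le> (INF t. f t)" by (rule cINF_greatest) (auto simp: assms(1))
  show "(INF t. f t) \<le> 0"
  proof (rule field_le_epsilon)
    fix \<epsilon> :: real assume "\<epsilon> > 0"
    then obtain t where "f t < \<epsilon>" using assms(2) by blast
    moreover have "(INF t. f t) \<le> f t"
      by (rule cINF_lower) (auto intro!: bdd_belowI2[of _ 0] assms(1))
    ultimately show "(INF t. f t) \<le> 0 + \<epsilon>" by simp
  qed
qed

lemma split_potentialI:
  fixes V :: "'a::euclidean_space \<Rightarrow> real"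
  assumes "C1_function V" "ereal c < Liminf at_infinity (\<lambda>x. ereal (V x))" "splits_sublevel V c A B"
  shows "split_potential V c A B"
proof
  show "continuous_on UNIV V"
    using assms(1) by (auto simp: C1_function_def intro!: continuous_at_imp_continuous_on differentiable_imp_continuous_within)
  show "A \<noteq> {}" "B \<noteq> {}" "closed A" "closed B" "{x. V x \<le> c} = A \<union> B" "setdist A B > 0"
    using assms(3) by (auto simp: splits_sublevel_def sublevel_def)
  \<comment> \<open>A level strictly between \<open>c\<close> and the liminf turns the strict
    inequality, even for an infinite liminf, into the uniform gap \<open>r - c\<close>.\<close>
  obtain r where r: "ereal c < ereal r" "ereal r < Liminf at_infinity (\<lambda>x. ereal (V x))"
    using ereal_dense2[OF assms(2)] by blast
  then have "\<forall>\<^sub>F x in at_infinity. ereal r < ereal (V x)" by (intro less_LiminfD)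
  then obtain R where "\<And>x. R \<le> norm x \<Longrightarrow> r < V x"
    unfolding eventually_at_infinity by auto
  then show "\<exists>R e. e > 0 \<and> (\<forall>x. R \<le> norm x \<longrightarrow> c + e \<le> V x)"
    using r(1) by (intro exI[of _ R] exI[of _ "r - c"]) (auto intro: less_imp_le)
qed

theorem proposition3p1:
  fixes V :: "real ^ 'n \<Rightarrow> real"
    and am ap :: "real ^ 'n"
    and \<nu>\<^sub>0 :: ereal
    and c :: real
    and Vm Vp :: "(real ^ 'n) set"
  assumes dim: "CARD('n) \<ge> 2"
    and C1: "C1_function V"
    and V1: "am \<noteq> ap" "V ap = 0" "V am = 0" "\<And>x. x \<notin> {am, ap} \<Longrightarrow> V x > 0"
    and V2: "Liminf at_infinity (\<lambda>x. ereal (V x)) = \<nu>\<^sub>0" "\<nu>\<^sub>0 > 0"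
    and c: "0 \<le> c" "ereal c < \<nu>\<^sub>0"
    and Vc: "splits_sublevel V c Vm Vp"
  shows "coercive V c Vm Vp \<and>
    (\<exists>q. C2_curve q \<and>
      (\<forall>t. velocity (velocity q) t = grad V (q t)) \<and>
      (INF t. infdist (q t) Vm) = 0 \<and>
      (INF t. infdist (q t) Vp) = 0 \<and>
      (\<forall>t. energy V q t = - c))"
proof
  interpret split_potential V c Vm Vp
    using split_potentialI[OF C1 _ Vc] c V2 by simp
  show "coercive V c Vm Vp" by (rule coercive_wells)
  obtain \<eta> q m where min: "\<eta> > 0" "near_minimizer \<eta> 0 q m" using minimizer_exists by blast
  have G: "continuous_on UNIV (grad V)" using C1 by (simp add: C1_function_def)
  interpret minimal_curve V c Vm Vp "grad V" \<eta> q m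
    by unfold_locales (rule C1_function_GDERIV[OF C1] G min)+
  obtain p v where p: "\<And>t. (p has_vector_derivative v t) (at t)"
    and v: "\<And>t. (v has_vector_derivative grad V (p t)) (at t)"
    and energy: "\<And>t. (norm (v t))\<^sup>2 / 2 - V (p t) = - c"
    and ends: "\<And>\<epsilon>. \<epsilon> > 0 \<Longrightarrow> \<exists>t. infdist (p t) Vm < \<epsilon>" "\<And>\<epsilon>. \<epsilon> > 0 \<Longrightarrow> \<exists>t. infdist (p t) Vp < \<epsilon>"
    by (rule connecting_solution) blast
  have vel: "velocity p = v" "velocity v = (\<lambda>t. grad V (p t))"
    using p v by (auto simp: velocity_def vector_derivative_at)
  have "continuous_on UNIV p" "continuous_on UNIV v"
    using p v by (auto intro!: continuous_at_imp_continuous_on has_vector_derivative_continuous)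
  moreover from this have "continuous_on UNIV (\<lambda>t. grad V (p t))"
    by (intro continuous_on_compose2[OF G]) auto
  ultimately have "C2_curve p"
    unfolding C2_curve_def vel C1_differentiable_on_def using p v
    by (intro conjI exI[of _ v] exI[of _ "\<lambda>t. grad V (p t)"]) auto
  moreover have "(INF t. infdist (p t) Vm) = 0" "(INF t. infdist (p t) Vp) = 0"
    by (rule INF_eq_0[OF infdist_nonneg]; rule ends; assumption)+
  moreover have "\<forall>t. energy V p t = - c"
    using energy by (simp add: energy_def vel)
  ultimately show "\<exists>q. C2_curve q \<and> (\<forall>t. velocity (velocity q) t = grad V (q t)) \<and>
      (INF t. infdist (q t) Vm) = 0 \<and> (INF t. infdist (q t) Vp) = 0 \<and> (\<forall>t. energy V q t = - c)"
    by (intro exI[of _ p]) (simp add: vel)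
qed

end
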